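(* Let $f(z)=\sum_{k=0}^\infty a_k z^k$ with $\{a_k\}_{k\ge 0}$ i.i.d. real standard Gaussian random variables, and let $\rho_1,\rho_2$ be the $1$- and $2$-point correlation functions of the real zeros of $f$ in $(-1,1)$. Let $R(s,t)=\frac{\rho_2(s,t)}{\rho_1(s)\rho_1(t)}$ be the normalized $2$-point correlation function, with the values at $t=\pm1$ understood as limits $R(s,\pm1)=\lim_{t\to\pm1}R(s,t)$. Then for every $s\in(-1,1)$: $R(s,s)=0$, $R(s,\pm1)=1$, and $t\mapsto R(s,t)$ is strictly increasing on $[s,1]$ and strictly decreasing on $[-1,s]$. In particular, $\rho_2(s,t)\le\rho_1(s)\rho_1(t)$ for all $s,t\in(-1,1)$.
   Context: The $n$-point correlation function of a point process on $(-1,1)$ is the density $\rho_n$, with respect to Lebesgue measure on $(-1,1)^n$, of its $n$-th factorial moment measure; i.e. for pairwise disjoint Borel sets $B_1,\dots,B_n\subset(-1,1)$, $E[\prod_i N(B_i)]=\int_{B_1\times\cdots\times B_n}\rho_n$, where $N(B)$ is the number of points in $B$. The continuous versions of $\rho_1$ and $\rho_2$ (on $(-1,1)$ and $(-1,1)^2$) are taken. *)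

theory Defs
  imports "HOL-Probability.Probability"
begin

text \<open>Number of points of the configuration \<open>X\<close> in \<open>B\<close>, with value \<open>\<infinity>\<close> if there are infinitely many.\<close>

definition num_points :: "real set \<Rightarrow> real set \<Rightarrow> ennreal" where
  "num_points X B = emeasure (count_space UNIV) (X \<inter> B)"

text \<open>Points of \<open>D\<^sup>n\<close> are represented as extensional functions on \<open>{..<n}\<close>.  Expectation and integral are
  nonnegative (lower) integrals, so both sides may be infinite.\<close>

definition correlation_function ::
    "'a measure \<Rightarrow> real set \<Rightarrow> ('a \<Rightarrow> real set) \<Rightarrow> nat \<Rightarrow> ((nat \<Rightarrow> real) \<Rightarrow> real) \<Rightarrow> bool" where
  "correlation_function M D Z n \<rho> \<longleftrightarrow>
     \<rho> \<in> borel_measurable (\<Pi>\<^sub>M i\<in>{..<n}. restrict_space lborel D) \<and>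
     (\<forall>x \<in> {..<n} \<rightarrow>\<^sub>E D. 0 \<le> \<rho> x) \<and>
     (\<forall>B :: nat \<Rightarrow> real set.
        (\<forall>i<n. B i \<in> sets borel \<and> B i \<subseteq> D) \<and> disjoint_family_on B {..<n} \<longrightarrow>
        (\<integral>\<^sup>+\<omega>. (\<Prod>i<n. num_points (Z \<omega>) (B i)) \<partial>M) =
        (\<integral>\<^sup>+x. ennreal (\<rho> x) * indicator (Pi\<^sub>E {..<n} B) x
            \<partial>(\<Pi>\<^sub>M i\<in>{..<n}. restrict_space lborel D)))"

text \<open>For i.i.d. standard Gaussian coefficients the series converges on \<open>(-1,1)\<close> and all its real zeros
  there are simple, almost surely; so neither the value of \<^const>\<open>suminf\<close> on divergent series nor the
  choice to count zeros without multiplicity affects expectations.\<close>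

definition random_series :: "(nat \<Rightarrow> 'a \<Rightarrow> real) \<Rightarrow> 'a \<Rightarrow> real \<Rightarrow> real" where
  "random_series a \<omega> z = (\<Sum>k. a k \<omega> * z ^ k)"

definition real_zeros :: "(nat \<Rightarrow> 'a \<Rightarrow> real) \<Rightarrow> 'a \<Rightarrow> real set" where
  "real_zeros a \<omega> = {x \<in> {-1<..<1}. random_series a \<omega> x = 0}"

definition norm_corr :: "(real \<Rightarrow> real) \<Rightarrow> (real \<Rightarrow> real \<Rightarrow> real) \<Rightarrow> real \<Rightarrow> real \<Rightarrow> real" where
  "norm_corr \<rho>1 \<rho>2 s t = \<rho>2 s t / (\<rho>1 s * \<rho>1 t)"

text \<open>Extension of \<open>norm_corr \<rho>1 \<rho>2 s\<close> from \<open>(-1,1)\<close> to \<open>[-1,1]\<close> by one-sided limits.  Since \<^const>\<open>Lim\<close> is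
  total, existence of the limits has to be claimed separately.\<close>

definition norm_corr_ext :: "(real \<Rightarrow> real) \<Rightarrow> (real \<Rightarrow> real \<Rightarrow> real) \<Rightarrow> real \<Rightarrow> real \<Rightarrow> real" where
  "norm_corr_ext \<rho>1 \<rho>2 s t =
     (if t = 1 then Lim (at_left 1) (norm_corr \<rho>1 \<rho>2 s)
      else if t = -1 then Lim (at_right (-1)) (norm_corr \<rho>1 \<rho>2 s)
      else norm_corr \<rho>1 \<rho>2 s t)"

end

theory Submission
  imports Defs "HOL-Real_Asymp.Real_Asymp"
begin

text \<open>In the coordinate \<open>x = tanh u\<close> the series, divided by \<open>cosh u\<close>, is a stationary Gaussian process with
  covariance \<open>1 / cosh (u - v)\<close>.  Its joint law at finitely many points is therefore that of an explicit
  triangular combination of independent Gaussians (the Takenaka-Malmquist basis, i.e. repeated division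
  by Blaschke factors).  At \<open>u, v, u + k, v + k\<close> this gives, after rescaling by \<open>tanh k\<close> and dominated
  convergence, the asymptotics of the probability of sign changes on \<open>[u, u + k]\<close> and \<open>[v, v + k]\<close> as
  \<open>k\<close> tends to 0.  Zeros are almost surely simple, so sign changes on fine meshes count them; with Fatou's
  lemma and continuity of the correlation functions this identifies \<open>\<rho>1\<close> and \<open>\<rho>2\<close>:
  \<open>\<rho>2 s t / (\<rho>1 s * \<rho>1 t) = S (S + arctan (1 / S)) / (1 + S\<^sup>2)\<close> with
  \<open>S = sinh \<bar>artanh t - artanh s\<bar>\<close>.  The numerator of the derivative in \<open>S\<close> is
  \<open>S + (1 - S\<^sup>2) arctan (1 / S)\<close>, which is positive because \<open>arctan (1 / S) < 1 / S\<close>.\<close>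

section \<open>Joint laws and characteristic functions\<close>

text \<open>Working with sign changes at finitely many points avoids the Kac-Rice formula: no
  derivative of the process and no conditioning on a zero is ever needed. The order
  \<open>u, v, u + k, v + k\<close> of the points is deliberate. The two base values then involve
  only \<open>a 0\<close> and \<open>a 1\<close>, while the fresh directions \<open>a 2\<close> and
  \<open>a 3\<close> enter at the shifted points with a factor \<open>tanh k\<close>. A sign change
  therefore forces the base values to be of size \<open>tanh k\<close>, and rescaling both of them
  produces the factor \<open>(tanh k)^2\<close>. In the limit \<open>a 2\<close> and
  \<open>a 3\<close> stand in for the slopes given zeros at both points. With d = v - u > 0, T =
  tanh d and c = 1 / cosh d, the increments become -T y and T (c y + T z), so that the expectation
  of |y| |c y + T z| remains, and its value 2/pi (T + c arctan (c/T)) is the source of the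
  arctangent. Since c/T = 1 / sinh d, the variable S = sinh d removes all hyperbolic functions. The
  correlation functions are given only through integrals over disjoint boxes, so pointwise values
  come from shrinking boxes and continuity. The upper bound needs sign-change asymptotics that are
  uniform over nearby base points.\<close>

lemma weighted_char_determines:
  fixes X V :: "'a \<Rightarrow> real" and Y W :: "'b \<Rightarrow> real"
  assumes "prob_space M" "prob_space N"
    and X[measurable]: "X \<in> borel_measurable M" and Y[measurable]: "Y \<in> borel_measurable N"
    and V[measurable]: "V \<in> borel_measurable M" and W[measurable]: "W \<in> borel_measurable N"
    and V0: "\<And>x. 0 \<le> V x" "\<And>x. V x \<le> C" and W0: "\<And>x. 0 \<le> W x" "\<And>x. W x \<le> C"
    and char: "\<And>t. (CLINT x|M. V x * iexp (t * X x)) = (CLINT x|N. W x * iexp (t * Y x))"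
    and B[measurable]: "B \<in> sets borel"
  shows "(LINT x|M. V x * indicator B (X x)) = (LINT x|N. W x * indicator B (Y x))"
proof -
  interpret M: prob_space M by fact
  interpret N: prob_space N by fact
  have iV: "integrable M V"
    by (rule M.integrable_const_bound[where B=C]) (use V0 in auto)
  have iW: "integrable N W"
    by (rule N.integrable_const_bound[where B=C]) (use W0 in auto)
  define m where "m = (LINT x|M. V x)"
  have "complex_of_real (LINT x|M. V x) = complex_of_real (LINT x|N. W x)"
    using char[of 0] by (simp flip: integral_complex_of_real)
  then have mW: "m = (LINT x|N. W x)"
    unfolding m_def by simp
  have m0: "0 \<le> m"
    unfolding m_def using V0 by simp
  show ?thesis
  proof (cases "m = 0")
    case True
    have "AE x in M. V x = 0"
      using True integral_nonneg_eq_0_iff_AE[OF iV] V0 unfolding m_def by auto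
    moreover have "AE x in N. W x = 0"
      using True mW integral_nonneg_eq_0_iff_AE[OF iW] W0 by auto
    ultimately show ?thesis
      by (simp add: integral_eq_zero_AE eventually_mono)
  next
    case False
    with m0 have mpos: "0 < m" by simp
    \<comment> \<open>Dividing the weight by its mass \<open>m\<close> gives a probability density,
      so uniqueness of characteristic functions applies to the law of the variable under the tilted
      measure. The masses agree by the hypothesis at t = 0; if they vanish, so do both sides of the
      claim.\<close>
    have real_dist: "real_distribution (distr (density P (\<lambda>x. ennreal (U x / m))) borel Z)"
      and char_eq: "char (distr (density P (\<lambda>x. ennreal (U x / m))) borel Z) t
         = (CLINT x|P. U x * iexp (t * Z x)) / m"
      and meas_eq: "measure (distr (density P (\<lambda>x. ennreal (U x / m))) borel Z) B
         = (LINT x|P. U x * indicator B (Z x)) / m"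
      if P: "prob_space P" and Z[measurable]: "Z \<in> borel_measurable P"
        and U[measurable]: "U \<in> borel_measurable P"
        and U0: "\<And>x. 0 \<le> U x" "\<And>x. U x \<le> C" and Um: "(LINT x|P. U x) = m"
      for P :: "'c measure" and U Z t
    proof -
      interpret P: prob_space P by fact
      have iU: "integrable P U"
        by (rule P.integrable_const_bound[where B=C]) (use U0 in auto)
      let ?D = "density P (\<lambda>x. ennreal (U x / m))"
      have "emeasure ?D (space ?D) = (\<integral>\<^sup>+x. ennreal (U x / m) \<partial>P)"
        by (simp add: emeasure_density cong: nn_integral_cong)
      also have "\<dots> = ennreal (LINT x|P. U x / m)"
        using U0 mpos iU by (intro nn_integral_eq_integral) auto
      also have "\<dots> = 1"
        using Um mpos by simp
      finally interpret D: prob_space ?D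
        by (rule prob_spaceI)
      show "real_distribution (distr ?D borel Z)"
        by (intro D.real_distribution_distr) simp
      then interpret R: real_distribution "distr ?D borel Z" .
      show "char (distr ?D borel Z) t = (CLINT x|P. U x * iexp (t * Z x)) / m"
        using U0 mpos unfolding char_def
        by (simp add: integral_distr integral_density scaleR_conv_of_real)
      have "measure (distr ?D borel Z) B = (LINT x|?D. indicator B (Z x))"
        by (subst integral_distr[symmetric, where N=borel]) auto
      also have "\<dots> = (LINT x|P. U x * indicator B (Z x)) / m"
        using U0 mpos by (simp add: integral_density)
      finally show "measure (distr ?D borel Z) B = (LINT x|P. U x * indicator B (Z x)) / m" .
    qed
    have "distr (density M (\<lambda>x. ennreal (V x / m))) borel X =
          distr (density N (\<lambda>x. ennreal (W x / m))) borel Y"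
    proof (rule Levy_uniqueness)
      show "real_distribution (distr (density M (\<lambda>x. ennreal (V x / m))) borel X)"
        using assms m_def by (intro real_dist) auto
      show "real_distribution (distr (density N (\<lambda>x. ennreal (W x / m))) borel Y)"
        using assms mW by (intro real_dist) auto
      show "char (distr (density M (\<lambda>x. ennreal (V x / m))) borel X) =
          char (distr (density N (\<lambda>x. ennreal (W x / m))) borel Y)"
      proof
        fix t
        show "char (distr (density M (\<lambda>x. ennreal (V x / m))) borel X) t =
          char (distr (density N (\<lambda>x. ennreal (W x / m))) borel Y) t"
          using char_eq[OF \<open>prob_space M\<close> X V V0 m_def[symmetric], of t]
            char_eq[OF \<open>prob_space N\<close> Y W W0 mW[symmetric], of t] char[of t] by simp
      qed
    qed
    then have "(LINT x|M. V x * indicator B (X x)) / m = (LINT x|N. W x * indicator B (Y x)) / m"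
      using meas_eq[OF \<open>prob_space M\<close> X V V0 m_def[symmetric]]
            meas_eq[OF \<open>prob_space N\<close> Y W W0 mW[symmetric]] by presburger
    then show ?thesis
      using mpos by simp
  qed
qed

text \<open>The mixed form, indicators over \<open>I\<close> and a phase over all of
  \<open>J\<close>, is what an induction on \<open>I\<close> can carry: since \<open>c\<close> is
  arbitrary, varying its entry at the next index \<open>i\<close> supplies the characteristic
  function of \<open>X i\<close> under the weight built so far. At \<open>I = J\<close> and
  \<open>c = 0\<close> only box probabilities remain.\<close>

lemma joint_char_determines_products:
  fixes X :: "'i \<Rightarrow> 'a \<Rightarrow> real" and Y :: "'i \<Rightarrow> 'a \<Rightarrow> real"
  assumes M: "prob_space M" and N: "prob_space N"
    and J: "finite J"
    and X[measurable]: "\<And>j. X j \<in> borel_measurable M"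
    and Y[measurable]: "\<And>j. Y j \<in> borel_measurable N"
    and char: "\<And>c. (CLINT x|M. iexp (\<Sum>j\<in>J. c j * X j x)) = (CLINT x|N. iexp (\<Sum>j\<in>J. c j * Y j x))"
    and "I \<subseteq> J" and B: "\<And>i. B i \<in> sets borel"
  shows "(CLINT x|M. of_real (\<Prod>i\<in>I. indicator (B i) (X i x)) * iexp (\<Sum>j\<in>J. c j * X j x)) =
         (CLINT x|N. of_real (\<Prod>i\<in>I. indicator (B i) (Y i x)) * iexp (\<Sum>j\<in>J. c j * Y j x))"
proof -
  have "finite I" using J \<open>I \<subseteq> J\<close> by (rule finite_subset[rotated])
  from this \<open>I \<subseteq> J\<close> show ?thesis
  proof (induction I arbitrary: c rule: finite_induct)
    case empty
    then show ?case using char by simp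
  next
    case (insert i I)
    have iJ: "i \<in> J" and IJ: "I \<subseteq> J" using insert by auto
    note [measurable] = B
    define V where "V Z x = (\<Prod>i\<in>I. indicator (B i) (Z i x) :: real)" for Z :: "'i \<Rightarrow> 'a \<Rightarrow> real" and x
    define \<theta> where "\<theta> Z x = (\<Sum>j\<in>J. c j * Z j x)" for Z :: "'i \<Rightarrow> 'a \<Rightarrow> real" and x
    have Vb: "0 \<le> V Z x" "V Z x \<le> 1" for Z :: "'i \<Rightarrow> 'a \<Rightarrow> real" and x
      unfolding V_def by (auto intro!: prod_nonneg prod_le_1)
    have Vm[measurable]: "V Z \<in> borel_measurable P" if [measurable]: "\<And>j. Z j \<in> borel_measurable P"
      for Z :: "'i \<Rightarrow> 'a \<Rightarrow> real" and P
      unfolding V_def by measurable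
    have \<theta>m[measurable]: "\<theta> Z \<in> borel_measurable P" if [measurable]: "\<And>j. Z j \<in> borel_measurable P"
      for Z :: "'i \<Rightarrow> 'a \<Rightarrow> real" and P
      unfolding \<theta>_def by measurable
    have upd: "(\<Sum>j\<in>J. (d(i := d i + t)) j * z j) = t * z i + (\<Sum>j\<in>J. d j * z j)" for d t and z :: "'i \<Rightarrow> real"
    proof -
      have "(\<Sum>j\<in>J. (d(i := d i + t)) j * z j) = (\<Sum>j\<in>J. (if j = i then t * z i else 0) + d j * z j)"
        by (intro sum.cong) (auto simp: algebra_simps)
      then show ?thesis using iJ J by (simp add: sum.distrib sum.delta')
    qed
    \<comment> \<open>Writing the cosine as two exponentials gives three integrals whose phases have
      coefficients 0, \<open>c\<close> and \<open>- c\<close>, each shifted by \<open>t\<close> at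
      \<open>i\<close>. All three are instances of the induction hypothesis.\<close>
    have expand: "(CLINT x|P. of_real (V Z x * (1 + cos (\<theta> Z x + \<phi>))) * iexp (t * Z i x)) =
       (CLINT x|P. of_real (V Z x) * iexp (\<Sum>j\<in>J. ((\<lambda>_. 0)(i := 0 + t)) j * Z j x))
       + exp (\<i> * \<phi>) / 2 * (CLINT x|P. of_real (V Z x) * iexp (\<Sum>j\<in>J. (c(i := c i + t)) j * Z j x))
       + exp (- \<i> * \<phi>) / 2 * (CLINT x|P. of_real (V Z x) * iexp (\<Sum>j\<in>J. ((\<lambda>j. - c j)(i := - c i + t)) j * Z j x))"
      if P: "prob_space P" and Zm[measurable]: "\<And>j. Z j \<in> borel_measurable P"
      for P :: "'a measure" and Z :: "'i \<Rightarrow> 'a \<Rightarrow> real" and \<phi> t :: real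
    proof -
      interpret P: prob_space P by fact
      have int: "integrable P (\<lambda>x. of_real (V Z x) * iexp (g x))"
        if [measurable]: "g \<in> borel_measurable P" for g
        by (rule P.integrable_const_bound[where B=1]) (use Vb[of Z] in \<open>auto simp: norm_mult\<close>)
      have "of_real (V Z x * (1 + cos (\<theta> Z x + \<phi>))) * iexp (t * Z i x) =
         of_real (V Z x) * iexp (t * Z i x) + exp (\<i> * \<phi>) / 2 * (of_real (V Z x) * iexp (t * Z i x + \<theta> Z x))
         + exp (- \<i> * \<phi>) / 2 * (of_real (V Z x) * iexp (t * Z i x - \<theta> Z x))" for x
      proof -
        have "complex_of_real (cos (\<theta> Z x + \<phi>)) = (exp (\<i> * \<phi>) * iexp (\<theta> Z x) + exp (- \<i> * \<phi>) * exp (- \<i> * \<theta> Z x)) / 2"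
          unfolding cos_of_real[symmetric] cos_exp_eq
          by (simp add: exp_add[symmetric] distrib_left add.commute)
        moreover have "iexp (t * Z i x + \<theta> Z x) = iexp (t * Z i x) * iexp (\<theta> Z x)"
          by (simp add: exp_add[symmetric] distrib_left)
        moreover have "iexp (t * Z i x - \<theta> Z x) = iexp (t * Z i x) * exp (- \<i> * \<theta> Z x)"
          by (simp add: exp_add[symmetric] right_diff_distrib)
        ultimately show ?thesis
          by (simp only: of_real_mult of_real_add of_real_1) (simp add: algebra_simps)
      qed
      then have "(CLINT x|P. of_real (V Z x * (1 + cos (\<theta> Z x + \<phi>))) * iexp (t * Z i x)) =
        (CLINT x|P. of_real (V Z x) * iexp (t * Z i x))
        + (CLINT x|P. exp (\<i> * \<phi>) / 2 * (of_real (V Z x) * iexp (t * Z i x + \<theta> Z x)))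
        + (CLINT x|P. exp (- \<i> * \<phi>) / 2 * (of_real (V Z x) * iexp (t * Z i x - \<theta> Z x)))"
        by (simp only:, intro trans[OF Bochner_Integration.integral_add] arg_cong2[where f="(+)"]
              Bochner_Integration.integral_add Bochner_Integration.integrable_add integrable_mult_right int refl) measurable
      then show ?thesis
        unfolding upd[of "\<lambda>_. 0"] upd[of c] upd[of "\<lambda>j. - c j"] by (simp add: \<theta>_def sum_negf)
    qed
    have cos_nonneg: "0 \<le> 1 + cos a" for a :: real
      using cos_ge_minus_one[of a] by linarith
    txt \<open>The weight \<open>V (1 + cos (\<theta> + \<phi>))\<close> is nonnegative, so one-dimensional uniqueness applies to it;
      two phases \<open>\<phi>\<close> recover the complex weight \<open>V exp (\<i> \<theta>)\<close>.\<close>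
    have key: "(LINT x|M. V X x * (1 + cos (\<theta> X x + \<phi>)) * indicator (B i) (X i x)) =
               (LINT x|N. V Y x * (1 + cos (\<theta> Y x + \<phi>)) * indicator (B i) (Y i x))" for \<phi>
    proof (rule weighted_char_determines[OF M N, where C=2])
      fix t
      show "(CLINT x|M. of_real (V X x * (1 + cos (\<theta> X x + \<phi>))) * iexp (t * X i x)) =
            (CLINT x|N. of_real (V Y x * (1 + cos (\<theta> Y x + \<phi>))) * iexp (t * Y i x))"
        unfolding expand[where Z=X, OF M X] expand[where Z=Y, OF N Y]
        unfolding V_def insert.IH[OF IJ] ..
    next
      have "V Z x * (1 + cos (\<theta> Z x + \<phi>)) \<le> 1 * 2" for Z :: "'i \<Rightarrow> 'a \<Rightarrow> real" and x
        using Vb[of Z x] cos_nonneg by (intro mult_mono) auto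
      then show "V X x * (1 + cos (\<theta> X x + \<phi>)) \<le> 2" "V Y y * (1 + cos (\<theta> Y y + \<phi>)) \<le> 2" for x y
        by auto
      then show "0 \<le> V X x * (1 + cos (\<theta> X x + \<phi>))" "0 \<le> V Y y * (1 + cos (\<theta> Y y + \<phi>))" for x y
        using Vb cos_nonneg by auto
    qed (use B in auto)
    define E where "E P Z \<phi> = (LINT x|P. V Z x * indicator (B i) (Z i x) * cos (\<theta> Z x + \<phi>))"
      for P :: "'a measure" and Z :: "'i \<Rightarrow> 'a \<Rightarrow> real" and \<phi> :: real
    have split: "(LINT x|P. V Z x * (1 + cos (\<theta> Z x + \<phi>)) * indicator (B i) (Z i x)) =
        (LINT x|P. V Z x * indicator (B i) (Z i x)) + E P Z \<phi>"
      and E_pi: "E P Z pi = - E P Z 0"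
      and recomb: "(CLINT x|P. of_real (\<Prod>i\<in>insert i I. indicator (B i) (Z i x)) * iexp (\<Sum>j\<in>J. c j * Z j x))
         = of_real (E P Z 0) + \<i> * of_real (E P Z (- pi/2))"
      if P: "prob_space P" and Zm[measurable]: "\<And>j. Z j \<in> borel_measurable P"
      for P :: "'a measure" and Z :: "'i \<Rightarrow> 'a \<Rightarrow> real" and \<phi>
    proof -
      interpret P: prob_space P by fact
      have Vi: "\<bar>V Z x * indicator (B i) (Z i x)\<bar> \<le> 1" for x
        using Vb[of Z x] by (auto simp: indicator_def)
      have int: "integrable P (\<lambda>x. V Z x * indicator (B i) (Z i x))"
        by (rule P.integrable_const_bound[where B=1]) (use Vi B in auto)
      have int2: "integrable P (\<lambda>x. V Z x * indicator (B i) (Z i x) * cos (\<theta> Z x + \<phi>))" for \<phi>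
      proof (rule P.integrable_const_bound[where B=1])
        have "\<bar>V Z x * indicator (B i) (Z i x)\<bar> * \<bar>cos (\<theta> Z x + \<phi>)\<bar> \<le> 1 * 1" for x
          by (intro mult_mono Vi) auto
        then show "AE x in P. norm (V Z x * indicator (B i) (Z i x) * cos (\<theta> Z x + \<phi>)) \<le> 1"
          by (auto simp: abs_mult)
      qed (use B in measurable)
      show "(LINT x|P. V Z x * (1 + cos (\<theta> Z x + \<phi>)) * indicator (B i) (Z i x)) =
        (LINT x|P. V Z x * indicator (B i) (Z i x)) + E P Z \<phi>"
        unfolding E_def by (subst Bochner_Integration.integral_add[symmetric, OF int int2]) (simp add: algebra_simps)
      show "E P Z pi = - E P Z 0"
        unfolding E_def by simp
      have "of_real (E P Z 0) + \<i> * of_real (E P Z (- pi/2)) =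
        (CLINT x|P. of_real (V Z x * indicator (B i) (Z i x) * cos (\<theta> Z x + 0)))
        + (CLINT x|P. \<i> * of_real (V Z x * indicator (B i) (Z i x) * cos (\<theta> Z x + - pi/2)))"
        unfolding E_def by (simp only: integral_complex_of_real integral_mult_right_zero)
      also have "\<dots> = (CLINT x|P. of_real (V Z x * indicator (B i) (Z i x) * cos (\<theta> Z x + 0))
        + \<i> * of_real (V Z x * indicator (B i) (Z i x) * cos (\<theta> Z x + - pi/2)))"
        by (intro Bochner_Integration.integral_add[symmetric] integrable_mult_right integrable_of_real int2)
      also have "\<dots> = (CLINT x|P. of_real (\<Prod>i\<in>insert i I. indicator (B i) (Z i x)) * iexp (\<Sum>j\<in>J. c j * Z j x))"
      proof (rule Bochner_Integration.integral_cong[OF refl])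
        fix x
        have "cos (\<theta> Z x + - pi/2) = sin (\<theta> Z x)"
          by (simp add: cos_diff)
        moreover have "iexp (\<theta> Z x) = of_real (cos (\<theta> Z x)) + \<i> * of_real (sin (\<theta> Z x))"
          by (simp add: exp_Euler cos_of_real sin_of_real)
        ultimately show "of_real (V Z x * indicator (B i) (Z i x) * cos (\<theta> Z x + 0))
        + \<i> * of_real (V Z x * indicator (B i) (Z i x) * cos (\<theta> Z x + - pi/2)) =
          of_real (\<Prod>i\<in>insert i I. indicator (B i) (Z i x)) * iexp (\<Sum>j\<in>J. c j * Z j x)"
          using insert.hyps by (simp add: V_def \<theta>_def algebra_simps)
      qed
      finally show "(CLINT x|P. of_real (\<Prod>i\<in>insert i I. indicator (B i) (Z i x)) * iexp (\<Sum>j\<in>J. c j * Z j x))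
         = of_real (E P Z 0) + \<i> * of_real (E P Z (- pi/2))" by simp
    qed
    \<comment> \<open>With A the integral of the weight and indicator alone, phases 0 and pi give A
      + E 0 and A - E 0, so A and E 0 agree on both sides. Phase -pi/2 then yields the sine
      part.\<close>
    have "E M X 0 = E N Y 0" "E M X (- pi/2) = E N Y (- pi/2)"
      using key[of 0] key[of pi] key[of "- pi/2"]
      unfolding split[where Z=X, OF M X] split[where Z=Y, OF N Y] E_pi[where Z=X, OF M X] E_pi[where Z=Y, OF N Y] by linarith+
    then show ?case
      unfolding recomb[where Z=X, OF M X] recomb[where Z=Y, OF N Y] by simp
  qed
qed

lemma joint_char_determines_distr:
  fixes X :: "'i \<Rightarrow> 'a \<Rightarrow> real" and Y :: "'i \<Rightarrow> 'a \<Rightarrow> real"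
  assumes M: "prob_space M" and N: "prob_space N"
    and J: "finite J"
    and X[measurable]: "\<And>j. X j \<in> borel_measurable M"
    and Y[measurable]: "\<And>j. Y j \<in> borel_measurable N"
    and char: "\<And>c. (CLINT x|M. iexp (\<Sum>j\<in>J. c j * X j x)) = (CLINT x|N. iexp (\<Sum>j\<in>J. c j * Y j x))"
  shows "distr M (\<Pi>\<^sub>M j\<in>J. borel) (\<lambda>x. \<lambda>j\<in>J. X j x) = distr N (\<Pi>\<^sub>M j\<in>J. borel) (\<lambda>x. \<lambda>j\<in>J. Y j x)"
proof -
  interpret M: prob_space M by fact
  interpret N: prob_space N by fact
  have box: "emeasure (distr P (\<Pi>\<^sub>M j\<in>J. borel) (\<lambda>x. \<lambda>j\<in>J. Z j x)) (Pi\<^sub>E J A)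
      = ennreal (Re (CLINT x|P. of_real (\<Prod>i\<in>J. indicator (A i) (Z i x)) * iexp (\<Sum>j\<in>J. 0 * Z j x)))"
    if P: "prob_space P" and Zm[measurable]: "\<And>j. Z j \<in> borel_measurable P" and A[measurable]: "\<And>j. A j \<in> sets borel"
    for P :: "'a measure" and Z :: "'i \<Rightarrow> 'a \<Rightarrow> real" and A
  proof -
    interpret P: prob_space P by fact
    have "emeasure (distr P (\<Pi>\<^sub>M j\<in>J. borel) (\<lambda>x. \<lambda>j\<in>J. Z j x)) (Pi\<^sub>E J A)
      = emeasure P {x\<in>space P. \<forall>j\<in>J. Z j x \<in> A j}"
      using J by (subst emeasure_distr) (auto intro!: arg_cong[where f="emeasure P"] sets_PiM_I_finite)
    also have "\<dots> = ennreal (measure P {x\<in>space P. \<forall>j\<in>J. Z j x \<in> A j})"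
      by (simp add: P.emeasure_eq_measure)
    also have "measure P {x\<in>space P. \<forall>j\<in>J. Z j x \<in> A j} = (LINT x|P. (\<Prod>i\<in>J. indicator (A i) (Z i x)))"
    proof -
      have [measurable]: "{x\<in>space P. \<forall>j\<in>J. Z j x \<in> A j} \<in> sets P"
        using J by measurable
      have eq: "(\<Prod>i\<in>J. indicator (A i) (Z i x) :: real) = indicator {x\<in>space P. \<forall>j\<in>J. Z j x \<in> A j} x"
        if "x \<in> space P" for x
        using J that by (auto simp: indicator_def prod_zero_iff)
      have "(LINT x|P. (\<Prod>i\<in>J. indicator (A i) (Z i x))) = (LINT x|P. indicator {x\<in>space P. \<forall>j\<in>J. Z j x \<in> A j} x :: real)"
        by (rule Bochner_Integration.integral_cong[OF refl eq])
      then show ?thesis by simp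
    qed
    also have "\<dots> = Re (CLINT x|P. of_real (\<Prod>i\<in>J. indicator (A i) (Z i x)) * iexp (\<Sum>j\<in>J. 0 * Z j x))"
      using integral_complex_of_real[of P "\<lambda>x. (\<Prod>i\<in>J. indicator (A i) (Z i x))"]
      by simp
    finally show ?thesis .
  qed
  show ?thesis
  proof (rule measure_eqI_PiM_finite[OF J])
    fix A :: "'i \<Rightarrow> real set" assume "\<And>i. i \<in> J \<Longrightarrow> A i \<in> sets borel"
    \<comment> \<open>Measurability of \<open>A\<close> is known only on \<open>J\<close>, whereas
      the product lemma asks for it at every index; the empty set is a filler that leaves the box
      unchanged.\<close>
    then have A': "\<And>j. (if j \<in> J then A j else {}) \<in> sets borel" by auto
    have eqA: "Pi\<^sub>E J A = Pi\<^sub>E J (\<lambda>j. if j \<in> J then A j else {})"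
      by (auto simp: PiE_iff)
    show "emeasure (distr M (\<Pi>\<^sub>M j\<in>J. borel) (\<lambda>x. \<lambda>j\<in>J. X j x)) (Pi\<^sub>E J A) =
          emeasure (distr N (\<Pi>\<^sub>M j\<in>J. borel) (\<lambda>x. \<lambda>j\<in>J. Y j x)) (Pi\<^sub>E J A)"
      unfolding eqA box[OF M X A'] box[OF N Y A']
      using joint_char_determines_products[where c="\<lambda>_. 0" and B="\<lambda>j. if j \<in> J then A j else {}", OF M N J X Y char subset_refl A'] by simp
  next
    show "range (\<lambda>_::nat. space (\<Pi>\<^sub>M j\<in>J. borel)) \<subseteq> prod_algebra J (\<lambda>_. borel :: real measure)"
      using J by (auto simp: space_PiM intro!: prod_algebraI_finite[where E="\<lambda>_. UNIV"])
    show "emeasure (distr M (\<Pi>\<^sub>M j\<in>J. borel) (\<lambda>x. \<lambda>j\<in>J. X j x)) (space (\<Pi>\<^sub>M j\<in>J. borel)) \<noteq> \<infinity>"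
      by (subst emeasure_distr) (auto simp: M.emeasure_eq_measure)
  qed auto
qed

section \<open>Linear functionals of Gaussian coefficients\<close>

locale gaussian_coefficients = prob_space M for M :: "'a measure" +
  fixes a :: "nat \<Rightarrow> 'a \<Rightarrow> real"
  assumes indep: "indep_vars (\<lambda>_. borel) a UNIV"
    and std_normal: "\<And>k. distributed M lborel (a k) (\<lambda>x. ennreal (std_normal_density x))"
begin

lemma a_measurable[measurable]: "a k \<in> borel_measurable M"
  using distributed_measurable[OF std_normal[of k]] by simp

lemma distr_a: "distr M borel (a k) = std_normal_distribution"
  using distributed_distr_eq_density[OF std_normal[of k]] by (simp cong: distr_cong)

lemma char_a: "(CLINT \<omega>|M. iexp (t * a k \<omega>)) = exp (- (t\<^sup>2) / 2)"
proof -
  have "char (distr M borel (a k)) t = (CLINT \<omega>|M. iexp (t * a k \<omega>))"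
    unfolding char_def by (subst integral_distr) auto
  then show ?thesis
    unfolding distr_a char_std_normal_distribution by simp
qed

text \<open>A first moment argument: the expectation of the absolute series is E|a 0| times a
  geometric series, hence finite. The radii 1 - 1/(n+1) are countable and dominate every smaller
  radius, so one null set serves all r.\<close>

lemma AE_summable_geometric: "AE \<omega> in M. \<forall>r. \<bar>r\<bar> < 1 \<longrightarrow> summable (\<lambda>k. \<bar>a k \<omega> * r ^ k\<bar>)"
proof -
  define D where "D = (\<integral>\<^sup>+x. ennreal (std_normal_density x * \<bar>x\<bar>) \<partial>lborel)"
  have Dfin: "D < \<infinity>"
    unfolding D_def using std_normal_moment_abs_odd[of 0]
    by (subst nn_integral_eq_integral) (auto simp: has_bochner_integral_iff)
  have E_abs: "(\<integral>\<^sup>+\<omega>. ennreal \<bar>a k \<omega>\<bar> \<partial>M) = D" for k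
  proof -
    have "(\<integral>\<^sup>+\<omega>. ennreal \<bar>a k \<omega>\<bar> \<partial>M) = (\<integral>\<^sup>+x. ennreal (std_normal_density x) * ennreal \<bar>x\<bar> \<partial>lborel)"
      by (rule distributed_nn_integral[OF std_normal, symmetric]) auto
    then show ?thesis
      unfolding D_def by (simp add: ennreal_mult'')
  qed
  have "AE \<omega> in M. summable (\<lambda>k. \<bar>a k \<omega>\<bar> * r ^ k)" if r: "0 \<le> r" "r < 1" for r :: real
  proof -
    have "(\<integral>\<^sup>+\<omega>. (\<Sum>k. ennreal (\<bar>a k \<omega>\<bar> * r ^ k)) \<partial>M) = (\<Sum>k. \<integral>\<^sup>+\<omega>. ennreal (\<bar>a k \<omega>\<bar> * r ^ k) \<partial>M)"
      by (rule nn_integral_suminf) auto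
    also have "\<dots> = (\<Sum>k. D * ennreal (r ^ k))"
      using r by (simp add: ennreal_mult nn_integral_multc E_abs)
    also have "\<dots> = D * (\<Sum>k. ennreal (r ^ k))"
      by simp
    also have "(\<Sum>k. ennreal (r ^ k)) = ennreal (\<Sum>k. r ^ k)"
      using r by (intro suminf_ennreal2) (auto intro: summable_geometric)
    also have "D * \<dots> < \<infinity>"
      using Dfin by (simp add: ennreal_mult_less_top)
    finally have "AE \<omega> in M. (\<Sum>k. ennreal (\<bar>a k \<omega>\<bar> * r ^ k)) \<noteq> \<infinity>"
      by (intro nn_integral_PInf_AE) auto
    then show ?thesis
      using r by (auto elim!: eventually_mono intro!: summable_suminf_not_top)
  qed
  then have "AE \<omega> in M. \<forall>n. summable (\<lambda>k. \<bar>a k \<omega>\<bar> * (1 - 1 / real (Suc n)) ^ k)"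
    by (subst AE_all_countable) auto
  then show ?thesis
  proof (rule eventually_mono, intro allI impI)
    fix \<omega> and r :: real
    assume sm: "\<forall>n. summable (\<lambda>k. \<bar>a k \<omega>\<bar> * (1 - 1 / real (Suc n)) ^ k)" and r: "\<bar>r\<bar> < 1"
    obtain n where n: "1 / real (Suc n) < 1 - \<bar>r\<bar>"
      using reals_Archimedean[of "1 - \<bar>r\<bar>"] r by (auto simp: inverse_eq_divide)
    show "summable (\<lambda>k. \<bar>a k \<omega> * r ^ k\<bar>)"
    proof (rule summable_comparison_test'[OF sm[rule_format, of n], of 0])
      fix k
      have "\<bar>r\<bar> ^ k \<le> (1 - 1 / real (Suc n)) ^ k"
        using n by (intro power_mono) auto
      then show "norm \<bar>a k \<omega> * r ^ k\<bar> \<le> \<bar>a k \<omega>\<bar> * (1 - 1 / real (Suc n)) ^ k"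
        by (auto simp: abs_mult power_abs intro!: mult_left_mono)
    qed
  qed
qed

end

text \<open>A class of weights on which the random series converges almost surely. It is closed
  under linear combinations and contains both kinds of weights to be compared: powers of a point of
  (-1,1) and finitely supported sequences.\<close>

definition geometric_decay :: "(nat \<Rightarrow> real) \<Rightarrow> bool" where
  "geometric_decay w \<longleftrightarrow> (\<exists>C r. 0 \<le> r \<and> r < 1 \<and> (\<forall>k. \<bar>w k\<bar> \<le> C * r ^ k))"

lemma geometric_decay_power: "\<bar>z\<bar> < 1 \<Longrightarrow> geometric_decay (\<lambda>k. z ^ k)"
  unfolding geometric_decay_def
  by (intro exI[of _ 1] exI[of _ "\<bar>z\<bar>"]) (auto simp: power_abs)

lemma geometric_decay_finite:
  assumes "\<And>k. n \<le> k \<Longrightarrow> w k = 0"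
  shows "geometric_decay w"
  unfolding geometric_decay_def
proof (intro exI conjI allI)
  fix k
  \<comment> \<open>The rate 1/2 is arbitrary; the constant absorbs the finitely many nonzero
    terms.\<close>
  show "\<bar>w k\<bar> \<le> (\<Sum>i<n. \<bar>w i\<bar> * 2 ^ i) * (1/2) ^ k"
  proof (cases "k < n")
    case True
    have "\<bar>w k\<bar> * 2 ^ k \<le> (\<Sum>i<n. \<bar>w i\<bar> * 2 ^ i)"
      using True by (intro member_le_sum[of k _ "\<lambda>i. \<bar>w i\<bar> * 2 ^ i"]) auto
    then show ?thesis by (simp add: field_simps power_divide)
  next
    case False
    then show ?thesis using assms by (auto intro!: mult_nonneg_nonneg sum_nonneg)
  qed
qed auto

lemma geometric_decay_cmult:
  assumes "geometric_decay w"
  shows "geometric_decay (\<lambda>k. c * w k)"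
proof -
  obtain C r where "0 \<le> r" "r < 1" "\<And>k. \<bar>w k\<bar> \<le> C * r ^ k"
    using assms unfolding geometric_decay_def by auto
  then show ?thesis
    unfolding geometric_decay_def
    by (intro exI[of _ "\<bar>c\<bar> * C"] exI[of _ r]) (auto simp: abs_mult mult.assoc intro!: mult_left_mono)
qed

lemma geometric_decay_add:
  assumes "geometric_decay v" "geometric_decay w"
  shows "geometric_decay (\<lambda>k. v k + w k)"
proof -
  obtain C r where v: "0 \<le> r" "r < 1" "\<And>k. \<bar>v k\<bar> \<le> C * r ^ k"
    using assms unfolding geometric_decay_def by auto
  obtain C' r' where w: "0 \<le> r'" "r' < 1" "\<And>k. \<bar>w k\<bar> \<le> C' * r' ^ k"
    using assms unfolding geometric_decay_def by auto
  have C: "0 \<le> C" "0 \<le> C'" using v(3)[of 0] w(3)[of 0] by auto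
  show ?thesis
    unfolding geometric_decay_def
  proof (intro exI conjI allI)
    fix k
    have "\<bar>v k + w k\<bar> \<le> C * r ^ k + C' * r' ^ k"
      using v(3)[of k] w(3)[of k] by linarith
    also have "\<dots> \<le> C * max r r' ^ k + C' * max r r' ^ k"
      using v(1) w(1) C by (intro add_mono mult_left_mono power_mono) auto
    finally show "\<bar>v k + w k\<bar> \<le> (C + C') * max r r' ^ k"
      by (simp add: algebra_simps)
  qed (use v w in auto)
qed

lemma geometric_decay_sum:
  assumes "\<And>j. j \<in> J \<Longrightarrow> geometric_decay (w j)"
  shows "geometric_decay (\<lambda>k. \<Sum>j\<in>J. c j * w j k)"
  using assms
proof (induction J rule: infinite_finite_induct)
  case (insert x F)
  then show ?case by (auto intro!: geometric_decay_add geometric_decay_cmult)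
qed (auto intro!: geometric_decay_finite[of 0])

lemma geometric_decay_summable_mult:
  assumes "geometric_decay v" "geometric_decay w"
  shows "summable (\<lambda>k. v k * w k)"
proof -
  obtain C r where v: "0 \<le> r" "r < 1" "\<And>k. \<bar>v k\<bar> \<le> C * r ^ k"
    using assms unfolding geometric_decay_def by auto
  obtain C' r' where w: "0 \<le> r'" "r' < 1" "\<And>k. \<bar>w k\<bar> \<le> C' * r' ^ k"
    using assms unfolding geometric_decay_def by auto
  have "r * r' < 1" using v w by (metis mult_le_one mult_left_le nless_le order_le_less_trans)
  show ?thesis
  proof (rule summable_comparison_test'[of "\<lambda>k. C * C' * (r * r') ^ k" 0])
    show "summable (\<lambda>k. C * C' * (r * r') ^ k)"
      using \<open>r * r' < 1\<close> v w by (intro summable_mult summable_geometric) auto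
    fix k
    have "\<bar>v k\<bar> * \<bar>w k\<bar> \<le> (C * r ^ k) * (C' * r' ^ k)"
      using v w by (intro mult_mono) (auto intro: order_trans[OF abs_ge_zero])
    then show "norm (v k * w k) \<le> C * C' * (r * r') ^ k"
      by (simp add: abs_mult power_mult_distrib mult_ac)
  qed
qed

section \<open>Laws of convergent Gaussian series\<close>

context gaussian_coefficients
begin

definition gsum :: "(nat \<Rightarrow> real) \<Rightarrow> 'a \<Rightarrow> real" where
  "gsum w \<omega> = (\<Sum>k. a k \<omega> * w k)"

lemma gsum_measurable[measurable]: "gsum w \<in> borel_measurable M"
  unfolding gsum_def[abs_def] by measurable

lemma AE_summable_gsum:
  assumes "geometric_decay w"
  shows "AE \<omega> in M. summable (\<lambda>k. a k \<omega> * w k)"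
proof -
  obtain C r where w: "0 \<le> r" "r < 1" "\<And>k. \<bar>w k\<bar> \<le> C * r ^ k"
    using assms unfolding geometric_decay_def by auto
  show ?thesis
  proof (rule eventually_mono[OF AE_summable_geometric])
    fix \<omega> assume "\<forall>r. \<bar>r\<bar> < 1 \<longrightarrow> summable (\<lambda>k. \<bar>a k \<omega> * r ^ k\<bar>)"
    with w have *: "summable (\<lambda>k. \<bar>C\<bar> * \<bar>a k \<omega> * r ^ k\<bar>)"
      by (intro summable_mult) auto
    show "summable (\<lambda>k. a k \<omega> * w k)"
    proof (rule summable_comparison_test'[OF *, of 0])
      fix k
      have "\<bar>a k \<omega>\<bar> * \<bar>w k\<bar> \<le> \<bar>a k \<omega>\<bar> * (\<bar>C\<bar> * r ^ k)"
        using w by (intro mult_left_mono order_trans[OF w(3)] mult_right_mono) auto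
      then show "norm (a k \<omega> * w k) \<le> \<bar>C\<bar> * \<bar>a k \<omega> * r ^ k\<bar>"
        using w by (simp add: abs_mult mult_ac)
    qed
  qed
qed

text \<open>Partial sums are sums of independent Gaussians, whose characteristic functions multiply;
  dominated convergence with bound 1 passes to the series.\<close>

lemma char_gsum:
  assumes w: "geometric_decay w"
  shows "(CLINT \<omega>|M. iexp (gsum w \<omega>)) = exp (- (\<Sum>k. (w k)\<^sup>2) / 2)"
proof (rule LIMSEQ_unique)
  show "(\<lambda>n. CLINT \<omega>|M. iexp (\<Sum>k<n. a k \<omega> * w k)) \<longlonglongrightarrow> (CLINT \<omega>|M. iexp (gsum w \<omega>))"
  proof (rule integral_dominated_convergence[where w="\<lambda>_. 1"])
    show "AE \<omega> in M. (\<lambda>n. iexp (\<Sum>k<n. a k \<omega> * w k)) \<longlonglongrightarrow> iexp (gsum w \<omega>)"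
      using AE_summable_gsum[OF w]
    proof eventually_elim
      case (elim \<omega>)
      then show ?case
        unfolding gsum_def by (intro tendsto_intros summable_LIMSEQ)
    qed
  qed auto
  have "(CLINT \<omega>|M. iexp (\<Sum>k<n. a k \<omega> * w k)) = exp (- (\<Sum>k<n. (w k)\<^sup>2) / 2)" for n
  proof -
    have ind: "indep_vars (\<lambda>_. borel) (\<lambda>k \<omega>. a k \<omega> * w k) {..<n}"
      by (rule indep_vars_compose2[where Y="\<lambda>k x. x * w k", OF indep_vars_subset[OF indep]]) auto
    have "char (distr M borel (\<lambda>\<omega>. \<Sum>k<n. a k \<omega> * w k)) 1 =
        (\<Prod>k<n. char (distr M borel (\<lambda>\<omega>. a k \<omega> * w k)) 1)"
      by (rule char_distr_sum[OF ind])
    also have "\<dots> = (\<Prod>k<n. CLINT \<omega>|M. iexp (w k * a k \<omega>))"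
      unfolding char_def by (intro prod.cong refl) (subst integral_distr, auto simp: mult.commute)
    also have "\<dots> = exp (- (\<Sum>k<n. (w k)\<^sup>2) / 2)"
      unfolding char_a by (simp add: exp_sum[symmetric] sum_negf sum_divide_distrib flip: of_real_prod)
    finally show ?thesis
      unfolding char_def by (subst (asm) integral_distr) auto
  qed
  moreover have "(\<lambda>n. complex_of_real (exp (- (\<Sum>k<n. (w k)\<^sup>2) / 2))) \<longlonglongrightarrow> exp (- (\<Sum>k. (w k)\<^sup>2) / 2)"
    using geometric_decay_summable_mult[OF w w]
    by (intro tendsto_intros summable_LIMSEQ) (auto simp: power2_eq_square)
  ultimately show "(\<lambda>n. CLINT \<omega>|M. iexp (\<Sum>k<n. a k \<omega> * w k)) \<longlonglongrightarrow> exp (- (\<Sum>k. (w k)\<^sup>2) / 2)"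
    by simp
qed

lemma AE_gsum_sum:
  assumes "finite J" "\<And>j. j \<in> J \<Longrightarrow> geometric_decay (w j)"
  shows "AE \<omega> in M. (\<Sum>j\<in>J. c j * gsum (w j) \<omega>) = gsum (\<lambda>k. \<Sum>j\<in>J. c j * w j k) \<omega>"
proof -
  have "AE \<omega> in M. \<forall>j\<in>J. summable (\<lambda>k. a k \<omega> * w j k)"
    using assms by (subst AE_ball_countable) (auto intro: AE_summable_gsum countable_finite)
  then show ?thesis
  proof eventually_elim
    case (elim \<omega>)
    have "gsum (\<lambda>k. \<Sum>j\<in>J. c j * w j k) \<omega> = (\<Sum>k. \<Sum>j\<in>J. c j * (a k \<omega> * w j k))"
      unfolding gsum_def by (simp add: sum_distrib_left mult_ac)
    also have "\<dots> = (\<Sum>j\<in>J. \<Sum>k. c j * (a k \<omega> * w j k))"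
      using elim by (intro suminf_sum) (auto intro: summable_mult)
    also have "\<dots> = (\<Sum>j\<in>J. c j * gsum (w j) \<omega>)"
      unfolding gsum_def using elim by (intro sum.cong refl suminf_mult) auto
    finally show ?case by simp
  qed
qed

text \<open>A linear combination of such series is again one, and its characteristic function is a
  function of the Gram matrix of the weights alone. This permits replacing the power weights by any
  system with the same inner products.\<close>

lemma distr_gsum_eq_of_gram_eq:
  assumes J: "finite J"
    and v: "\<And>j. geometric_decay (v j)" and w: "\<And>j. geometric_decay (w j)"
    and gram: "\<And>i j. i \<in> J \<Longrightarrow> j \<in> J \<Longrightarrow> (\<Sum>k. v i k * v j k) = (\<Sum>k. w i k * w j k)"
  shows "distr M (\<Pi>\<^sub>M j\<in>J. borel) (\<lambda>\<omega>. \<lambda>j\<in>J. gsum (v j) \<omega>) =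
         distr M (\<Pi>\<^sub>M j\<in>J. borel) (\<lambda>\<omega>. \<lambda>j\<in>J. gsum (w j) \<omega>)"
proof (rule joint_char_determines_distr[OF prob_space_axioms prob_space_axioms J])
  fix c :: "'b \<Rightarrow> real"
  have char: "(CLINT \<omega>|M. iexp (\<Sum>j\<in>J. c j * gsum (u j) \<omega>)) =
      exp (- (\<Sum>i\<in>J. \<Sum>j\<in>J. c i * c j * (\<Sum>k. u i k * u j k)) / 2)"
    if u: "\<And>j. geometric_decay (u j)" for u
  proof -
    have "(CLINT \<omega>|M. iexp (\<Sum>j\<in>J. c j * gsum (u j) \<omega>)) = (CLINT \<omega>|M. iexp (gsum (\<lambda>k. \<Sum>j\<in>J. c j * u j k) \<omega>))"
    proof (rule integral_cong_AE)
      show "AE \<omega> in M. iexp (\<Sum>j\<in>J. c j * gsum (u j) \<omega>) = iexp (gsum (\<lambda>k. \<Sum>j\<in>J. c j * u j k) \<omega>)"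
        using AE_gsum_sum[where w=u and c=c, OF J u] by eventually_elim (simp only:)
    qed auto
    also have "\<dots> = exp (- (\<Sum>k. (\<Sum>j\<in>J. c j * u j k)\<^sup>2) / 2)"
      by (rule char_gsum) (intro geometric_decay_sum u)
    also have "(\<Sum>k. (\<Sum>j\<in>J. c j * u j k)\<^sup>2) = (\<Sum>k. \<Sum>i\<in>J. \<Sum>j\<in>J. c i * c j * (u i k * u j k))"
      by (simp add: power2_eq_square sum_product mult_ac)
    also have "\<dots> = (\<Sum>i\<in>J. \<Sum>j\<in>J. \<Sum>k. c i * c j * (u i k * u j k))"
      using u by (subst suminf_sum) (auto intro!: sum.cong suminf_sum summable_sum summable_mult geometric_decay_summable_mult)
    also have "\<dots> = (\<Sum>i\<in>J. \<Sum>j\<in>J. c i * c j * (\<Sum>k. u i k * u j k))"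
      using u by (intro sum.cong refl suminf_mult geometric_decay_summable_mult)
    finally show ?thesis .
  qed
  show "(CLINT \<omega>|M. iexp (\<Sum>j\<in>J. c j * gsum (v j) \<omega>)) = (CLINT \<omega>|M. iexp (\<Sum>j\<in>J. c j * gsum (w j) \<omega>))"
    unfolding char[OF v] char[OF w] using gram by (simp cong: sum.cong)
qed auto

end

section \<open>A bivariate Gaussian absolute moment\<close>

abbreviation "\<phi> \<equiv> std_normal_density"

text \<open>The product is negative exactly when \<open>q\<close> lies strictly between the roots
  -A/T and -B/T. This is how a sign change turns into the absolute value of an increment.\<close>

lemma emeasure_between:
  fixes A B T :: real
  assumes "T \<noteq> 0"
  shows "emeasure lborel {q. (A + T * q) * (B + T * q) < 0} = ennreal (\<bar>A - B\<bar> / \<bar>T\<bar>)"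
proof -
  have between: "(q - x) * (q - y) < 0 \<longleftrightarrow> min x y < q \<and> q < max x y" for q x y :: real
    by (auto simp: mult_less_0_iff min_def max_def)
  have T2: "0 < T * T" using assms by (metis not_real_square_gt_zero)
  have "(A + T * q) * (B + T * q) = (T * T) * ((q - - A / T) * (q - - B / T))" for q
    using assms by (simp add: field_simps)
  then have "(A + T * q) * (B + T * q) < 0 \<longleftrightarrow> (q - - A / T) * (q - - B / T) < 0" for q
    using T2 by (metis mult_less_0_iff order_less_asym)
  then have "{q. (A + T * q) * (B + T * q) < 0} = {min (- A / T) (- B / T)<..<max (- A / T) (- B / T)}"
    by (intro set_eqI) (simp only: mem_Collect_eq greaterThanLessThan_iff between)
  moreover have "max (- A / T) (- B / T) - min (- A / T) (- B / T) = \<bar>A - B\<bar> / \<bar>T\<bar>"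
  proof -
    have "max (- A / T) (- B / T) - min (- A / T) (- B / T) = \<bar>(A - B) / T\<bar>"
      by (simp add: diff_divide_distrib)
    then show ?thesis by (simp add: abs_divide)
  qed
  ultimately show ?thesis by simp
qed

text \<open>Splitting at the root \<open>m0\<close> of c + T m, an explicit antiderivative handles
  both halves. Its limits at the two infinities cancel and -2 F(m0) remains; c^2 + T^2 = 1 enters as
  1 + m0^2 = 1/T^2.\<close>

lemma nn_integral_abs_linear_Cauchy_square:
  fixes c T :: real
  assumes T: "0 < T" and cT: "c\<^sup>2 + T\<^sup>2 = 1"
  shows "(\<integral>\<^sup>+m. ennreal (\<bar>c + T * m\<bar> / (1 + m\<^sup>2)\<^sup>2) \<partial>lborel) = ennreal (T + c * arctan (c / T))"
proof -
  define F where "F m = c / 2 * (m / (1 + m\<^sup>2) + arctan m) - T / (2 * (1 + m\<^sup>2))" for m :: real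
  define m0 where "m0 = - c / T"
  have pos: "0 < 1 + m\<^sup>2" for m :: real by (simp add: add_pos_nonneg)
  have dF: "(F has_real_derivative (c + T * m) / (1 + m\<^sup>2)\<^sup>2) (at m)" for m
  proof -
    let ?p = "1 + m\<^sup>2"
    have "(F has_real_derivative
        (c / 2 * ((?p - m * (2 * m)) / (?p * ?p) + inverse ?p) + T * (4 * m) / (2 * ?p * (2 * ?p)))) (at m)"
      unfolding F_def using pos[of m] by (auto intro!: derivative_eq_intros simp: mult_ac)
    moreover have "c / 2 * ((?p - m * (2 * m)) / (?p * ?p) + inverse ?p) + T * (4 * m) / (2 * ?p * (2 * ?p)) = (c + T * m) / ?p\<^sup>2"
      using pos[of m] by (simp add: divide_simps power2_eq_square[of ?p]) (simp add: power2_eq_square algebra_simps)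
    ultimately show ?thesis by simp
  qed
  have lim1: "(F \<longlongrightarrow> c * pi / 4) at_top" unfolding F_def by real_asymp
  have lim2: "((\<lambda>m. F (- m)) \<longlongrightarrow> - (c * pi / 4)) at_top" unfolding F_def by real_asymp
  have right: "(\<integral>\<^sup>+m. ennreal ((c + T * m) / (1 + m\<^sup>2)\<^sup>2) * indicator {m0..} m \<partial>lborel) = ennreal (c * pi / 4 - F m0)"
    by (rule nn_integral_FTC_atLeast[OF _ dF _ lim1]) (use T in \<open>auto simp: m0_def field_simps\<close>)
  \<comment> \<open>The half-line below \<open>m0\<close> is reflected, so that the fundamental
    theorem for half-lines unbounded above covers it too.\<close>
  have left: "(\<integral>\<^sup>+m. ennreal ((T * m - c) / (1 + m\<^sup>2)\<^sup>2) * indicator {- m0..} m \<partial>lborel) = ennreal (- (c * pi / 4) - F (- (- m0)))"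
  proof (rule nn_integral_FTC_atLeast[OF _ _ _ lim2])
    fix m
    show "((\<lambda>m. F (- m)) has_real_derivative (T * m - c) / (1 + m\<^sup>2)\<^sup>2) (at m)"
    proof -
      have "((\<lambda>m. F (- m)) has_real_derivative (c + T * - m) / (1 + (- m)\<^sup>2)\<^sup>2 * (- 1)) (at m)"
        by (rule DERIV_chain2[where f=F and g=uminus, OF dF]) (auto intro!: derivative_eq_intros)
      moreover have "(c + T * - m) / (1 + (- m)\<^sup>2)\<^sup>2 * (- 1) = (T * m - c) / (1 + m\<^sup>2)\<^sup>2"
        by (simp add: minus_divide_left)
      ultimately show ?thesis by simp
    qed
  qed (use T in \<open>auto simp: m0_def field_simps\<close>)
  have left': "(\<integral>\<^sup>+m. ennreal ((T * m - c) / (1 + m\<^sup>2)\<^sup>2) * indicator {- m0..} m \<partial>lborel) =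
     (\<integral>\<^sup>+m. ennreal (- (c + T * m) / (1 + m\<^sup>2)\<^sup>2) * indicator {..m0} m \<partial>lborel)"
    by (subst nn_integral_real_affine[where c="-1" and t=0]) (auto intro!: nn_integral_cong simp: indicator_def)
  have "(\<integral>\<^sup>+m. ennreal (\<bar>c + T * m\<bar> / (1 + m\<^sup>2)\<^sup>2) \<partial>lborel) =
     (\<integral>\<^sup>+m. ennreal ((c + T * m) / (1 + m\<^sup>2)\<^sup>2) * indicator {m0..} m
          + ennreal (- (c + T * m) / (1 + m\<^sup>2)\<^sup>2) * indicator {..m0} m \<partial>lborel)"
  proof (rule nn_integral_cong)
    fix m
    have "m0 \<le> m \<longleftrightarrow> 0 \<le> c + T * m" "m \<le> m0 \<longleftrightarrow> c + T * m \<le> 0"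
      using T by (auto simp: m0_def field_simps)
    then show "ennreal (\<bar>c + T * m\<bar> / (1 + m\<^sup>2)\<^sup>2) = ennreal ((c + T * m) / (1 + m\<^sup>2)\<^sup>2) * indicator {m0..} m
          + ennreal (- (c + T * m) / (1 + m\<^sup>2)\<^sup>2) * indicator {..m0} m"
      by (auto simp: indicator_def abs_if not_le)
  qed
  also have "\<dots> = ennreal (c * pi / 4 - F m0) + ennreal (- (c * pi / 4) - F (- (- m0)))"
    using right left left' by (subst nn_integral_add) auto
  \<comment> \<open>\<open>ennreal\<close> truncates negative reals to 0, so adding inside it
    requires both halves to be nonnegative. This holds because \<open>F\<close> increases to the
    right of \<open>m0\<close> and decreases to the left of it.\<close>
  also have "\<dots> = ennreal (c * pi / 4 - F m0 + (- (c * pi / 4) - F (- (- m0))))"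
  proof (rule ennreal_plus[symmetric])
    have mono: "F x \<le> l" if l: "(F \<longlongrightarrow> l) at_top" and "m0 \<le> x" for x l
    proof (rule tendsto_lowerbound[OF l])
      have "F x \<le> F y" if "x \<le> y" for y
      proof (rule DERIV_nonneg_imp_nondecreasing[OF that])
        fix z assume "x \<le> z" "z \<le> y"
        then have "m0 \<le> z" using \<open>m0 \<le> x\<close> by simp
        then have "0 \<le> c + T * z" using T by (auto simp: m0_def field_simps)
        then show "\<exists>w. DERIV F z :> w \<and> 0 \<le> w" by (intro exI[of _ "(c + T * z) / (1 + z\<^sup>2)\<^sup>2"] conjI dF) auto
      qed
      then show "\<forall>\<^sub>F y in at_top. F x \<le> F y" by (auto simp: eventually_at_top_linorder)
    qed auto
    show "0 \<le> c * pi / 4 - F m0" using mono[OF lim1, of m0] by simp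
    have "F (- (- m0)) \<le> - (c * pi / 4)"
    proof (rule tendsto_lowerbound[OF lim2])
      have "F (- (- m0)) \<le> F (- y)" if "- m0 \<le> y" for y
      proof (rule DERIV_nonpos_imp_nonincreasing[of "- y" "- (- m0)"])
        show "- y \<le> - (- m0)" using that by simp
        fix z assume "- y \<le> z" "z \<le> - (- m0)"
        then have "c + T * z \<le> 0" using T by (auto simp: m0_def field_simps)
        then show "\<exists>w. DERIV F z :> w \<and> w \<le> 0"
            by (intro exI[of _ "(c + T * z) / (1 + z\<^sup>2)\<^sup>2"] conjI dF) (auto simp: divide_nonpos_nonneg)
      qed
      then show "\<forall>\<^sub>F y in at_top. F (- (- m0)) \<le> F (- y)" by (auto simp: eventually_at_top_linorder)
    qed auto
    then show "0 \<le> - (c * pi / 4) - F (- (- m0))" by simp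
  qed
  also have "c * pi / 4 - F m0 + (- (c * pi / 4) - F (- (- m0))) = T + c * arctan (c / T)"
  proof -
    have sq: "1 + (c / T)\<^sup>2 = 1 / T\<^sup>2"
      using T cT by (simp add: field_simps power2_eq_square)
    have "c * pi / 4 - F m0 + (- (c * pi / 4) - F (- (- m0))) = - 2 * F m0" by simp
    also have "\<dots> = c * (c / T * T\<^sup>2 + arctan (c / T)) + T * T\<^sup>2"
      unfolding F_def m0_def minus_divide_left[symmetric] power2_minus sq arctan_minus
      by (simp add: algebra_simps)
    also have "\<dots> = (c\<^sup>2 + T\<^sup>2) * T + c * arctan (c / T)"
      using T by (simp add: field_simps power2_eq_square)
    finally show ?thesis using cT by simp
  qed
  finally show ?thesis .
qed

text \<open>Along the line of slope \<open>m\<close> the product density is proportional to a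
  Gaussian of variance 1/(1 + m^2), and rescaling by \<open>s\<close> gives an odd absolute moment
  of the standard normal. In the exponent, 2 j belongs to the integrand and 1 to the Jacobian of z =
  y m.\<close>

lemma nn_integral_Gaussian_ray:
  "(\<integral>\<^sup>+y. ennreal (\<phi> y * \<phi> (y * m) * \<bar>y\<bar> ^ (2 * j + 1)) \<partial>lborel) =
    ennreal (2 ^ j * fact j / (pi * (1 + m\<^sup>2) ^ (j + 1)))"
proof -
  have pos: "0 < 1 + m\<^sup>2" by (simp add: add_pos_nonneg)
  define s where "s = 1 / sqrt (1 + m\<^sup>2)"
  have s: "0 < s" "s\<^sup>2 = 1 / (1 + m\<^sup>2)"
    using pos by (auto simp: s_def power_divide)
  have e: "s * (\<phi> (0 + s * t) * \<phi> ((0 + s * t) * m) * \<bar>0 + s * t\<bar> ^ (2 * j + 1)) =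
      (s\<^sup>2) ^ (j + 1) / sqrt (2 * pi) * (\<phi> t * \<bar>t\<bar> ^ (2 * j + 1))" for t
  proof -
    have "- ((s * t)\<^sup>2 / 2) + - ((s * t * m)\<^sup>2 / 2) = - ((s\<^sup>2 * (1 + m\<^sup>2)) * t\<^sup>2 / 2)"
      by (simp add: field_simps power2_eq_square)
    then have "exp (- ((s * t)\<^sup>2 / 2)) * exp (- ((s * t * m)\<^sup>2 / 2)) = exp (- (t\<^sup>2 / 2))"
      unfolding exp_add[symmetric] using s pos by simp
    then have "\<phi> (s * t) * \<phi> (s * t * m) = \<phi> t / sqrt (2 * pi)"
      unfolding std_normal_density_def by (simp add: field_simps)
    moreover have "s * s ^ (2 * j + 1) = (s\<^sup>2) ^ (j + 1)"
      by (simp add: power_mult[symmetric]) (simp add: power2_eq_square)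
    ultimately show ?thesis
      using s(1) by (simp add: abs_mult power_mult_distrib mult_ac)
  qed
  have "(\<integral>\<^sup>+y. ennreal (\<phi> y * \<phi> (y * m) * \<bar>y\<bar> ^ (2 * j + 1)) \<partial>lborel) =
     ennreal \<bar>s\<bar> * (\<integral>\<^sup>+t. ennreal (\<phi> (0 + s * t) * \<phi> ((0 + s * t) * m) * \<bar>0 + s * t\<bar> ^ (2 * j + 1)) \<partial>lborel)"
    by (rule nn_integral_real_affine) (use s(1) in auto)
  also have "\<dots> = (\<integral>\<^sup>+t. ennreal (\<bar>s\<bar> * (\<phi> (0 + s * t) * \<phi> ((0 + s * t) * m) * \<bar>0 + s * t\<bar> ^ (2 * j + 1))) \<partial>lborel)"
    by (subst nn_integral_cmult[symmetric]) (simp_all only: ennreal_mult'[OF abs_ge_zero, symmetric], measurable)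
  also have "\<dots> = (\<integral>\<^sup>+t. ennreal ((s\<^sup>2) ^ (j + 1) / sqrt (2 * pi) * (\<phi> t * \<bar>t\<bar> ^ (2 * j + 1))) \<partial>lborel)"
    using s(1) by (simp only: abs_of_pos e)
  also have "\<dots> = ennreal ((s\<^sup>2) ^ (j + 1) / sqrt (2 * pi) * (sqrt (2 / pi) * 2 ^ j * fact j))"
    using std_normal_moment_abs_odd[of j] s(1)
    by (subst nn_integral_eq_integral) (auto simp: has_bochner_integral_iff)
  also have "(s\<^sup>2) ^ (j + 1) / sqrt (2 * pi) * (sqrt (2 / pi) * 2 ^ j * fact j) = 2 ^ j * fact j / (pi * (1 + m\<^sup>2) ^ (j + 1))"
  proof -
    have "sqrt (2 / pi) / sqrt (2 * pi) = 1 / pi"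
      by (simp add: real_sqrt_divide real_sqrt_mult)
    moreover have "p / q * (r * u * v) = p * (r / q) * (u * v)" for p q r u v :: real by simp
    ultimately show ?thesis
      unfolding s(2) power_one_over by (simp only:) (simp add: divide_simps mult_ac)
  qed
  finally show ?thesis .
qed

text \<open>Substitution z = y m at fixed y, then exchange of the integrals. The case j = 0 is the
  Cauchy law of the slope, used for a single sign change; j = 1 serves integrands homogeneous of
  degree two, used for a pair.\<close>

lemma nn_integral_Gaussian_slope:
  fixes g :: "real \<Rightarrow> real"
  assumes [measurable]: "g \<in> borel_measurable borel" and g: "\<And>m. 0 \<le> g m"
  shows "(\<integral>\<^sup>+y. \<integral>\<^sup>+z. ennreal (\<phi> y * \<phi> z * (\<bar>y\<bar> ^ (2 * j) * g (z / y))) \<partial>lborel \<partial>lborel) =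
    (\<integral>\<^sup>+m. ennreal (g m * (2 ^ j * fact j / (pi * (1 + m\<^sup>2) ^ (j + 1)))) \<partial>lborel)"
proof -
  have inner: "(\<integral>\<^sup>+z. ennreal (\<phi> y * \<phi> z * (\<bar>y\<bar> ^ (2 * j) * g (z / y))) \<partial>lborel) =
     (\<integral>\<^sup>+m. ennreal (g m * (\<phi> y * \<phi> (y * m) * \<bar>y\<bar> ^ (2 * j + 1))) \<partial>lborel)" if "y \<noteq> 0" for y
  proof -
    have "(\<integral>\<^sup>+z. ennreal (\<phi> y * \<phi> z * (\<bar>y\<bar> ^ (2 * j) * g (z / y))) \<partial>lborel) =
      ennreal \<bar>y\<bar> * (\<integral>\<^sup>+m. ennreal (\<phi> y * \<phi> (0 + y * m) * (\<bar>y\<bar> ^ (2 * j) * g ((0 + y * m) / y))) \<partial>lborel)"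
      by (rule nn_integral_real_affine) (use that in auto)
    also have "\<dots> = (\<integral>\<^sup>+m. ennreal (\<bar>y\<bar> * (\<phi> y * \<phi> (0 + y * m) * (\<bar>y\<bar> ^ (2 * j) * g ((0 + y * m) / y)))) \<partial>lborel)"
      by (subst nn_integral_cmult[symmetric]) (simp_all only: ennreal_mult'[OF abs_ge_zero, symmetric], measurable)
    finally show ?thesis using that by (simp add: mult_ac)
  qed
  have "(\<integral>\<^sup>+y. \<integral>\<^sup>+z. ennreal (\<phi> y * \<phi> z * (\<bar>y\<bar> ^ (2 * j) * g (z / y))) \<partial>lborel \<partial>lborel) =
    (\<integral>\<^sup>+y. \<integral>\<^sup>+m. ennreal (g m * (\<phi> y * \<phi> (y * m) * \<bar>y\<bar> ^ (2 * j + 1))) \<partial>lborel \<partial>lborel)"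
    by (rule nn_integral_cong_AE, rule eventually_mono[OF AE_lborel_singleton[of 0]]) (rule inner)
  also have "\<dots> = (\<integral>\<^sup>+m. \<integral>\<^sup>+y. ennreal (g m * (\<phi> y * \<phi> (y * m) * \<bar>y\<bar> ^ (2 * j + 1))) \<partial>lborel \<partial>lborel)"
    by (rule lborel_pair.Fubini') auto
  also have "\<dots> = (\<integral>\<^sup>+m. ennreal (g m * (2 ^ j * fact j / (pi * (1 + m\<^sup>2) ^ (j + 1)))) \<partial>lborel)"
    unfolding ennreal_mult'[OF g] nn_integral_Gaussian_ray[symmetric]
    by (intro nn_integral_cong nn_integral_cmult) measurable
  finally show ?thesis .
qed

text \<open>The integrand is homogeneous of degree two: it equals y^2 |c + T (z/y)|.\<close>

lemma nn_integral_abs_product_Gaussian: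
  fixes c T :: real
  assumes T: "0 < T" and cT: "c\<^sup>2 + T\<^sup>2 = 1"
  shows "(\<integral>\<^sup>+y. \<integral>\<^sup>+z. ennreal (\<phi> y * \<phi> z * (\<bar>y\<bar> * \<bar>c * y + T * z\<bar>)) \<partial>lborel \<partial>lborel)
    = ennreal (2 / pi * (T + c * arctan (c / T)))"
proof -
  have "\<bar>y\<bar> * \<bar>c * y + T * z\<bar> = \<bar>y\<bar> ^ (2 * 1) * \<bar>c + T * (z / y)\<bar>" if "y \<noteq> 0" for y z
  proof -
    have "c * y + T * z = y * (c + T * (z / y))" using that by (simp add: field_simps)
    then show ?thesis by (simp only: abs_mult) (simp add: power2_eq_square)
  qed
  then have "(\<integral>\<^sup>+y. \<integral>\<^sup>+z. ennreal (\<phi> y * \<phi> z * (\<bar>y\<bar> * \<bar>c * y + T * z\<bar>)) \<partial>lborel \<partial>lborel) =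
      (\<integral>\<^sup>+y. \<integral>\<^sup>+z. ennreal (\<phi> y * \<phi> z * (\<bar>y\<bar> ^ (2 * 1) * \<bar>c + T * (z / y)\<bar>)) \<partial>lborel \<partial>lborel)"
    by (intro nn_integral_cong_AE eventually_mono[OF AE_lborel_singleton[of 0]]) simp
  also have "\<dots> = (\<integral>\<^sup>+m. ennreal (2 / pi) * ennreal (\<bar>c + T * m\<bar> / (1 + m\<^sup>2)\<^sup>2) \<partial>lborel)"
    by (subst nn_integral_Gaussian_slope) (auto simp: ennreal_mult'[symmetric] numeral_2_eq_2 mult_ac intro!: nn_integral_cong)
  also have "\<dots> = ennreal (2 / pi) * ennreal (T + c * arctan (c / T))"
    by (simp add: nn_integral_cmult nn_integral_abs_linear_Cauchy_square[OF T cT])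
  also have "\<dots> = ennreal (2 / pi * (T + c * arctan (c / T)))"
    by (rule ennreal_mult'[symmetric]) simp
  finally show ?thesis .
qed

section \<open>Limits of scaled sign-change probabilities\<close>

text \<open>If u v < 0 then |u| is at most |v - u|. Here both differences contain \<open>p\<close>
  and \<open>q\<close> only with coefficients bounded by \<eta>, plus terms in \<open>y\<close> and
  \<open>z\<close>. Since T is at least T0/2, this gives s \<le> \<eta> (1 + 6/T0) s + (2 + 12/T0) m
  for s = |p| + |q| and m = |y| + |z|; \<eta> is chosen to make the first coefficient 1/2, so that
  it can be absorbed.\<close>

lemma sign_change_box_bound:
  fixes \<alpha> \<beta> \<gamma> c T c' T' \<delta> \<epsilon> p q y z :: real
  assumes T: "0 < T0" "T0 / 2 \<le> T" and c: "\<bar>c\<bar> \<le> 2"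
    and \<eta>: "\<eta> = 1 / (2 * (1 + 6 / T0))"
    and small: "\<bar>\<alpha> - 1\<bar> \<le> \<eta>" "\<bar>\<beta>\<bar> \<le> \<eta>" "\<bar>c' - c\<bar> \<le> \<eta>" "\<bar>T' - T\<bar> \<le> \<eta>"
    and bound: "\<bar>\<gamma>\<bar> \<le> 2" "\<bar>\<delta>\<bar> \<le> 2" "\<bar>\<epsilon>\<bar> \<le> 2"
    and sign: "p * (\<alpha> * p + \<beta> * q + \<gamma> * y) < 0" "(c * p + T * q) * (c' * p + T' * q + \<delta> * y + \<epsilon> * z) < 0"
  shows "\<bar>p\<bar> + \<bar>q\<bar> \<le> (4 + 24 / T0) * (\<bar>y\<bar> + \<bar>z\<bar>)"
proof -
  have opp: "\<bar>u\<bar> \<le> \<bar>v - u\<bar>" if "u * v < 0" for u v :: real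
    using that by (auto simp: mult_less_0_iff)
  define s where "s = \<bar>p\<bar> + \<bar>q\<bar>"
  define m where "m = \<bar>y\<bar> + \<bar>z\<bar>"
  have prod: "\<bar>u * v\<bar> \<le> C * \<bar>v\<bar>" if "\<bar>u\<bar> \<le> C" for u v C :: real
    using that by (simp add: abs_mult mult_right_mono)
  have "\<bar>p\<bar> \<le> \<bar>(\<alpha> - 1) * p + \<beta> * q + \<gamma> * y\<bar>"
    using opp[OF sign(1)] by (simp add: algebra_simps)
  also have "\<dots> \<le> \<eta> * \<bar>p\<bar> + \<eta> * \<bar>q\<bar> + 2 * \<bar>y\<bar>"
    using prod[OF small(1), of p] prod[OF small(2), of q] prod[OF bound(1), of y] by linarith
  finally have p: "\<bar>p\<bar> \<le> \<eta> * s + 2 * m"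
    unfolding s_def m_def by (simp add: distrib_left)
  have "\<bar>c * p + T * q\<bar> \<le> \<bar>(c' - c) * p + (T' - T) * q + \<delta> * y + \<epsilon> * z\<bar>"
    using opp[OF sign(2)] by (simp add: algebra_simps)
  also have "\<dots> \<le> \<eta> * \<bar>p\<bar> + \<eta> * \<bar>q\<bar> + 2 * \<bar>y\<bar> + 2 * \<bar>z\<bar>"
    using prod[OF small(3), of p] prod[OF small(4), of q] prod[OF bound(2), of y] prod[OF bound(3), of z] by linarith
  finally have "\<bar>c * p + T * q\<bar> \<le> \<eta> * s + 2 * m"
    unfolding s_def m_def by (simp add: distrib_left)
  then have "\<bar>T * q\<bar> \<le> 3 * (\<eta> * s) + 6 * m"
    using prod[OF c, of p] p by linarith
  moreover have "T0 / 2 * \<bar>q\<bar> \<le> \<bar>T * q\<bar>"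
    unfolding abs_mult using T by (intro mult_right_mono) auto
  ultimately have "T0 / 2 * \<bar>q\<bar> \<le> 3 * (\<eta> * s) + 6 * m" by linarith
  then have "\<bar>q\<bar> \<le> 6 / T0 * (\<eta> * s) + 12 / T0 * m"
    using T(1) by (simp add: field_simps)
  with p have "s \<le> \<eta> * (1 + 6 / T0) * s + (2 + 12 / T0) * m"
    by (simp add: s_def algebra_simps add_divide_distrib)
  moreover have "\<eta> * (1 + 6 / T0) = 1 / 2"
  proof -
    have "1 / (2 * x) * x = 1 / 2" if "0 < x" for x :: real
      using that by simp
    moreover have "0 < 1 + 6 / T0" using T(1) by (simp add: add_pos_pos)
    ultimately show ?thesis unfolding \<eta> by blast
  qed
  ultimately have "s \<le> 2 * ((2 + 12 / T0) * m)" by simp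
  then show ?thesis unfolding s_def m_def by (simp add: algebra_simps)
qed

lemma std_normal_density_le: "\<phi> x \<le> 1 / sqrt (2 * pi)"
  unfolding std_normal_density_def by (simp add: divide_le_cancel)

lemma tendsto_std_normal_density:
  assumes "(f \<longlongrightarrow> x) F"
  shows "((\<lambda>n. \<phi> (f n)) \<longlongrightarrow> \<phi> x) F"
  unfolding std_normal_density_def by (intro tendsto_intros assms) auto

lemma nn_integral_lborel_quadruple:
  fixes f :: "(real \<times> real) \<times> (real \<times> real) \<Rightarrow> ennreal"
  assumes f[measurable]: "f \<in> borel_measurable ((lborel \<Otimes>\<^sub>M lborel) \<Otimes>\<^sub>M (lborel \<Otimes>\<^sub>M lborel))"
  shows "(\<integral>\<^sup>+w. f w \<partial>((lborel \<Otimes>\<^sub>M lborel) \<Otimes>\<^sub>M (lborel \<Otimes>\<^sub>M lborel))) =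
     (\<integral>\<^sup>+y. \<integral>\<^sup>+z. \<integral>\<^sup>+p. \<integral>\<^sup>+q. f ((y, z), (p, q)) \<partial>lborel \<partial>lborel \<partial>lborel \<partial>lborel)"
proof -
  have "(\<integral>\<^sup>+w. f w \<partial>((lborel \<Otimes>\<^sub>M lborel) \<Otimes>\<^sub>M (lborel \<Otimes>\<^sub>M lborel))) =
      (\<integral>\<^sup>+yz. \<integral>\<^sup>+pq. f (yz, pq) \<partial>(lborel \<Otimes>\<^sub>M lborel) \<partial>(lborel \<Otimes>\<^sub>M lborel))"
    by (rule sigma_finite_measure.nn_integral_fst[OF _ f, symmetric]) (simp add: lborel_prod sigma_finite_lborel)
  also have "\<dots> = (\<integral>\<^sup>+yz. \<integral>\<^sup>+p. \<integral>\<^sup>+q. f (yz, (p, q)) \<partial>lborel \<partial>lborel \<partial>(lborel \<Otimes>\<^sub>M lborel))"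
    by (intro nn_integral_cong lborel.nn_integral_fst[symmetric]) (auto simp: space_pair_measure)
  also have "\<dots> = (\<integral>\<^sup>+y. \<integral>\<^sup>+z. \<integral>\<^sup>+p. \<integral>\<^sup>+q. f ((y, z), (p, q)) \<partial>lborel \<partial>lborel \<partial>lborel \<partial>lborel)"
    by (rule lborel.nn_integral_fst[symmetric]) measurable
  finally show ?thesis .
qed

text \<open>\<open>p\<close> and \<open>q\<close> are the Gaussian coordinates behind the two base
  values in units of \<tau>; \<open>y\<close> and \<open>z\<close> are the fresh directions of the
  increments. Although the rescaled densities in \<open>p\<close> and \<open>q\<close> flatten to
  the constant 1/(2 pi), the mass cannot escape: the sign conditions confine \<open>p\<close> and
  \<open>q\<close> to a box of size linear in |y| + |z|, and this gives an integrable
  majorant.\<close>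

lemma sign_change_probability_limit:
  fixes \<tau> \<alpha> \<beta> \<gamma> c T c' T' \<delta> \<epsilon> :: "nat \<Rightarrow> real" and c0 T0 :: real
  defines "E \<equiv> \<lambda>n y z p q. p * (\<alpha> n * p + \<beta> n * q + \<gamma> n * y) < 0 \<and>
      (c n * p + T n * q) * (c' n * p + T' n * q + \<delta> n * y + \<epsilon> n * z) < 0"
  assumes T0: "0 < T0" and cT: "c0\<^sup>2 + T0\<^sup>2 = 1"
    and lims: "\<tau> \<longlonglongrightarrow> 0" "\<alpha> \<longlonglongrightarrow> 1" "\<beta> \<longlonglongrightarrow> 0" "\<gamma> \<longlonglongrightarrow> - T0" "c \<longlonglongrightarrow> c0" "T \<longlonglongrightarrow> T0"
      "c' \<longlonglongrightarrow> c0" "T' \<longlonglongrightarrow> T0" "\<delta> \<longlonglongrightarrow> T0 * c0" "\<epsilon> \<longlonglongrightarrow> T0 * T0"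
  shows "(\<lambda>n. \<integral>\<^sup>+y. \<integral>\<^sup>+z. \<integral>\<^sup>+p. \<integral>\<^sup>+q. (if E n y z p q then
             ennreal (\<phi> y * \<phi> z *
               (\<phi> (\<tau> n * p) * \<phi> (\<tau> n * q))) else 0)
             \<partial>lborel \<partial>lborel \<partial>lborel \<partial>lborel)
         \<longlonglongrightarrow> ennreal (T0 / pi\<^sup>2 * (T0 + c0 * arctan (c0 / T0)))"
proof -
  let ?N = "lborel :: ((real \<times> real) \<times> (real \<times> real)) measure"
  define u where "u n w = (case w of ((y, z), (p, q)) \<Rightarrow>
     if E n y z p q then ennreal (\<phi> y * \<phi> z * (\<phi> (\<tau> n * p) * \<phi> (\<tau> n * q))) else 0)" for n w
  define E0 where "E0 y z p q \<longleftrightarrow> p * (p - T0 * y) < 0 \<and>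
      (c0 * p + T0 * q) * (c0 * p + T0 * q + T0 * c0 * y + T0 * T0 * z) < 0" for y z p q
  define v where "v w = (case w of ((y, z), (p, q)) \<Rightarrow>
     if E0 y z p q then ennreal (\<phi> y * \<phi> z * (1 / (2 * pi))) else 0)" for w
  define K where "K = 4 + 24 / T0"
  have K: "0 < K" using T0 by (simp add: K_def add_pos_pos)
  define W where "W w = (case w of ((y, z), (p, q)) \<Rightarrow>
     if \<bar>p\<bar> \<le> K * (\<bar>y\<bar> + \<bar>z\<bar>) \<and> \<bar>q\<bar> \<le> K * (\<bar>y\<bar> + \<bar>z\<bar>) then ennreal (\<phi> y * \<phi> z * (1 / (2 * pi))) else 0)" for w
  have [measurable]: "u n \<in> borel_measurable ((lborel \<Otimes>\<^sub>M lborel) \<Otimes>\<^sub>M (lborel \<Otimes>\<^sub>M lborel))"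
    "v \<in> borel_measurable ((lborel \<Otimes>\<^sub>M lborel) \<Otimes>\<^sub>M (lborel \<Otimes>\<^sub>M lborel))"
    "W \<in> borel_measurable ((lborel \<Otimes>\<^sub>M lborel) \<Otimes>\<^sub>M (lborel \<Otimes>\<^sub>M lborel))" for n
    unfolding u_def[abs_def] v_def[abs_def] W_def[abs_def] E_def E0_def by measurable
  then have [measurable]: "u n \<in> borel_measurable ?N" "v \<in> borel_measurable ?N" "W \<in> borel_measurable ?N" for n
    unfolding lborel_prod by auto
  have iterated: "(\<integral>\<^sup>+w. f w \<partial>?N) = (\<integral>\<^sup>+y. \<integral>\<^sup>+z. \<integral>\<^sup>+p. \<integral>\<^sup>+q. f ((y, z), (p, q)) \<partial>lborel \<partial>lborel \<partial>lborel \<partial>lborel)"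
    if "f \<in> borel_measurable ((lborel \<Otimes>\<^sub>M lborel) \<Otimes>\<^sub>M (lborel \<Otimes>\<^sub>M lborel))" for f
    using nn_integral_lborel_quadruple[OF that] unfolding lborel_prod .
  have v_int: "(\<integral>\<^sup>+w. v w \<partial>?N) = ennreal (T0 / pi\<^sup>2 * (T0 + c0 * arctan (c0 / T0)))"
  proof -
    \<comment> \<open>As a function of \<open>q\<close>, both factors have slope \<open>T0\<close>
      and their intercepts differ by T0 |c0 y + T0 z|, so the length in \<open>q\<close> is |c0 y +
      T0 z|. In \<open>p\<close> the slope is 1 and the offset T0 y, so the length is T0
      |y|.\<close>
    have pq: "(\<integral>\<^sup>+p. \<integral>\<^sup>+q. v ((y, z), (p, q)) \<partial>lborel \<partial>lborel) =
        ennreal (T0 / (2 * pi)) * ennreal (\<phi> y * \<phi> z * (\<bar>y\<bar> * \<bar>c0 * y + T0 * z\<bar>))" for y z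
    proof -
      let ?C = "ennreal (\<phi> y * \<phi> z * (1 / (2 * pi)))"
      let ?g = "\<bar>c0 * y + T0 * z\<bar>"
      have q: "(\<integral>\<^sup>+q. v ((y, z), (p, q)) \<partial>lborel) = ?C * ennreal ?g * indicator {p. (0 + 1 * p) * (- T0 * y + 1 * p) < 0} p" for p
      proof -
        have "(\<integral>\<^sup>+q. v ((y, z), (p, q)) \<partial>lborel) = (\<integral>\<^sup>+q. ?C * indicator {p. (0 + 1 * p) * (- T0 * y + 1 * p) < 0} p *
           indicator {q. (c0 * p + T0 * q) * ((c0 * p + T0 * c0 * y + T0 * T0 * z) + T0 * q) < 0} q \<partial>lborel)"
          by (intro nn_integral_cong) (auto simp: v_def E0_def indicator_def algebra_simps)
        also have "\<dots> = ?C * indicator {p. (0 + 1 * p) * (- T0 * y + 1 * p) < 0} p *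
            emeasure lborel {q. (c0 * p + T0 * q) * ((c0 * p + T0 * c0 * y + T0 * T0 * z) + T0 * q) < 0}"
          by (rule nn_integral_cmult_indicator) measurable
        also have "emeasure lborel {q. (c0 * p + T0 * q) * ((c0 * p + T0 * c0 * y + T0 * T0 * z) + T0 * q) < 0} = ennreal ?g"
        proof -
          have "\<bar>c0 * p - (c0 * p + T0 * c0 * y + T0 * T0 * z)\<bar> = \<bar>- T0 * (c0 * y + T0 * z)\<bar>"
            by (simp add: algebra_simps)
          also have "\<dots> = T0 * ?g" using T0 by (simp only: abs_mult abs_minus_cancel abs_of_pos)
          finally show ?thesis using T0 by (subst emeasure_between) auto
        qed
        finally show ?thesis by (simp add: mult_ac)
      qed
      have "(\<integral>\<^sup>+p. \<integral>\<^sup>+q. v ((y, z), (p, q)) \<partial>lborel \<partial>lborel) = ?C * ennreal ?g * emeasure lborel {p. (0 + 1 * p) * (- T0 * y + 1 * p) < 0}"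
        unfolding q by (rule nn_integral_cmult_indicator) measurable
      also have "\<dots> = ?C * ennreal ?g * ennreal (T0 * \<bar>y\<bar>)"
        using T0 by (subst emeasure_between) (auto simp: abs_mult)
      also have "\<dots> = ennreal (T0 / (2 * pi)) * ennreal (\<phi> y * \<phi> z * (\<bar>y\<bar> * \<bar>c0 * y + T0 * z\<bar>))"
        using T0 by (simp add: ennreal_mult'[symmetric] ennreal_mult''[symmetric] field_simps)
      finally show ?thesis .
    qed
    have "(\<integral>\<^sup>+w. v w \<partial>?N) = ennreal (T0 / (2 * pi)) * (\<integral>\<^sup>+y. \<integral>\<^sup>+z. ennreal (\<phi> y * \<phi> z * (\<bar>y\<bar> * \<bar>c0 * y + T0 * z\<bar>)) \<partial>lborel \<partial>lborel)"
      by (subst iterated) (simp_all add: pq nn_integral_cmult)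
    also have "\<dots> = ennreal (T0 / (2 * pi) * (2 / pi * (T0 + c0 * arctan (c0 / T0))))"
      unfolding nn_integral_abs_product_Gaussian[OF T0 cT] using T0 by (intro ennreal_mult'[symmetric]) auto
    also have "T0 / (2 * pi) * (2 / pi * (T0 + c0 * arctan (c0 / T0))) = T0 / pi\<^sup>2 * (T0 + c0 * arctan (c0 / T0))"
      by (simp add: power2_eq_square field_simps)
    finally show ?thesis .
  qed
  \<comment> \<open>At fixed \<open>y\<close>, \<open>z\<close> the majorant is constant on a square
    of area (2 K (|y| + |z|))^2. Its quadratic growth is dominated by a product, (|y| + |z|)^2 \<le>
    2 (1 + y^2) (1 + z^2), and the Gaussian second moments finish.\<close>
  have W_fin: "(\<integral>\<^sup>+w. W w \<partial>?N) < \<infinity>"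
  proof -
    define A where "A = (\<integral>\<^sup>+y. ennreal (\<phi> y * (1 + y\<^sup>2)) \<partial>lborel)"
    have "A < \<infinity>"
    proof -
      have "integrable lborel (\<lambda>y. \<phi> y * y ^ (2 * 0) + \<phi> y * y ^ (2 * 1))"
        using std_normal_moment_even[of 0] std_normal_moment_even[of 1]
        by (intro Bochner_Integration.integrable_add) (auto simp: has_bochner_integral_iff)
      then have "integrable lborel (\<lambda>y. \<phi> y * (1 + y\<^sup>2))" by (simp add: algebra_simps power2_eq_square)
      then show ?thesis unfolding A_def by (subst nn_integral_eq_integral) auto
    qed
    let ?L = "4 * K\<^sup>2 / pi"
    have L: "0 \<le> ?L" by simp
    have pq: "(\<integral>\<^sup>+p. \<integral>\<^sup>+q. W ((y, z), (p, q)) \<partial>lborel \<partial>lborel) \<le>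
        ennreal ?L * (ennreal (\<phi> y * (1 + y\<^sup>2)) * ennreal (\<phi> z * (1 + z\<^sup>2)))" for y z
    proof -
      let ?C = "ennreal (\<phi> y * \<phi> z * (1 / (2 * pi)))"
      let ?m = "K * (\<bar>y\<bar> + \<bar>z\<bar>)"
      have m: "0 \<le> ?m" using K by simp
      have "(\<integral>\<^sup>+p. \<integral>\<^sup>+q. W ((y, z), (p, q)) \<partial>lborel \<partial>lborel) = (\<integral>\<^sup>+p. \<integral>\<^sup>+q. ?C * indicator {- ?m..?m} p * indicator {- ?m..?m} q \<partial>lborel \<partial>lborel)"
        by (intro nn_integral_cong) (auto simp: W_def indicator_def)
      also have "\<dots> = ?C * ennreal (2 * ?m) * ennreal (2 * ?m)"
        using m by (simp add: nn_integral_cmult_indicator nn_integral_multc nn_integral_cmult)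
      also have "\<dots> = ennreal (\<phi> y * \<phi> z * (1 / (2 * pi)) * (2 * ?m) * (2 * ?m))"
        using m by (simp only: ennreal_mult''[symmetric] mult_nonneg_nonneg zero_le_numeral)
      also have "\<dots> \<le> ennreal (?L * ((\<phi> y * (1 + y\<^sup>2)) * (\<phi> z * (1 + z\<^sup>2))))"
      proof (rule ennreal_leI)
        have "0 \<le> (\<bar>y\<bar> - \<bar>z\<bar>)\<^sup>2" by simp
        then have "(\<bar>y\<bar> + \<bar>z\<bar>)\<^sup>2 \<le> 2 * (y\<^sup>2 + z\<^sup>2)" by (simp add: power2_eq_square algebra_simps)
        also have "\<dots> \<le> 2 * ((1 + y\<^sup>2) * (1 + z\<^sup>2))" by (simp add: algebra_simps)
        finally have "\<phi> y * \<phi> z * (2 * K\<^sup>2 / pi) * (\<bar>y\<bar> + \<bar>z\<bar>)\<^sup>2 \<le> \<phi> y * \<phi> z * (2 * K\<^sup>2 / pi) * (2 * ((1 + y\<^sup>2) * (1 + z\<^sup>2)))"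
          by (intro mult_left_mono) auto
        moreover have e: "F * (1 / (2 * pi)) * (2 * (K * s)) * (2 * (K * s)) = F * (2 * K\<^sup>2 / pi) * s\<^sup>2"
          "4 * K\<^sup>2 / pi * (F * U * (G * V)) = F * G * (2 * K\<^sup>2 / pi) * (2 * (U * V))" for F G s U V :: real
          by (simp_all add: power2_eq_square field_simps)
        ultimately show "\<phi> y * \<phi> z * (1 / (2 * pi)) * (2 * ?m) * (2 * ?m) \<le> ?L * ((\<phi> y * (1 + y\<^sup>2)) * (\<phi> z * (1 + z\<^sup>2)))"
          by (simp only: e)
      qed
      also have "\<dots> = ennreal ?L * (ennreal (\<phi> y * (1 + y\<^sup>2)) * ennreal (\<phi> z * (1 + z\<^sup>2)))"
        using L by (subst ennreal_mult'; simp add: ennreal_mult'')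
      finally show ?thesis .
    qed
    have "(\<integral>\<^sup>+w. W w \<partial>?N) = (\<integral>\<^sup>+y. \<integral>\<^sup>+z. \<integral>\<^sup>+p. \<integral>\<^sup>+q. W ((y, z), (p, q)) \<partial>lborel \<partial>lborel \<partial>lborel \<partial>lborel)"
      by (rule iterated) measurable
    also have "\<dots> \<le> (\<integral>\<^sup>+y. \<integral>\<^sup>+z. ennreal ?L * (ennreal (\<phi> y * (1 + y\<^sup>2)) * ennreal (\<phi> z * (1 + z\<^sup>2))) \<partial>lborel \<partial>lborel)"
      by (intro nn_integral_mono pq)
    also have "\<dots> = ennreal ?L * (A * A)"
      unfolding A_def by (simp add: nn_integral_cmult nn_integral_multc)
    also have "\<dots> < \<infinity>" using \<open>A < \<infinity>\<close> by (simp add: ennreal_mult_less_top)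
    finally show ?thesis .
  qed
  have AE_lim: "AE w in ?N. (\<lambda>n. u n w) \<longlonglongrightarrow> v w"
  proof -
    \<comment> \<open>The indicator of a strict inequality converges wherever the limiting product
      is nonzero. At fixed \<open>y\<close>, \<open>z\<close> the excluded set consists of two
      values of \<open>p\<close> and, for each other \<open>p\<close>, two values of
      \<open>q\<close>, hence is null.\<close>
    have pw: "(\<lambda>n. u n ((y, z), (p, q))) \<longlonglongrightarrow> v ((y, z), (p, q))"
      if n1: "p * (p - T0 * y) \<noteq> 0" and n2: "(c0 * p + T0 * q) * (c0 * p + T0 * q + T0 * c0 * y + T0 * T0 * z) \<noteq> 0" for y z p q
    proof -
      have t1: "(\<lambda>n. p * (\<alpha> n * p + \<beta> n * q + \<gamma> n * y)) \<longlonglongrightarrow> p * (1 * p + 0 * q + - T0 * y)"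
        by (intro tendsto_intros lims)
      have t2: "(\<lambda>n. (c n * p + T n * q) * (c' n * p + T' n * q + \<delta> n * y + \<epsilon> n * z)) \<longlonglongrightarrow>
          (c0 * p + T0 * q) * (c0 * p + T0 * q + T0 * c0 * y + T0 * T0 * z)"
        by (intro tendsto_intros lims)
      have sgn: "\<forall>\<^sub>F n in sequentially. (f n < 0) = (l < 0)" if "f \<longlonglongrightarrow> l" "l \<noteq> 0" for f and l :: real
      proof (cases "l < 0")
        case True
        then show ?thesis using order_tendstoD(2)[OF that(1), of 0] by (auto elim: eventually_mono)
      next
        case False
        then show ?thesis using order_tendstoD(1)[OF that(1), of 0] that(2) by (auto elim!: eventually_mono)
      qed
      have n1': "p * (1 * p + 0 * q + - T0 * y) \<noteq> 0" using n1 by simp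
      have ev: "\<forall>\<^sub>F n in sequentially. E n y z p q = E0 y z p q"
        using sgn[OF t1 n1'] sgn[OF t2 n2] by eventually_elim (simp add: E_def E0_def)
      have "(\<lambda>n. \<phi> (\<tau> n * p) * \<phi> (\<tau> n * q)) \<longlonglongrightarrow> \<phi> (0 * p) * \<phi> (0 * q)"
        by (intro tendsto_intros tendsto_std_normal_density lims)
      moreover have "\<phi> (0 * p) * \<phi> (0 * q) = 1 / (2 * pi)"
        by (simp add: std_normal_density_def)
      ultimately have "(\<lambda>n. ennreal (\<phi> y * \<phi> z * (\<phi> (\<tau> n * p) * \<phi> (\<tau> n * q)))) \<longlonglongrightarrow> ennreal (\<phi> y * \<phi> z * (1 / (2 * pi)))"
        by (intro tendsto_ennrealI tendsto_mult_left) simp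
      then have "(\<lambda>n. if E0 y z p q then ennreal (\<phi> y * \<phi> z * (\<phi> (\<tau> n * p) * \<phi> (\<tau> n * q))) else 0) \<longlonglongrightarrow> v ((y, z), (p, q))"
        by (simp add: v_def)
      then show ?thesis
        by (rule Lim_transform_eventually) (use ev in eventually_elim, simp add: u_def)
    qed
    define Q where "Q w = (case w of ((y, z), (p, q)) \<Rightarrow> p * (p - T0 * y) \<noteq> 0 \<and>
      (c0 * p + T0 * q) * (c0 * p + T0 * q + T0 * c0 * y + T0 * T0 * z) \<noteq> 0)" for w
    have Q_measurable[measurable]: "Measurable.pred ((lborel \<Otimes>\<^sub>M lborel) \<Otimes>\<^sub>M (lborel \<Otimes>\<^sub>M lborel)) Q"
      unfolding Q_def[abs_def] by measurable
    have ae_pq: "AE pq in lborel \<Otimes>\<^sub>M lborel. Q (yz, pq)" for yz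
    proof (rule lborel_pair.AE_pair_measure)
      show "{pq \<in> space (lborel \<Otimes>\<^sub>M lborel). Q (yz, pq)} \<in> sets (lborel \<Otimes>\<^sub>M lborel)"
        using measurable_compose[OF measurable_Pair1' Q_measurable, of yz] unfolding pred_def by (simp add: space_pair_measure)
      obtain y z where yz: "yz = (y, z)" by force
      have "AE p in lborel. p \<noteq> 0 \<and> p \<noteq> T0 * y"
        by (intro AE_conjI AE_lborel_singleton)
      then show "AE p in lborel. AE q in lborel. Q (yz, (p, q))"
      proof eventually_elim
        case (elim p)
        have "AE q in lborel. q \<noteq> - (c0 * p) / T0 \<and> q \<noteq> - (c0 * p + T0 * c0 * y + T0 * T0 * z) / T0"
          by (intro AE_conjI AE_lborel_singleton)
        then show ?case
        proof eventually_elim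
          case (elim q)
          have nz: "A + T0 * q \<noteq> 0" if "q \<noteq> - A / T0" for A
            using that T0 by (simp add: field_simps add_eq_0_iff)
          have "c0 * p + T0 * q + T0 * c0 * y + T0 * T0 * z \<noteq> 0"
            using nz[of "c0 * p + T0 * c0 * y + T0 * T0 * z"] elim by (simp only: ac_simps) simp
          with nz[of "c0 * p"] elim \<open>p \<noteq> 0 \<and> p \<noteq> T0 * y\<close> show ?case
            by (simp add: Q_def yz)
        qed
      qed
    qed
    have "AE w in (lborel \<Otimes>\<^sub>M lborel) \<Otimes>\<^sub>M (lborel \<Otimes>\<^sub>M lborel). Q w"
    proof (rule pair_sigma_finite.AE_pair_measure)
      show "pair_sigma_finite (lborel \<Otimes>\<^sub>M lborel :: (real \<times> real) measure) (lborel \<Otimes>\<^sub>M lborel :: (real \<times> real) measure)"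
        by (simp add: lborel_prod pair_sigma_finite_def sigma_finite_lborel)
      show "{w \<in> space ((lborel \<Otimes>\<^sub>M lborel) \<Otimes>\<^sub>M (lborel \<Otimes>\<^sub>M lborel)). Q w} \<in> sets ((lborel \<Otimes>\<^sub>M lborel) \<Otimes>\<^sub>M (lborel \<Otimes>\<^sub>M lborel))"
        by measurable
    qed (use ae_pq in auto)
    then show ?thesis
      unfolding lborel_prod by eventually_elim (auto simp: Q_def intro: pw)
  qed
  have dom: "\<forall>\<^sub>F n in sequentially. \<forall>w. u n w \<le> W w"
  proof -
    define \<eta> where "\<eta> = 1 / (2 * (1 + 6 / T0))"
    have \<eta>: "0 < \<eta>" using T0 by (simp add: \<eta>_def add_pos_pos)
    have near: "\<forall>\<^sub>F n in sequentially. \<bar>f n - l\<bar> \<le> r" if "f \<longlonglongrightarrow> l" "0 < r" for f and l r :: real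
      using tendstoD[OF that] by eventually_elim (simp add: dist_real_def)
    have "(\<lambda>n. c' n - c n) \<longlonglongrightarrow> c0 - c0" "(\<lambda>n. T' n - T n) \<longlonglongrightarrow> T0 - T0"
      by (intro tendsto_intros lims)+
    then have d: "(\<lambda>n. c' n - c n) \<longlonglongrightarrow> 0" "(\<lambda>n. T' n - T n) \<longlonglongrightarrow> 0" by simp_all
    have "c0\<^sup>2 \<le> 1" "T0\<^sup>2 \<le> 1"
      using cT zero_le_power2[of c0] zero_le_power2[of T0] by linarith+
    then have 1: "\<bar>c0\<bar> \<le> 1" "\<bar>T0\<bar> \<le> 1" by (simp_all add: abs_square_le_1)
    then have 2: "\<bar>T0 * c0\<bar> \<le> 1" "\<bar>T0 * T0\<bar> \<le> 1" unfolding abs_mult by (intro mult_le_one; simp)+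
    show ?thesis
      using near[OF lims(2) \<eta>] near[OF lims(3) \<eta>] near[OF d(1) \<eta>] near[OF d(2) \<eta>]
        near[OF lims(4) zero_less_one] near[OF lims(9) zero_less_one] near[OF lims(10) zero_less_one]
        near[OF lims(5) zero_less_one] near[OF lims(6), of "T0 / 2", OF half_gt_zero[OF T0]]
    proof eventually_elim
      case (elim n)
      show ?case
      proof
        fix w :: "(real \<times> real) \<times> (real \<times> real)"
        obtain y z p q where w: "w = ((y, z), (p, q))" by (metis surj_pair)
        show "u n w \<le> W w"
        proof (cases "E n y z p q")
          case True
          have b: "T0 / 2 \<le> T n" "\<bar>c n\<bar> \<le> 2" "\<bar>\<gamma> n\<bar> \<le> 2" "\<bar>\<delta> n\<bar> \<le> 2" "\<bar>\<epsilon> n\<bar> \<le> 2"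
            using elim 1 2 by (simp_all only: diff_0_right abs_le_iff) linarith+
          have "\<bar>p\<bar> + \<bar>q\<bar> \<le> (4 + 24 / T0) * (\<bar>y\<bar> + \<bar>z\<bar>)"
            by (rule sign_change_box_bound[OF T0 b(1,2) \<eta>_def _ _ _ _ b(3-5), where \<alpha>="\<alpha> n" and \<beta>="\<beta> n"
                  and c'="c' n" and T'="T' n"])
               (use elim True in \<open>simp_all add: E_def\<close>)
          then have "\<bar>p\<bar> \<le> K * (\<bar>y\<bar> + \<bar>z\<bar>)" "\<bar>q\<bar> \<le> K * (\<bar>y\<bar> + \<bar>z\<bar>)" unfolding K_def by linarith+
          moreover have "\<phi> (\<tau> n * p) * \<phi> (\<tau> n * q) \<le> 1 / sqrt (2 * pi) * (1 / sqrt (2 * pi))"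
            by (intro mult_mono std_normal_density_le) auto
          then have "\<phi> y * \<phi> z * (\<phi> (\<tau> n * p) * \<phi> (\<tau> n * q)) \<le> \<phi> y * \<phi> z * (1 / (2 * pi))"
            by (intro mult_left_mono) auto
          ultimately show ?thesis
            using True by (simp add: w u_def W_def ennreal_leI)
        qed (simp add: w u_def)
      qed
    qed
  qed
  \<comment> \<open>Domination holds only from \<open>n0\<close> on, so the convergence theorem is
    applied to the shifted sequence.\<close>
  then obtain n0 where n0: "\<And>n w. n0 \<le> n \<Longrightarrow> u n w \<le> W w"
    unfolding eventually_sequentially by blast
  have "(\<lambda>n. \<integral>\<^sup>+w. u (n + n0) w \<partial>?N) \<longlonglongrightarrow> (\<integral>\<^sup>+w. v w \<partial>?N)"
  proof (rule nn_integral_dominated_convergence[where w=W])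
    show "AE w in ?N. (\<lambda>n. u (n + n0) w) \<longlonglongrightarrow> v w"
      using AE_lim by eventually_elim (rule LIMSEQ_ignore_initial_segment)
  qed (use n0 W_fin in auto)
  then have "(\<lambda>n. \<integral>\<^sup>+w. u n w \<partial>?N) \<longlonglongrightarrow> (\<integral>\<^sup>+w. v w \<partial>?N)"
    by (rule LIMSEQ_offset)
  then show ?thesis
    unfolding v_int by (subst (asm) iterated) (auto simp: u_def)
qed

section \<open>The Takenaka-Malmquist basis\<close>

text \<open>In the coordinate x = tanh u, the Blaschke factor with zero tanh (p i) is tanh (u - p
  i). The normalised Szego kernel at tanh (p k) is cosh u / cosh (u - p k), and the common factor
  cosh u is divided out here.\<close>

definition takenaka :: "(nat \<Rightarrow> real) \<Rightarrow> nat \<Rightarrow> real \<Rightarrow> real" where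
  "takenaka p k u = (\<Prod>i<k. tanh (u - p i)) / cosh (u - p k)"

text \<open>One step of Gram-Schmidt on the kernel 1 / cosh (x - y): removing the direction
  belonging to the point \<open>z\<close> leaves the same kernel multiplied by two Blaschke factors.
  It is the addition formula for cosh.\<close>

lemma inverse_cosh_diff:
  fixes x y z :: real
  shows "1 / cosh (x - y) = 1 / (cosh (x - z) * cosh (y - z)) + tanh (x - z) * tanh (y - z) / cosh (x - y)"
proof -
  have "cosh (x - y) = cosh ((x - z) - (y - z))" by simp
  also have "\<dots> = cosh (x - z) * cosh (y - z) - sinh (x - z) * sinh (y - z)"
    by (rule cosh_diff)
  finally have "cosh (x - y) = cosh (x - z) * cosh (y - z) - sinh (x - z) * sinh (y - z)" .
  then show ?thesis
    using cosh_real_pos[of "x - z"] cosh_real_pos[of "y - z"] cosh_real_pos[of "x - y"]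
    unfolding tanh_def by (simp add: field_simps)
qed

text \<open>By the preceding identity each summand is the kernel times the drop of the Blaschke
  product, so the sum telescopes. If \<open>u\<close> or \<open>v\<close> is one of the first
  \<open>n\<close> points, the product vanishes and the kernel is reproduced exactly.\<close>

lemma sum_takenaka:
  "(\<Sum>k<n. takenaka p k u * takenaka p k v) =
     (1 - (\<Prod>i<n. tanh (u - p i) * tanh (v - p i))) / cosh (u - v)"
proof (induction n)
  case (Suc n)
  let ?P = "\<Prod>i<n. tanh (u - p i) * tanh (v - p i)"
  have "(\<Sum>k<Suc n. takenaka p k u * takenaka p k v) =
      (1 - ?P) / cosh (u - v) + ?P * (1 / (cosh (u - p n) * cosh (v - p n)))"
    unfolding sum.lessThan_Suc Suc by (simp add: takenaka_def prod.distrib)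
  also have "1 / (cosh (u - p n) * cosh (v - p n)) = 1 / cosh (u - v) - tanh (u - p n) * tanh (v - p n) / cosh (u - v)"
    using inverse_cosh_diff[of u v "p n"] by simp
  finally show ?case by (simp add: field_simps)
qed simp

text \<open>The left side is the covariance of the series at tanh u and tanh v; removing the factors
  cosh u and cosh v leaves a function of u - v, which is the stationarity.\<close>

lemma cosh_diff_tanh:
  fixes u v :: real
  shows "1 / (1 - tanh u * tanh v) = cosh u * cosh v / cosh (u - v)"
  using cosh_real_pos[of u] cosh_real_pos[of v] cosh_real_pos[of "u - v"]
  unfolding tanh_def by (simp add: cosh_diff field_simps)

lemma abs_tanh_less_1: "\<bar>tanh (u::real)\<bar> < 1"
  using tanh_real_lt_1[of u] tanh_real_gt_neg1[of u] by linarith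

section \<open>Triangular Gaussian form of the values at finitely many points\<close>

context gaussian_coefficients
begin

lemma random_series_eq_gsum: "random_series a \<omega> z = gsum (\<lambda>k. z ^ k) \<omega>"
  unfolding random_series_def gsum_def ..

lemma random_series_measurable[measurable]: "(\<lambda>\<omega>. random_series a \<omega> z) \<in> borel_measurable M"
  unfolding random_series_eq_gsum by measurable

text \<open>Both families have the same Gram matrix, because the finite basis reproduces the kernel
  at its own points. The combination is triangular: the value at \<open>p j\<close> involves only
  \<open>a 0\<close> up to \<open>a j\<close>, since later basis functions contain the factor tanh
  (p j - p j) = 0.\<close>

lemma distr_random_series_tanh:
  fixes p :: "nat \<Rightarrow> real"
  shows "distr M (\<Pi>\<^sub>M j\<in>{..<n}. borel) (\<lambda>\<omega>. \<lambda>j\<in>{..<n}. random_series a \<omega> (tanh (p j))) =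
     distr M (\<Pi>\<^sub>M j\<in>{..<n}. borel) (\<lambda>\<omega>. \<lambda>j\<in>{..<n}. cosh (p j) * (\<Sum>k<n. a k \<omega> * takenaka p k (p j)))"
proof -
  define w where "w j k = (if k < n then cosh (p j) * takenaka p k (p j) else 0)" for j k
  have gw: "gsum (w j) \<omega> = cosh (p j) * (\<Sum>k<n. a k \<omega> * takenaka p k (p j))" for j \<omega>
  proof -
    have "gsum (w j) \<omega> = (\<Sum>k<n. a k \<omega> * w j k)"
      unfolding gsum_def by (rule suminf_finite) (auto simp: w_def)
    then show ?thesis by (simp add: w_def sum_distrib_left mult_ac)
  qed
  have "distr M (\<Pi>\<^sub>M j\<in>{..<n}. borel) (\<lambda>\<omega>. \<lambda>j\<in>{..<n}. gsum (\<lambda>k. tanh (p j) ^ k) \<omega>) =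
     distr M (\<Pi>\<^sub>M j\<in>{..<n}. borel) (\<lambda>\<omega>. \<lambda>j\<in>{..<n}. gsum (w j) \<omega>)"
  proof (rule distr_gsum_eq_of_gram_eq)
    fix i j assume ij: "i \<in> {..<n}" "j \<in> {..<n}"
    have "\<bar>tanh (p i) * tanh (p j)\<bar> < 1"
      unfolding abs_mult using abs_tanh_less_1[of "p i"] abs_tanh_less_1[of "p j"]
      by (intro order_le_less_trans[OF mult_left_le]) auto
    then have "(\<Sum>k. tanh (p i) ^ k * tanh (p j) ^ k) = 1 / (1 - tanh (p i) * tanh (p j))"
      unfolding power_mult_distrib[symmetric] by (intro suminf_geometric) simp
    also have "\<dots> = cosh (p i) * cosh (p j) * (1 / cosh (p i - p j))"
      unfolding cosh_diff_tanh by simp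
    also have "1 / cosh (p i - p j) = (\<Sum>k<n. takenaka p k (p i) * takenaka p k (p j))"
    proof -
      have "(\<Prod>l<n. tanh (p i - p l) * tanh (p j - p l)) = 0"
        using ij by (intro prod_zero bexI[of _ i]) auto
      then show ?thesis unfolding sum_takenaka by simp
    qed
    also have "cosh (p i) * cosh (p j) * \<dots> = (\<Sum>k<n. w i k * w j k)"
      by (simp add: w_def sum_distrib_left mult_ac)
    also have "\<dots> = (\<Sum>k. w i k * w j k)"
      by (rule suminf_finite[symmetric]) (auto simp: w_def)
    finally show "(\<Sum>k. tanh (p i) ^ k * tanh (p j) ^ k) = (\<Sum>k. w i k * w j k)" .
  next
    show "geometric_decay (\<lambda>k. tanh (p j) ^ k)" for j
      by (rule geometric_decay_power[OF abs_tanh_less_1])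
    show "geometric_decay (w j)" for j
      by (rule geometric_decay_finite[of n]) (simp add: w_def)
  qed simp
  then show ?thesis
    unfolding gw random_series_eq_gsum .
qed

lemma emeasure_random_series_tanh:
  fixes p :: "nat \<Rightarrow> real"
  assumes [measurable]: "Measurable.pred (\<Pi>\<^sub>M j\<in>{..<n}. borel) Q"
  shows "emeasure M {\<omega> \<in> space M. Q (\<lambda>j\<in>{..<n}. random_series a \<omega> (tanh (p j)))} =
         emeasure M {\<omega> \<in> space M. Q (\<lambda>j\<in>{..<n}. cosh (p j) * (\<Sum>k<n. a k \<omega> * takenaka p k (p j)))}"
proof -
  let ?S = "{x \<in> space (\<Pi>\<^sub>M j\<in>{..<n}. borel). Q x}"
  have eq: "emeasure (distr M (\<Pi>\<^sub>M j\<in>{..<n}. borel) (\<lambda>\<omega>. \<lambda>j\<in>{..<n}. Z j \<omega>)) ?S =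
      emeasure M {\<omega> \<in> space M. Q (\<lambda>j\<in>{..<n}. Z j \<omega>)}"
    if [measurable]: "\<And>j. Z j \<in> borel_measurable M" for Z
    by (subst emeasure_distr) (auto intro!: arg_cong[where f="emeasure M"] simp: space_PiM)
  show ?thesis
    using distr_random_series_tanh[of n p] eq[of "\<lambda>j \<omega>. random_series a \<omega> (tanh (p j))"]
      eq[of "\<lambda>j \<omega>. cosh (p j) * (\<Sum>k<n. a k \<omega> * takenaka p k (p j))"] by simp
qed

lemma distributed_a_pair:
  assumes "i \<noteq> j"
  shows "distributed M (lborel \<Otimes>\<^sub>M lborel) (\<lambda>\<omega>. (a i \<omega>, a j \<omega>))
     (\<lambda>(x, y). ennreal (\<phi> x) * ennreal (\<phi> y))"
proof (rule distributed_joint_indep[OF sigma_finite_lborel sigma_finite_lborel std_normal std_normal])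
  have "indep_var borel ((\<lambda>x. x i) \<circ> (\<lambda>\<omega>. restrict (\<lambda>k. a k \<omega>) {i}))
      borel ((\<lambda>x. x j) \<circ> (\<lambda>\<omega>. restrict (\<lambda>k. a k \<omega>) {j}))"
    by (rule indep_var_compose[OF indep_var_restrict[OF indep]]) (use assms in auto)
  then have "indep_var borel (a i) borel (a j)" by (simp add: comp_def)
  then show "indep_var lborel (a i) lborel (a j)"
    using indep_var_compose[of borel "a i" borel "a j" "\<lambda>x. x" lborel "\<lambda>x. x" lborel] by (simp add: comp_def)
qed

lemma emeasure_a_pair:
  assumes "i \<noteq> j" and [measurable]: "Measurable.pred (borel \<Otimes>\<^sub>M borel) (\<lambda>(x, y). Q x y)"
  shows "emeasure M {\<omega> \<in> space M. Q (a i \<omega>) (a j \<omega>)} =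
     (\<integral>\<^sup>+x. \<integral>\<^sup>+y. (if Q x y then ennreal (\<phi> x * \<phi> y) else 0) \<partial>lborel \<partial>lborel)"
proof -
  let ?A = "{w \<in> space (lborel \<Otimes>\<^sub>M lborel). (\<lambda>(x, y). Q x y) w}"
  have [measurable]: "?A \<in> sets (lborel \<Otimes>\<^sub>M lborel)" by measurable
  have "emeasure M {\<omega> \<in> space M. Q (a i \<omega>) (a j \<omega>)} = emeasure M ((\<lambda>\<omega>. (a i \<omega>, a j \<omega>)) -` ?A \<inter> space M)"
    by (rule arg_cong[where f="emeasure M"]) (auto simp: space_pair_measure)
  also have "\<dots> = (\<integral>\<^sup>+w. (case w of (x, y) \<Rightarrow> ennreal (\<phi> x) * ennreal (\<phi> y)) * indicator ?A w \<partial>(lborel \<Otimes>\<^sub>M lborel))"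
    by (rule distributed_emeasure[OF distributed_a_pair[OF \<open>i \<noteq> j\<close>]]) measurable
  also have "\<dots> = (\<integral>\<^sup>+x. \<integral>\<^sup>+y. (case (x, y) of (x, y) \<Rightarrow> ennreal (\<phi> x) * ennreal (\<phi> y)) * indicator ?A (x, y) \<partial>lborel \<partial>lborel)"
    by (rule lborel.nn_integral_fst[symmetric]) measurable
  also have "\<dots> = (\<integral>\<^sup>+x. \<integral>\<^sup>+y. (if Q x y then ennreal (\<phi> x * \<phi> y) else 0) \<partial>lborel \<partial>lborel)"
    by (intro nn_integral_cong) (auto simp: ennreal_mult' indicator_def space_pair_measure)
  finally show ?thesis .
qed

text \<open>The coordinates \<open>a 0\<close> and \<open>a 1\<close> of the base values are
  innermost, since they are the ones rescaled at fixed \<open>a 2\<close> and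
  \<open>a 3\<close>.\<close>

lemma emeasure_a_quadruple:
  assumes [measurable]: "Measurable.pred ((borel \<Otimes>\<^sub>M borel) \<Otimes>\<^sub>M (borel \<Otimes>\<^sub>M borel)) (\<lambda>((y, z), (p, q)). Q y z p q)"
  shows "emeasure M {\<omega> \<in> space M. Q (a 2 \<omega>) (a 3 \<omega>) (a 0 \<omega>) (a 1 \<omega>)} =
     (\<integral>\<^sup>+y. \<integral>\<^sup>+z. \<integral>\<^sup>+p. \<integral>\<^sup>+q. (if Q y z p q then ennreal (\<phi> y * \<phi> z *
        (\<phi> p * \<phi> q)) else 0) \<partial>lborel \<partial>lborel \<partial>lborel \<partial>lborel)"
proof -
  let ?L = "lborel \<Otimes>\<^sub>M lborel :: (real \<times> real) measure"
  let ?d = "\<lambda>(x, y). ennreal (\<phi> x) * ennreal (\<phi> y)"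
  have sf: "sigma_finite_measure ?L" by (simp add: lborel_prod sigma_finite_lborel)
  have dist: "distributed M (?L \<Otimes>\<^sub>M ?L) (\<lambda>\<omega>. ((a 2 \<omega>, a 3 \<omega>), (a 0 \<omega>, a 1 \<omega>))) (\<lambda>(v, w). ?d v * ?d w)"
  proof (rule distributed_joint_indep[OF sf sf])
    have "indep_var ?L ((\<lambda>x. (x 2, x 3)) \<circ> (\<lambda>\<omega>. restrict (\<lambda>k. a k \<omega>) {2, 3}))
        ?L ((\<lambda>x. (x 0, x 1)) \<circ> (\<lambda>\<omega>. restrict (\<lambda>k. a k \<omega>) {0, 1}))"
      by (rule indep_var_compose[OF indep_var_restrict[OF indep]]) auto
    then show "indep_var ?L (\<lambda>\<omega>. (a 2 \<omega>, a 3 \<omega>)) ?L (\<lambda>\<omega>. (a 0 \<omega>, a 1 \<omega>))"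
      by (simp add: comp_def)
  qed (rule distributed_a_pair; simp)+
  let ?A = "{w \<in> space (?L \<Otimes>\<^sub>M ?L). (\<lambda>((y, z), (p, q)). Q y z p q) w}"
  have [measurable]: "?A \<in> sets (?L \<Otimes>\<^sub>M ?L)" by measurable
  have "emeasure M {\<omega> \<in> space M. Q (a 2 \<omega>) (a 3 \<omega>) (a 0 \<omega>) (a 1 \<omega>)} =
      emeasure M ((\<lambda>\<omega>. ((a 2 \<omega>, a 3 \<omega>), (a 0 \<omega>, a 1 \<omega>))) -` ?A \<inter> space M)"
    by (rule arg_cong[where f="emeasure M"]) (auto simp: space_pair_measure)
  also have "\<dots> = (\<integral>\<^sup>+w. (case w of (v, w) \<Rightarrow> ?d v * ?d w) * indicator ?A w \<partial>(?L \<Otimes>\<^sub>M ?L))"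
    by (rule distributed_emeasure[OF dist]) measurable
  also have "\<dots> = (\<integral>\<^sup>+y. \<integral>\<^sup>+z. \<integral>\<^sup>+p. \<integral>\<^sup>+q. (case ((y, z), (p, q)) of (v, w) \<Rightarrow> ?d v * ?d w) * indicator ?A ((y, z), (p, q)) \<partial>lborel \<partial>lborel \<partial>lborel \<partial>lborel)"
    by (rule nn_integral_lborel_quadruple) measurable
  also have "\<dots> = (\<integral>\<^sup>+y. \<integral>\<^sup>+z. \<integral>\<^sup>+p. \<integral>\<^sup>+q. (if Q y z p q then ennreal (\<phi> y * \<phi> z * (\<phi> p * \<phi> q)) else 0) \<partial>lborel \<partial>lborel \<partial>lborel \<partial>lborel)"
    by (intro nn_integral_cong) (auto simp: ennreal_mult' indicator_def space_pair_measure)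
  finally show ?thesis .
qed

end

lemma sign_mult_cosh:
  fixes u v A B :: real
  shows "(cosh u * A) * (cosh v * B) < 0 \<longleftrightarrow> A * B < 0"
proof -
  have "(cosh u * A) * (cosh v * B) = (cosh u * cosh v) * (A * B)" by (simp add: mult_ac)
  moreover have "0 < cosh u * cosh v" by simp
  ultimately show ?thesis by (metis mult_less_cancel_left_pos mult_zero_right)
qed

lemma nn_integral_scale_pair:
  fixes \<tau> :: real and F :: "real \<Rightarrow> real \<Rightarrow> ennreal"
  assumes "0 < \<tau>" and [measurable]: "(\<lambda>(x, y). F x y) \<in> borel_measurable (borel \<Otimes>\<^sub>M borel)"
  shows "(\<integral>\<^sup>+x. \<integral>\<^sup>+y. F x y \<partial>lborel \<partial>lborel) = ennreal (\<tau>\<^sup>2) * (\<integral>\<^sup>+x. \<integral>\<^sup>+y. F (\<tau> * x) (\<tau> * y) \<partial>lborel \<partial>lborel)"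
proof -
  have "(\<integral>\<^sup>+x. \<integral>\<^sup>+y. F x y \<partial>lborel \<partial>lborel) = ennreal \<bar>\<tau>\<bar> * (\<integral>\<^sup>+x. \<integral>\<^sup>+y. F (0 + \<tau> * x) y \<partial>lborel \<partial>lborel)"
    using assms(1) by (intro nn_integral_real_affine) auto
  also have "\<dots> = ennreal \<bar>\<tau>\<bar> * (\<integral>\<^sup>+x. ennreal \<bar>\<tau>\<bar> * (\<integral>\<^sup>+y. F (0 + \<tau> * x) (0 + \<tau> * y) \<partial>lborel) \<partial>lborel)"
    using assms(1) by (intro arg_cong2[where f="(*)"] refl nn_integral_cong nn_integral_real_affine) auto
  also have "\<dots> = ennreal \<bar>\<tau>\<bar> * (ennreal \<bar>\<tau>\<bar> * (\<integral>\<^sup>+x. \<integral>\<^sup>+y. F (\<tau> * x) (\<tau> * y) \<partial>lborel \<partial>lborel))"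
    by (simp add: nn_integral_cmult)
  also have "\<dots> = ennreal (\<tau>\<^sup>2) * (\<integral>\<^sup>+x. \<integral>\<^sup>+y. F (\<tau> * x) (\<tau> * y) \<partial>lborel \<partial>lborel)"
    using assms(1) by (simp add: power2_eq_square ennreal_mult' mult.assoc)
  finally show ?thesis .
qed

section \<open>Sign-change probabilities and their asymptotics for small steps\<close>

context gaussian_coefficients
begin

text \<open>Two standard Gaussians with correlation cos \<theta> have opposite signs with
  probability \<theta>/pi; here the correlation is 1 / cosh k, so tan \<theta> = sinh k. Concretely,
  the Cauchy-distributed ratio of \<open>a 0\<close> to \<open>a 1\<close> has to fall between -
  sinh k and 0.\<close>

lemma emeasure_sign_change:
  assumes k: "0 < k"
  shows "emeasure M {\<omega> \<in> space M. random_series a \<omega> (tanh x) * random_series a \<omega> (tanh (x + k)) < 0} =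
    ennreal (arctan (sinh k) / pi)"
proof -
  define P where "P j = (if j = 0 then x else x + k)" for j :: nat
  let ?Q = "\<lambda>y z. z * (1 / cosh k * z + tanh k * y) < 0"
  have "emeasure M {\<omega> \<in> space M. random_series a \<omega> (tanh x) * random_series a \<omega> (tanh (x + k)) < 0} =
     emeasure M {\<omega> \<in> space M. (\<lambda>f. f 0 * f 1 < 0) (\<lambda>j\<in>{..<2::nat}. random_series a \<omega> (tanh (P j)))}"
    by (simp add: P_def)
  also have "\<dots> = emeasure M {\<omega> \<in> space M. (\<lambda>f. f 0 * f 1 < 0) (\<lambda>j\<in>{..<2::nat}. cosh (P j) * (\<Sum>k<2. a k \<omega> * takenaka P k (P j)))}"
    by (rule emeasure_random_series_tanh) measurable
  also have "\<dots> = emeasure M {\<omega> \<in> space M. ?Q (a 1 \<omega>) (a 0 \<omega>)}"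
  proof -
    have "(\<Sum>k<2. a k \<omega> * takenaka P k (P 0)) = a 0 \<omega>"
      "(\<Sum>k<2. a k \<omega> * takenaka P k (P 1)) = 1 / cosh k * a 0 \<omega> + tanh k * a 1 \<omega>" for \<omega>
      by (simp_all add: P_def takenaka_def numeral_2_eq_2)
    then show ?thesis by (simp add: sign_mult_cosh del: One_nat_def)
  qed
  also have "\<dots> = (\<integral>\<^sup>+y. \<integral>\<^sup>+z. (if ?Q y z then ennreal (\<phi> y * \<phi> z) else 0) \<partial>lborel \<partial>lborel)"
    by (rule emeasure_a_pair) auto
  also have "\<dots> = (\<integral>\<^sup>+y. \<integral>\<^sup>+z. ennreal (\<phi> y * \<phi> z * (\<bar>y\<bar> ^ (2 * 0) * indicator {m. m * (m + sinh k) < 0} (z / y))) \<partial>lborel \<partial>lborel)"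
  proof (intro nn_integral_cong_AE eventually_mono[OF AE_lborel_singleton[of 0]] AE_I2 nn_integral_cong)
    fix y z :: real assume y: "y \<noteq> 0"
    have "z * (1 / cosh k * z + tanh k * y) = (y\<^sup>2 / cosh k) * (z / y * (z / y + sinh k))"
      using y by (simp add: tanh_def field_simps power2_eq_square)
    moreover have "0 < y\<^sup>2 / cosh k" using y by simp
    ultimately have "?Q y z \<longleftrightarrow> z / y * (z / y + sinh k) < 0"
      by (metis mult_less_cancel_left_pos mult_zero_right)
    then show "(if ?Q y z then ennreal (\<phi> y * \<phi> z) else 0) =
        ennreal (\<phi> y * \<phi> z * (\<bar>y\<bar> ^ (2 * 0) * indicator {m. m * (m + sinh k) < 0} (z / y)))"
      by (simp add: indicator_def)
  qed
  also have "\<dots> = (\<integral>\<^sup>+m. ennreal (indicator {m. m * (m + sinh k) < 0} m * (2 ^ 0 * fact 0 / (pi * (1 + m\<^sup>2) ^ (0 + 1)))) \<partial>lborel)"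
    by (rule nn_integral_Gaussian_slope) auto
  also have "\<dots> = (\<integral>\<^sup>+m. ennreal (inverse (1 + m\<^sup>2) / pi) * indicator {- sinh k..0} m \<partial>lborel)"
  proof (rule nn_integral_cong_AE)
    have "AE m in lborel. m \<noteq> 0 \<and> m \<noteq> - sinh k" by (intro AE_conjI AE_lborel_singleton)
    then show "AE m in lborel. ennreal (indicator {m. m * (m + sinh k) < 0} m * (2 ^ 0 * fact 0 / (pi * (1 + m\<^sup>2) ^ (0 + 1)))) =
        ennreal (inverse (1 + m\<^sup>2) / pi) * indicator {- sinh k..0} m"
    proof eventually_elim
      case (elim m)
      have "0 < sinh k" using k by simp
      then have "m * (m + sinh k) < 0 \<longleftrightarrow> - sinh k \<le> m \<and> m \<le> 0"
        unfolding mult_less_0_iff using elim by linarith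
      then show ?case by (simp add: indicator_def inverse_eq_divide mult.commute)
    qed
  qed
  also have "\<dots> = ennreal (arctan 0 / pi - arctan (- sinh k) / pi)"
    using k by (intro nn_integral_FTC_Icc) (auto intro!: DERIV_cdivide DERIV_arctan add_nonneg_nonneg)
  finally show ?thesis by (simp add: arctan_minus)
qed

text \<open>Both sign conditions are invariant under a common positive scaling of all the values
  involved. Substituting tanh k times \<open>p\<close> and \<open>q\<close> therefore cancels
  \<open>tanh k\<close> in front of \<open>y\<close> and \<open>z\<close> and leaves only the
  Jacobian; the remaining integral has a nondegenerate limit.\<close>

lemma emeasure_two_sign_changes:
  fixes x d k :: real
  assumes k: "0 < k"
  shows "emeasure M {\<omega> \<in> space M. random_series a \<omega> (tanh x) * random_series a \<omega> (tanh (x + k)) < 0 \<and>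
      random_series a \<omega> (tanh (x + d)) * random_series a \<omega> (tanh (x + d + k)) < 0} =
    ennreal ((tanh k)\<^sup>2) * (\<integral>\<^sup>+y. \<integral>\<^sup>+z. \<integral>\<^sup>+p. \<integral>\<^sup>+q.
       (if p * (1 / cosh k * p + tanh k / cosh (k - d) * q + tanh (k - d) * y) < 0 \<and>
           (1 / cosh d * p + tanh d * q) * (1 / cosh (d + k) * p + tanh (d + k) / cosh k * q
              + tanh (d + k) / cosh d * y + tanh (d + k) * tanh d * z) < 0
        then ennreal (\<phi> y * \<phi> z *
          (\<phi> (tanh k * p) * \<phi> (tanh k * q))) else 0)
        \<partial>lborel \<partial>lborel \<partial>lborel \<partial>lborel)" (is "_ = _ * ?I")
proof -
  \<comment> \<open>Base points come before shifted ones: the basis functions for \<open>a 2\<close>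
    and \<open>a 3\<close> then carry the Blaschke factor of a base point at distance
    \<open>k\<close> from the evaluation point, that is \<open>tanh k\<close>.\<close>
  define P where "P j = (if j = 0 then x else if j = 1 then x + d else if j = 2 then x + k else x + d + k)" for j :: nat
  define Q where "Q y z p q \<longleftrightarrow> p * (1 / cosh k * p + tanh k / cosh (k - d) * q + tanh k * tanh (k - d) * y) < 0 \<and>
      (1 / cosh d * p + tanh d * q) * (1 / cosh (d + k) * p + tanh (d + k) / cosh k * q
              + tanh k * (tanh (d + k) / cosh d) * y + tanh k * (tanh (d + k) * tanh d) * z) < 0" for y z p q
  have [measurable]: "Measurable.pred ((borel \<Otimes>\<^sub>M borel) \<Otimes>\<^sub>M (borel \<Otimes>\<^sub>M borel)) (\<lambda>((y, z), (p, q)). Q y z p q)"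
    unfolding Q_def split_beta' by measurable
  have \<tau>: "0 < tanh k" using k by simp
  have "emeasure M {\<omega> \<in> space M. random_series a \<omega> (tanh x) * random_series a \<omega> (tanh (x + k)) < 0 \<and>
      random_series a \<omega> (tanh (x + d)) * random_series a \<omega> (tanh (x + d + k)) < 0} =
     emeasure M {\<omega> \<in> space M. (\<lambda>f. f 0 * f 2 < 0 \<and> f 1 * f 3 < 0) (\<lambda>j\<in>{..<4::nat}. random_series a \<omega> (tanh (P j)))}"
    by (simp add: P_def)
  also have "\<dots> = emeasure M {\<omega> \<in> space M. (\<lambda>f. f 0 * f 2 < 0 \<and> f 1 * f 3 < 0) (\<lambda>j\<in>{..<4::nat}. cosh (P j) * (\<Sum>k<4. a k \<omega> * takenaka P k (P j)))}"
    by (rule emeasure_random_series_tanh) measurable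
  also have "\<dots> = emeasure M {\<omega> \<in> space M. Q (a 2 \<omega>) (a 3 \<omega>) (a 0 \<omega>) (a 1 \<omega>)}"
  proof -
    have "(\<Sum>k<4. a k \<omega> * takenaka P k (P 0)) = a 0 \<omega>"
      "(\<Sum>k<4. a k \<omega> * takenaka P k (P 1)) = 1 / cosh d * a 0 \<omega> + tanh d * a 1 \<omega>"
      "(\<Sum>k<4. a k \<omega> * takenaka P k (P 2)) = 1 / cosh k * a 0 \<omega> + tanh k / cosh (k - d) * a 1 \<omega> + tanh k * tanh (k - d) * a 2 \<omega>"
      "(\<Sum>k<4. a k \<omega> * takenaka P k (P 3)) = 1 / cosh (d + k) * a 0 \<omega> + tanh (d + k) / cosh k * a 1 \<omega>
              + tanh k * (tanh (d + k) / cosh d) * a 2 \<omega> + tanh k * (tanh (d + k) * tanh d) * a 3 \<omega>" for \<omega>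
      by (simp_all add: P_def takenaka_def eval_nat_numeral algebra_simps)
    then show ?thesis by (simp add: sign_mult_cosh Q_def del: One_nat_def)
  qed
  also have "\<dots> = (\<integral>\<^sup>+y. \<integral>\<^sup>+z. \<integral>\<^sup>+p. \<integral>\<^sup>+q. (if Q y z p q then ennreal (\<phi> y * \<phi> z * (\<phi> p * \<phi> q)) else 0)
      \<partial>lborel \<partial>lborel \<partial>lborel \<partial>lborel)"
    by (rule emeasure_a_quadruple) measurable
  also have "\<dots> = (\<integral>\<^sup>+y. \<integral>\<^sup>+z. ennreal ((tanh k)\<^sup>2) * (\<integral>\<^sup>+p. \<integral>\<^sup>+q. (if Q y z (tanh k * p) (tanh k * q) then ennreal (\<phi> y * \<phi> z * (\<phi> (tanh k * p) * \<phi> (tanh k * q))) else 0)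
      \<partial>lborel \<partial>lborel) \<partial>lborel \<partial>lborel)"
    by (intro nn_integral_cong nn_integral_scale_pair \<tau>) (simp add: Q_def)
  also have "\<dots> = ennreal ((tanh k)\<^sup>2) * (\<integral>\<^sup>+y. \<integral>\<^sup>+z. \<integral>\<^sup>+p. \<integral>\<^sup>+q. (if Q y z (tanh k * p) (tanh k * q) then ennreal (\<phi> y * \<phi> z * (\<phi> (tanh k * p) * \<phi> (tanh k * q))) else 0)
      \<partial>lborel \<partial>lborel \<partial>lborel \<partial>lborel)"
    unfolding Q_def by (simp add: nn_integral_cmult)
  also have "(\<integral>\<^sup>+y. \<integral>\<^sup>+z. \<integral>\<^sup>+p. \<integral>\<^sup>+q. (if Q y z (tanh k * p) (tanh k * q) then ennreal (\<phi> y * \<phi> z * (\<phi> (tanh k * p) * \<phi> (tanh k * q))) else 0)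
      \<partial>lborel \<partial>lborel \<partial>lborel \<partial>lborel) = ?I"
  proof -
    have scale: "(\<tau> * u) * (\<tau> * v) < 0 \<longleftrightarrow> u * v < 0" if "0 < \<tau>" for \<tau> u v :: real
      using that by (simp add: mult_less_0_iff zero_less_mult_iff)
    have "Q y z (tanh k * p) (tanh k * q) \<longleftrightarrow>
      p * (1 / cosh k * p + tanh k / cosh (k - d) * q + tanh (k - d) * y) < 0 \<and>
           (1 / cosh d * p + tanh d * q) * (1 / cosh (d + k) * p + tanh (d + k) / cosh k * q
              + tanh (d + k) / cosh d * y + tanh (d + k) * tanh d * z) < 0" for y z p q
      unfolding Q_def
      by (subst (3 4) scale[OF \<tau>, symmetric]) (simp add: algebra_simps)
    then show ?thesis by simp
  qed
  finally show ?thesis .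
qed

lemma tanh_over_self_tendsto:
  fixes k :: "nat \<Rightarrow> real"
  assumes "k \<longlonglongrightarrow> 0" "\<And>n. 0 < k n"
  shows "(\<lambda>n. tanh (k n) / k n) \<longlonglongrightarrow> 1"
proof -
  have "((\<lambda>h. tanh h / h) \<longlongrightarrow> (1 :: real)) (at_right 0)" by real_asymp
  moreover have "filterlim k (at_right 0) sequentially"
    using assms by (intro tendsto_imp_filterlim_at_right) auto
  ultimately show ?thesis by (rule filterlim_compose)
qed

text \<open>By stationarity the probability depends on the step alone, so the base points may vary
  freely with n; the limit is that of arctan (sinh h) / h, divided by pi.\<close>

lemma sign_change_density:
  assumes k: "k \<longlonglongrightarrow> 0" "\<And>n. 0 < k n"
  shows "(\<lambda>n. measure M {\<omega> \<in> space M. random_series a \<omega> (tanh (x n)) * random_series a \<omega> (tanh (x n + k n)) < 0} / k n)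
      \<longlonglongrightarrow> 1 / pi"
proof -
  have "((\<lambda>h. arctan (sinh h) / h) \<longlongrightarrow> 1) (at_right (0::real))" by real_asymp
  moreover have "filterlim k (at_right 0) sequentially"
    using k by (intro tendsto_imp_filterlim_at_right) auto
  ultimately have "(\<lambda>n. arctan (sinh (k n)) / k n) \<longlonglongrightarrow> 1" by (rule filterlim_compose)
  from tendsto_divide[OF this tendsto_const[of pi]] show ?thesis
    unfolding measure_def emeasure_sign_change[OF k(2)] using k(2) by (simp add: less_imp_le mult.commute)
qed

text \<open>Base points and distance vary with n because cells of a subdivision do not keep the
  exact distance of the two target points. Stationarity leaves only the convergence of
  \<open>d\<close> to a positive limit as a condition.\<close>

lemma two_sign_changes_density:
  assumes k: "k \<longlonglongrightarrow> 0" "\<And>n. 0 < k n" and d: "d \<longlonglongrightarrow> d0" "0 < d0"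
  shows "(\<lambda>n. measure M {\<omega> \<in> space M. random_series a \<omega> (tanh (x n)) * random_series a \<omega> (tanh (x n + k n)) < 0 \<and>
      random_series a \<omega> (tanh (x n + d n)) * random_series a \<omega> (tanh (x n + d n + k n)) < 0} / (k n)\<^sup>2)
      \<longlonglongrightarrow> tanh d0 / pi\<^sup>2 * (tanh d0 + 1 / cosh d0 * arctan ((1 / cosh d0) / tanh d0))"
    (is "?P \<longlonglongrightarrow> ?L")
proof -
  define I where "I n = (\<integral>\<^sup>+y. \<integral>\<^sup>+z. \<integral>\<^sup>+p. \<integral>\<^sup>+q.
       (if p * (1 / cosh (k n) * p + tanh (k n) / cosh (k n - d n) * q + tanh (k n - d n) * y) < 0 \<and>
           (1 / cosh (d n) * p + tanh (d n) * q) * (1 / cosh (d n + k n) * p + tanh (d n + k n) / cosh (k n) * q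
              + tanh (d n + k n) / cosh (d n) * y + tanh (d n + k n) * tanh (d n) * z) < 0
        then ennreal (\<phi> y * \<phi> z *
          (\<phi> (tanh (k n) * p) * \<phi> (tanh (k n) * q))) else 0)
        \<partial>lborel \<partial>lborel \<partial>lborel \<partial>lborel)" for n
  have nz: "cosh u \<noteq> 0" for u :: real using cosh_real_pos[of u] by simp
  have l: "(\<lambda>n. tanh (k n)) \<longlonglongrightarrow> tanh 0" "(\<lambda>n. 1 / cosh (k n)) \<longlonglongrightarrow> 1 / cosh 0"
    "(\<lambda>n. tanh (k n) / cosh (k n - d n)) \<longlonglongrightarrow> tanh 0 / cosh (0 - d0)"
    "(\<lambda>n. tanh (k n - d n)) \<longlonglongrightarrow> tanh (0 - d0)"
    "(\<lambda>n. 1 / cosh (d n)) \<longlonglongrightarrow> 1 / cosh d0"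
    "(\<lambda>n. tanh (d n)) \<longlonglongrightarrow> tanh d0"
    "(\<lambda>n. 1 / cosh (d n + k n)) \<longlonglongrightarrow> 1 / cosh (d0 + 0)"
    "(\<lambda>n. tanh (d n + k n) / cosh (k n)) \<longlonglongrightarrow> tanh (d0 + 0) / cosh 0"
    "(\<lambda>n. tanh (d n + k n) / cosh (d n)) \<longlonglongrightarrow> tanh (d0 + 0) / cosh d0"
    "(\<lambda>n. tanh (d n + k n) * tanh (d n)) \<longlonglongrightarrow> tanh (d0 + 0) * tanh d0"
    by (intro tendsto_intros k d nz)+
  have T: "0 < tanh d0" using d by simp
  have "I \<longlonglongrightarrow> ennreal ?L"
    unfolding I_def
  proof (rule sign_change_probability_limit[OF T])
    have "(cosh d0)\<^sup>2 = (sinh d0)\<^sup>2 + 1" by (rule cosh_square_eq)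
    moreover have "0 < (sinh d0)\<^sup>2 + 1" by (simp add: add_nonneg_pos)
    ultimately show "(1 / cosh d0)\<^sup>2 + (tanh d0)\<^sup>2 = 1"
      using nz[of d0] by (simp add: tanh_def power_divide divide_simps)
  qed (use l in simp_all)
  then have "(\<lambda>n. enn2real (I n)) \<longlonglongrightarrow> enn2real (ennreal ?L)"
    by (intro tendsto_enn2real) auto
  then have "(\<lambda>n. (tanh (k n) / k n)\<^sup>2 * enn2real (I n)) \<longlonglongrightarrow> 1\<^sup>2 * enn2real (ennreal ?L)"
    by (intro tendsto_mult tendsto_power tanh_over_self_tendsto k) simp
  moreover have "0 \<le> ?L"
    using T by (auto intro!: mult_nonneg_nonneg add_nonneg_nonneg)
  moreover have "?P n = (tanh (k n) / k n)\<^sup>2 * enn2real (I n)" for n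
    unfolding measure_def emeasure_two_sign_changes[OF k(2)] I_def[symmetric] enn2real_mult
    by (simp add: power_divide)
  ultimately show ?thesis by simp
qed

end

section \<open>Zeros are simple\<close>

text \<open>Two mean value estimates in a row. The bound K |x - z| for \<open>F'\<close> is used on
  the whole segment, which gives the constant K in place of Taylor's K/2.\<close>

lemma abs_le_of_double_zero:
  fixes F F' F'' :: "real \<Rightarrow> real"
  assumes d1: "\<And>x. \<bar>x\<bar> \<le> r \<Longrightarrow> (F has_real_derivative F' x) (at x)"
    and d2: "\<And>x. \<bar>x\<bar> \<le> r \<Longrightarrow> (F' has_real_derivative F'' x) (at x)"
    and bound: "\<And>x. \<bar>x\<bar> \<le> r \<Longrightarrow> \<bar>F'' x\<bar> \<le> K"
    and z: "\<bar>z\<bar> \<le> r" "F z = 0" "F' z = 0" and x: "\<bar>x\<bar> \<le> r"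
  shows "\<bar>F x\<bar> \<le> K * (x - z)\<^sup>2"
proof -
  have seg: "\<bar>y\<bar> \<le> r \<and> \<bar>y - z\<bar> \<le> \<bar>x - z\<bar>" if "y \<in> closed_segment z x" for y
    using that z(1) x by (auto simp: closed_segment_eq_real_ivl split: if_splits)
  have F1: "\<bar>F' y\<bar> \<le> K * \<bar>x - z\<bar>" if "y \<in> closed_segment z x" for y
  proof -
    have "norm (F' y - F' z) \<le> K * norm (y - z)"
    proof (rule field_differentiable_bound[where S="closed_segment z x" and f'=F''])
      show "(F' has_real_derivative F'' w) (at w within closed_segment z x)" if "w \<in> closed_segment z x" for w
        by (rule has_field_derivative_at_within[OF d2]) (use seg[OF that] in simp)
      show "norm (F'' w) \<le> K" if "w \<in> closed_segment z x" for w
        using bound seg[OF that] by simp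
    qed (use that in auto)
    also have "K * norm (y - z) \<le> K * \<bar>x - z\<bar>"
      using seg[OF that] bound[OF x] by (intro mult_left_mono) auto
    finally show ?thesis using z by simp
  qed
  have "norm (F x - F z) \<le> (K * \<bar>x - z\<bar>) * norm (x - z)"
  proof (rule field_differentiable_bound[where S="closed_segment z x" and f'=F'])
    show "(F has_real_derivative F' w) (at w within closed_segment z x)" if "w \<in> closed_segment z x" for w
      by (rule has_field_derivative_at_within[OF d1]) (use seg[OF that] in simp)
    show "norm (F' w) \<le> K * \<bar>x - z\<bar>" if "w \<in> closed_segment z x" for w
      using F1[OF that] by simp
  qed auto
  then show ?thesis using z by (simp add: power2_eq_square mult.assoc flip: abs_mult)
qed

lemma power_series_derivative:
  fixes c :: "nat \<Rightarrow> real"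
  assumes c: "\<And>r. \<bar>r\<bar> < 1 \<Longrightarrow> summable (\<lambda>k. c k * r ^ k)"
  shows "\<bar>r\<bar> < 1 \<Longrightarrow> ((\<lambda>x. \<Sum>k. c k * x ^ k) has_real_derivative (\<Sum>k. diffs c k * r ^ k)) (at r)"
    and "\<bar>r\<bar> < 1 \<Longrightarrow> summable (\<lambda>k. diffs c k * r ^ k)"
proof -
  show "\<bar>r\<bar> < 1 \<Longrightarrow> summable (\<lambda>k. diffs c k * r ^ k)"
    using termdiff_converges[of r 1 c] c by simp
  assume r: "\<bar>r\<bar> < 1"
  define s where "s = (1 + \<bar>r\<bar>) / 2"
  have s: "\<bar>r\<bar> < s" "\<bar>s\<bar> < 1" using r by (auto simp: s_def)
  show "((\<lambda>x. \<Sum>k. c k * x ^ k) has_real_derivative (\<Sum>k. diffs c k * r ^ k)) (at r)"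
    by (rule termdiffs_strong[OF c[OF s(2)]]) (use s in auto)
qed

lemma tanh_artanh_real:
  fixes x :: real
  assumes "- 1 < x" "x < 1"
  shows "tanh (artanh x) = x"
proof -
  have "exp (- 2 * artanh x) = 1 / exp (ln ((1 + x) / (1 - x)))"
    unfolding artanh_def by (simp add: exp_minus inverse_eq_divide)
  also have "\<dots> = (1 - x) / (1 + x)"
    using assms by simp
  finally have e: "exp (- 2 * artanh x) = (1 - x) / (1 + x)" .
  show ?thesis
    using assms unfolding tanh_real_altdef e by (simp add: field_simps)
qed

section \<open>Almost sure absence of double zeros\<close>

context gaussian_coefficients
begin

text \<open>With a single point the triangular form is cosh (artanh x) times \<open>a 0\<close>, of
  standard deviation at least 1. The normal density is at most 1 / sqrt (2 pi), and 2 / sqrt (2 pi)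
  \<le> 1.\<close>

lemma emeasure_random_series_small:
  assumes x: "\<bar>x\<bar> < 1" and \<eta>: "0 \<le> \<eta>"
  shows "emeasure M {\<omega> \<in> space M. \<bar>random_series a \<omega> x\<bar> \<le> \<eta>} \<le> ennreal \<eta>"
proof -
  have th: "tanh (artanh x) = x"
    using x by (intro tanh_artanh_real) auto
  have "emeasure M {\<omega> \<in> space M. \<bar>random_series a \<omega> x\<bar> \<le> \<eta>} =
      emeasure M {\<omega> \<in> space M. (\<lambda>f. \<bar>f 0\<bar> \<le> \<eta>) (\<lambda>j\<in>{..<1::nat}. random_series a \<omega> (tanh (artanh x)))}"
    by (simp add: th)
  also have "\<dots> = emeasure M {\<omega> \<in> space M. (\<lambda>f. \<bar>f 0\<bar> \<le> \<eta>) (\<lambda>j\<in>{..<1::nat}. cosh (artanh x) * (\<Sum>k<1. a k \<omega> * takenaka (\<lambda>_. artanh x) k (artanh x)))}"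
    by (rule emeasure_random_series_tanh[where p="\<lambda>_. artanh x"]) measurable
  also have "\<dots> \<le> emeasure M {\<omega> \<in> space M. \<bar>a 0 \<omega>\<bar> \<le> \<eta>}"
  proof (rule emeasure_mono)
    have "\<bar>y\<bar> \<le> \<bar>cosh (artanh x) * y\<bar>" for y
      unfolding abs_mult using cosh_real_ge_1[of "artanh x"] mult_right_mono[of 1 "cosh (artanh x)" "\<bar>y\<bar>"] by simp
    then show "{\<omega> \<in> space M. (\<lambda>f. \<bar>f 0\<bar> \<le> \<eta>) (\<lambda>j\<in>{..<1::nat}. cosh (artanh x) * (\<Sum>k<1. a k \<omega> * takenaka (\<lambda>_. artanh x) k (artanh x)))}
       \<subseteq> {\<omega> \<in> space M. \<bar>a 0 \<omega>\<bar> \<le> \<eta>}"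
      by (auto simp: takenaka_def intro: order_trans)
  qed measurable
  also have "\<dots> = emeasure M (a 0 -` {- \<eta>..\<eta>} \<inter> space M)"
    by (rule arg_cong[where f="emeasure M"]) auto
  also have "\<dots> = (\<integral>\<^sup>+y. ennreal (\<phi> y) * indicator {- \<eta>..\<eta>} y \<partial>lborel)"
    by (rule distributed_emeasure[OF std_normal]) simp
  also have "\<dots> \<le> (\<integral>\<^sup>+y. ennreal (1 / sqrt (2 * pi)) * indicator {- \<eta>..\<eta>} y \<partial>lborel)"
    by (intro nn_integral_mono mult_right_mono ennreal_leI std_normal_density_le) auto
  also have "\<dots> = ennreal (1 / sqrt (2 * pi)) * ennreal (2 * \<eta>)"
    using \<eta> by (subst nn_integral_cmult_indicator) auto
  also have "\<dots> = ennreal (1 / sqrt (2 * pi) * (2 * \<eta>))"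
    using \<eta> by (intro ennreal_mult'[symmetric]) auto
  also have "\<dots> \<le> ennreal \<eta>"
  proof (rule ennreal_leI)
    have "sqrt (2\<^sup>2) \<le> sqrt (2 * pi)" using pi_gt3 by (intro real_sqrt_le_mono) simp
    then have "2 \<le> sqrt (2 * pi)" by simp
    then have "2 * \<eta> \<le> sqrt (2 * pi) * \<eta>" using \<eta> by (rule mult_right_mono)
    then show "1 / sqrt (2 * pi) * (2 * \<eta>) \<le> \<eta>" by (simp add: divide_le_eq mult_ac)
  qed
  finally show ?thesis .
qed

lemma AE_random_series_nonzero:
  assumes x: "\<bar>x\<bar> < 1"
  shows "AE \<omega> in M. random_series a \<omega> x \<noteq> 0"
proof -
  have small: "emeasure M {\<omega> \<in> space M. \<not> random_series a \<omega> x \<noteq> 0} \<le> ennreal \<eta>" if "0 < \<eta>" for \<eta>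
    by (rule order_trans[OF emeasure_mono emeasure_random_series_small[OF x]]) (use that in auto)
  have "emeasure M {\<omega> \<in> space M. \<not> random_series a \<omega> x \<noteq> 0} \<le> 0"
    by (rule ennreal_le_epsilon) (use small in simp)
  then have "emeasure M {\<omega> \<in> space M. \<not> random_series a \<omega> x \<noteq> 0} = 0" by simp
  then show ?thesis
    by (subst AE_iff_measurable[OF _ refl]) auto
qed

text \<open>A double zero \<open>z\<close> makes the series of order \<open>1/n\<^sup>2\<close> at the nearest of \<open>n\<close> grid points, an event of
  probability at most of order \<open>1/n\<^sup>2\<close> for each of them.\<close>

lemma AE_no_bounded_double_zero:
  fixes K r :: real
  assumes r: "0 < r" "r < 1" and K: "0 \<le> K"
  shows "AE \<omega> in M. \<not> (\<exists>z. \<bar>z\<bar> \<le> r \<and>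
     (\<forall>x. \<bar>x\<bar> \<le> r \<longrightarrow> \<bar>random_series a \<omega> x\<bar> \<le> K * (x - z)\<^sup>2))"
proof -
  define x where "x n i = - r + 2 * r * real i / real n" for n i
  define U where "U n = (\<Union>i\<le>n. {\<omega> \<in> space M. \<bar>random_series a \<omega> (x n i)\<bar> \<le> 4 * K / (real n)\<^sup>2})" for n
  have [measurable]: "U n \<in> sets M" for n unfolding U_def by measurable
  have x_le: "\<bar>x n i\<bar> \<le> r" if "i \<le> n" "0 < n" for n i
  proof -
    have "real i / real n \<le> 1" "0 \<le> real i / real n" using that by auto
    then have "2 * r * (real i / real n) \<le> 2 * r" "0 \<le> 2 * r * (real i / real n)"
      using r mult_left_le[of "real i / real n" "2 * r"] by auto
    then show ?thesis unfolding x_def by simp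
  qed
  have U_le: "emeasure M (U n) \<le> ennreal ((real n + 1) * (4 * K / (real n)\<^sup>2))" if "0 < n" for n
  proof -
    have "emeasure M (U n) \<le> (\<Sum>i\<le>n. emeasure M {\<omega> \<in> space M. \<bar>random_series a \<omega> (x n i)\<bar> \<le> 4 * K / (real n)\<^sup>2})"
      unfolding U_def by (rule emeasure_subadditive_finite) auto
    also have "\<dots> \<le> (\<Sum>i\<le>n. ennreal (4 * K / (real n)\<^sup>2))"
      using x_le[OF _ that] r K by (intro sum_mono emeasure_random_series_small) (auto intro: order_le_less_trans)
    also have "\<dots> = ennreal ((real n + 1) * (4 * K / (real n)\<^sup>2))"
    proof -
      have e: "of_nat (Suc n) = ennreal (real n + 1)"
        by (simp add: ennreal_of_nat_eq_real_of_nat add.commute)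
      have "(\<Sum>i\<le>n. ennreal (4 * K / (real n)\<^sup>2)) = of_nat (Suc n) * ennreal (4 * K / (real n)\<^sup>2)"
        by simp
      then show ?thesis
        unfolding e by (simp only:) (rule ennreal_mult'[symmetric], simp)
    qed
    finally show ?thesis .
  qed
  have "(\<Inter>n. U (Suc n)) \<in> null_sets M"
  proof (rule null_setsI)
    have "(\<lambda>n. (real (Suc n) + 1) * (4 * K / (real (Suc n))\<^sup>2)) \<longlonglongrightarrow> 0" by real_asymp
    then have "(\<lambda>n. ennreal ((real (Suc n) + 1) * (4 * K / (real (Suc n))\<^sup>2))) \<longlonglongrightarrow> ennreal 0"
      by (rule tendsto_ennrealI)
    moreover have "emeasure M (\<Inter>n. U (Suc n)) \<le> ennreal ((real (Suc n) + 1) * (4 * K / (real (Suc n))\<^sup>2))" for n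
      by (rule order_trans[OF emeasure_mono U_le]) auto
    ultimately have "emeasure M (\<Inter>n. U (Suc n)) \<le> ennreal 0"
      by (intro LIMSEQ_le_const) auto
    then show "emeasure M (\<Inter>n. U (Suc n)) = 0" by simp
  qed measurable
  then show ?thesis
  proof (rule AE_I')
    show "{\<omega> \<in> space M. \<not> \<not> (\<exists>z. \<bar>z\<bar> \<le> r \<and> (\<forall>x. \<bar>x\<bar> \<le> r \<longrightarrow> \<bar>random_series a \<omega> x\<bar> \<le> K * (x - z)\<^sup>2))} \<subseteq> (\<Inter>n. U (Suc n))"
    proof (intro subsetI INT_I)
      fix \<omega> n
      assume "\<omega> \<in> {\<omega> \<in> space M. \<not> \<not> (\<exists>z. \<bar>z\<bar> \<le> r \<and> (\<forall>x. \<bar>x\<bar> \<le> r \<longrightarrow> \<bar>random_series a \<omega> x\<bar> \<le> K * (x - z)\<^sup>2))}"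
      then obtain z where \<omega>: "\<omega> \<in> space M" and z: "\<bar>z\<bar> \<le> r"
        and le: "\<forall>x. \<bar>x\<bar> \<le> r \<longrightarrow> \<bar>random_series a \<omega> x\<bar> \<le> K * (x - z)\<^sup>2"
        by blast
      define N where "N = Suc n"
      have N: "0 < N" by (simp add: N_def)
      \<comment> \<open>\<open>i\<close> indexes the grid point just left of \<open>z\<close> (or at
        \<open>z\<close>), at distance at most one mesh width 2 r / N \<le> 2 / N; this is the
        origin of the 4 in the threshold 4 K / N^2.\<close>
      define i where "i = nat \<lfloor>(z + r) * real N / (2 * r)\<rfloor>"
      have pos: "0 \<le> (z + r) * real N / (2 * r)" using z r by auto
      then have i: "real i \<le> (z + r) * real N / (2 * r)" "(z + r) * real N / (2 * r) < real i + 1"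
        unfolding i_def by linarith+
      have "(z + r) * real N / (2 * r) \<le> real N"
      proof -
        have "(z + r) * real N \<le> (2 * r) * real N" using z by (intro mult_right_mono) auto
        then show ?thesis using r by (simp add: divide_le_eq mult_ac)
      qed
      with i(1) have "i \<le> N" by linarith
      have "2 * r * real i / real N \<le> z + r" "z + r \<le> 2 * r * real i / real N + 2 * r / real N"
        using i r N by (simp_all add: field_simps)
      then have "\<bar>x N i - z\<bar> \<le> 2 * r / real N" unfolding x_def by simp
      also have "\<dots> \<le> 2 / real N" using r N by (intro divide_right_mono) auto
      finally have "(x N i - z)\<^sup>2 \<le> (2 / real N)\<^sup>2"
        by (metis abs_ge_zero power2_abs power_mono)
      then have "K * (x N i - z)\<^sup>2 \<le> K * (2 / real N)\<^sup>2"
        using K by (rule mult_left_mono)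
      then have "K * (x N i - z)\<^sup>2 \<le> 4 * K / (real N)\<^sup>2"
        by (simp add: power_divide mult.commute)
      then have "\<bar>random_series a \<omega> (x N i)\<bar> \<le> 4 * K / (real N)\<^sup>2"
        using le x_le[OF \<open>i \<le> N\<close> N] by (meson order_trans)
      then show "\<omega> \<in> U (Suc n)"
        unfolding U_def N_def[symmetric] using \<omega> \<open>i \<le> N\<close> by auto
    qed
  qed
qed

text \<open>A double zero lies in some [- r N, r N] with r N < 1, on which the second derivative is
  continuous and so bounded by an integer K. The resulting quadratic bound at \<open>z\<close> was
  excluded almost surely for each N and K, and these are countably many events.\<close>

lemma AE_simple_zeros:
  "AE \<omega> in M. \<forall>z. \<bar>z\<bar> < 1 \<longrightarrow> (random_series a \<omega> has_real_derivative (\<Sum>k. diffs (\<lambda>k. a k \<omega>) k * z ^ k)) (at z) \<and>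
     (random_series a \<omega> z = 0 \<longrightarrow> (\<Sum>k. diffs (\<lambda>k. a k \<omega>) k * z ^ k) \<noteq> 0)"
proof -
  \<comment> \<open>The shift by 2 keeps every radius positive, also at N = 0.\<close>
  define r where "r N = 1 - 1 / real (N + 2)" for N :: nat
  have r: "0 < r N" "r N < 1" for N unfolding r_def by auto
  have "AE \<omega> in M. \<forall>N. \<forall>K::nat. \<not> (\<exists>z. \<bar>z\<bar> \<le> r N \<and>
     (\<forall>x. \<bar>x\<bar> \<le> r N \<longrightarrow> \<bar>random_series a \<omega> x\<bar> \<le> real K * (x - z)\<^sup>2))"
    unfolding AE_all_countable by (intro allI AE_no_bounded_double_zero r) auto
  with AE_summable_geometric show ?thesis
  proof eventually_elim
    case (elim \<omega>)
    define c where "c k = a k \<omega>" for k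
    have c: "summable (\<lambda>k. c k * x ^ k)" if "\<bar>x\<bar> < 1" for x
      using elim(1)[rule_format, OF that] unfolding c_def by (rule summable_rabs_cancel)
    have c': "summable (\<lambda>k. diffs c k * x ^ k)" if "\<bar>x\<bar> < 1" for x
      by (rule power_series_derivative(2)[OF c that])
    have c'': "summable (\<lambda>k. diffs (diffs c) k * x ^ k)" if "\<bar>x\<bar> < 1" for x
      by (rule power_series_derivative(2)[OF c' that])
    have F: "random_series a \<omega> = (\<lambda>x. \<Sum>k. c k * x ^ k)"
      by (auto simp: random_series_def c_def)
    have d1: "((\<lambda>x. \<Sum>k. c k * x ^ k) has_real_derivative (\<Sum>k. diffs c k * x ^ k)) (at x)" if "\<bar>x\<bar> < 1" for x
      by (rule power_series_derivative(1)[OF c that])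
    have d2: "((\<lambda>x. \<Sum>k. diffs c k * x ^ k) has_real_derivative (\<Sum>k. diffs (diffs c) k * x ^ k)) (at x)" if "\<bar>x\<bar> < 1" for x
      by (rule power_series_derivative(1)[OF c' that])
    have d3: "((\<lambda>x. \<Sum>k. diffs (diffs c) k * x ^ k) has_real_derivative (\<Sum>k. diffs (diffs (diffs c)) k * x ^ k)) (at x)" if "\<bar>x\<bar> < 1" for x
      by (rule power_series_derivative(1)[OF c'' that])
    have simple: "(\<Sum>k. diffs c k * z ^ k) \<noteq> 0" if z: "\<bar>z\<bar> < 1" "random_series a \<omega> z = 0" for z
    proof
      assume dz: "(\<Sum>k. diffs c k * z ^ k) = 0"
      obtain N where N: "1 / real (Suc N) < 1 - \<bar>z\<bar>"
        using reals_Archimedean[of "1 - \<bar>z\<bar>"] z by (auto simp: inverse_eq_divide)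
      moreover have "1 / real (N + 2) \<le> 1 / real (Suc N)" by (simp add: divide_simps)
      ultimately have zr: "\<bar>z\<bar> \<le> r N" unfolding r_def by linarith
      have "continuous_on {- r N..r N} (\<lambda>x. \<Sum>k. diffs (diffs c) k * x ^ k)"
      proof (rule DERIV_continuous_on)
        fix x assume "x \<in> {- r N..r N}"
        then have "\<bar>x\<bar> < 1" using r[of N] by auto
        then show "((\<lambda>x. \<Sum>k. diffs (diffs c) k * x ^ k) has_real_derivative (\<Sum>k. diffs (diffs (diffs c)) k * x ^ k)) (at x within {- r N..r N})"
          by (intro has_field_derivative_at_within[OF d3])
      qed
      then have "compact ((\<lambda>x. \<Sum>k. diffs (diffs c) k * x ^ k) ` {- r N..r N})"
        by (intro compact_continuous_image compact_Icc)
      then obtain B where B: "\<And>x. \<bar>x\<bar> \<le> r N \<Longrightarrow> \<bar>\<Sum>k. diffs (diffs c) k * x ^ k\<bar> \<le> B"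
        by (fastforce dest!: compact_imp_bounded simp: bounded_iff abs_le_iff)
      obtain K :: nat where K: "B \<le> real K" using real_arch_simple by blast
      have "\<bar>random_series a \<omega> x\<bar> \<le> real K * (x - z)\<^sup>2" if x: "\<bar>x\<bar> \<le> r N" for x
        unfolding F
      proof (rule abs_le_of_double_zero[where F="\<lambda>x. \<Sum>k. c k * x ^ k" and F'="\<lambda>x. \<Sum>k. diffs c k * x ^ k"
              and F''="\<lambda>x. \<Sum>k. diffs (diffs c) k * x ^ k", OF _ _ _ zr _ dz x])
        fix y assume y: "\<bar>y\<bar> \<le> r N"
        then have y1: "\<bar>y\<bar> < 1" using r[of N] by auto
        show "((\<lambda>x. \<Sum>k. c k * x ^ k) has_real_derivative (\<Sum>k. diffs c k * y ^ k)) (at y)"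
          by (rule d1[OF y1])
        show "((\<lambda>x. \<Sum>k. diffs c k * x ^ k) has_real_derivative (\<Sum>k. diffs (diffs c) k * y ^ k)) (at y)"
          by (rule d2[OF y1])
        show "\<bar>\<Sum>k. diffs (diffs c) k * y ^ k\<bar> \<le> real K"
          using B[OF y] K by simp
      next
        show "(\<Sum>k. c k * z ^ k) = 0" using z(2) unfolding F .
      qed
      then show False using elim(2) zr by blast
    qed
    show ?case
      using d1 simple unfolding F c_def by auto
  qed
qed

end

section \<open>Counting zeros by sign changes\<close>

lemma abs_tanh_diff_le: "\<bar>tanh x - tanh y\<bar> \<le> \<bar>x - y\<bar>" for x y :: real
proof -
  have "norm (tanh x - tanh y) \<le> 1 * norm (x - y)"
  proof (rule field_differentiable_bound[where S=UNIV and f'="\<lambda>x. 1 - tanh x ^ 2"])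
    show "(tanh has_real_derivative 1 - tanh z ^ 2) (at z within UNIV)" for z :: real
      by (auto intro!: derivative_eq_intros)
    show "norm (1 - tanh z ^ 2) \<le> 1" for z :: real
    proof -
      have "(tanh z)\<^sup>2 \<le> 1" using abs_tanh_less_1[of z] by (simp add: abs_square_le_1)
      then show ?thesis using zero_le_power2[of "tanh z"] by simp
    qed
  qed auto
  then show ?thesis by simp
qed

lemma sign_change_at_simple_zero:
  fixes f :: "real \<Rightarrow> real"
  assumes "(f has_real_derivative D) (at z)" "D \<noteq> 0" "f z = 0"
  shows "\<exists>\<delta>>0. \<forall>x y. z - \<delta> < x \<and> x < z \<and> z < y \<and> y < z + \<delta> \<longrightarrow> f x * f y < 0"
proof (cases "0 < D")
  case True
  obtain d1 where d1: "0 < d1" "\<And>h. 0 < h \<Longrightarrow> h < d1 \<Longrightarrow> f z < f (z + h)"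
    using DERIV_pos_inc_right[OF assms(1) True] by auto
  obtain d2 where d2: "0 < d2" "\<And>h. 0 < h \<Longrightarrow> h < d2 \<Longrightarrow> f (z - h) < f z"
    using DERIV_pos_inc_left[OF assms(1) True] by auto
  show ?thesis
  proof (intro exI[of _ "min d1 d2"] conjI allI impI)
    fix x y assume "z - min d1 d2 < x \<and> x < z \<and> z < y \<and> y < z + min d1 d2"
    then have "0 < y - z" "y - z < d1" "0 < z - x" "z - x < d2"
      using min.cobounded1[of d1 d2] min.cobounded2[of d1 d2] by linarith+
    then show "f x * f y < 0"
      using d1(2)[of "y - z"] d2(2)[of "z - x"] assms(3) by (simp add: mult_less_0_iff)
  qed (use d1 d2 in auto)
next
  case False
  then have D: "D < 0" using assms by simp
  obtain d1 where d1: "0 < d1" "\<And>h. 0 < h \<Longrightarrow> h < d1 \<Longrightarrow> f (z + h) < f z"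
    using DERIV_neg_dec_right[OF assms(1) D] by auto
  obtain d2 where d2: "0 < d2" "\<And>h. 0 < h \<Longrightarrow> h < d2 \<Longrightarrow> f z < f (z - h)"
    using DERIV_neg_dec_left[OF assms(1) D] by auto
  show ?thesis
  proof (intro exI[of _ "min d1 d2"] conjI allI impI)
    fix x y assume "z - min d1 d2 < x \<and> x < z \<and> z < y \<and> y < z + min d1 d2"
    then have "0 < y - z" "y - z < d1" "0 < z - x" "z - x < d2"
      using min.cobounded1[of d1 d2] min.cobounded2[of d1 d2] by linarith+
    then show "f x * f y < 0"
      using d1(2)[of "y - z"] d2(2)[of "z - x"] assms(3) by (simp add: mult_less_0_iff)
  qed (use d1 d2 in auto)
qed

text \<open>An accumulation point of zeros is itself a zero by continuity. It is simple, so near it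
  f x * f y < 0 whenever x and y lie on opposite sides, and this leaves no room for another zero
  w.\<close>

lemma finite_simple_zeros:
  fixes f f' :: "real \<Rightarrow> real"
  assumes deriv: "\<And>z. z \<in> S \<Longrightarrow> (f has_real_derivative f' z) (at z)"
    and simple: "\<And>z. z \<in> S \<Longrightarrow> f z = 0 \<Longrightarrow> f' z \<noteq> 0"
    and S: "compact S"
  shows "finite {z \<in> S. f z = 0}"
proof (rule ccontr)
  assume inf: "infinite {z \<in> S. f z = 0}"
  obtain z where z: "z \<in> S" "z islimpt {z \<in> S. f z = 0}"
    using S inf by (metis (no_types, lifting) compact_eq_Bolzano_Weierstrass mem_Collect_eq subsetI)
  have "continuous_on S f"
    using deriv by (intro DERIV_continuous_on) (auto intro: has_field_derivative_at_within)
  then have "closed {z \<in> S. f z = 0}"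
    using S by (intro continuous_closed_preimage_constant compact_imp_closed)
  with z(2) have fz: "f z = 0"
    unfolding closed_limpt by blast
  obtain \<delta> where \<delta>: "0 < \<delta>" "\<And>x y. z - \<delta> < x \<Longrightarrow> x < z \<Longrightarrow> z < y \<Longrightarrow> y < z + \<delta> \<Longrightarrow> f x * f y < 0"
    using sign_change_at_simple_zero[OF deriv[OF z(1)] simple[OF z(1) fz] fz] by blast
  obtain w where w: "f w = 0" "w \<noteq> z" "dist w z < \<delta>"
    using z(2) \<delta>(1) unfolding islimpt_approachable by blast
  then show False
    using \<delta>(2)[of w "z + \<delta> / 2"] \<delta>(2)[of "z - \<delta> / 2" w] \<delta>(1)
    by (cases "w < z") (auto simp: dist_real_def)
qed

text \<open>The intermediate value theorem, with the right end excluded because \<open>f y\<close>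
  is nonzero; this matches the half-open cells.\<close>

lemma ex_zero_of_sign_change:
  fixes f :: "real \<Rightarrow> real"
  assumes "x < y" "continuous_on {x..y} f" "f x * f y < 0"
  shows "\<exists>z\<in>{x..<y}. f z = 0"
proof -
  have "\<exists>z. x \<le> z \<and> z \<le> y \<and> f z = 0"
  proof (cases "f x < 0")
    case True
    then show ?thesis using assms IVT'[of f x 0 y] by (auto simp: mult_less_0_iff)
  next
    case False
    then show ?thesis using assms IVT2'[of f y 0 x] by (auto simp: mult_less_0_iff)
  qed
  then obtain z where "x \<le> z" "z \<le> y" "f z = 0" by blast
  moreover from this have "z \<noteq> y" using assms by auto
  ultimately show ?thesis by (intro bexI[of _ z]) auto
qed

lemma ex_cell:
  fixes u h s :: real
  assumes "0 < h" "u \<le> s" "s < u + h" "0 < m"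
  shows "\<exists>j<m. u + real j * (h / real m) \<le> s \<and> s < u + real (Suc j) * (h / real m)"
proof -
  define j where "j = nat \<lfloor>(s - u) * real m / h\<rfloor>"
  have pos: "0 \<le> (s - u) * real m / h" using assms by auto
  then have j: "real j \<le> (s - u) * real m / h" "(s - u) * real m / h < real j + 1"
    unfolding j_def by linarith+
  have "(s - u) * real m < h * real m" using assms by (intro mult_strict_right_mono) auto
  then have "(s - u) * real m / h < real m" using assms by (simp add: divide_less_eq mult.commute)
  with j(1) have "j < m" by linarith
  moreover have "u + real j * (h / real m) \<le> s" "s < u + real (Suc j) * (h / real m)"
    using j assms by (simp_all add: field_simps)
  ultimately show ?thesis by blast
qed

text \<open>There are finitely many zeros, all simple. Once the mesh is finer than every
  neighbourhood on which the sign pattern is controlled, each zero lies inside a cell whose end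
  points have opposite signs. The nonvanishing on the grid keeps zeros off the cell
  boundaries.\<close>

lemma eventually_card_zeros_le_sign_changes:
  fixes f f' :: "real \<Rightarrow> real"
  assumes deriv: "\<And>z. \<bar>z\<bar> < 1 \<Longrightarrow> (f has_real_derivative f' z) (at z)"
    and simple: "\<And>z. \<bar>z\<bar> < 1 \<Longrightarrow> f z = 0 \<Longrightarrow> f' z \<noteq> 0"
    and grid: "\<And>m j. f (tanh (u + real j * (h / real m))) \<noteq> 0"
    and h: "0 < h"
  shows "\<forall>\<^sub>F m in sequentially. num_points {z \<in> {-1<..<1}. f z = 0} {tanh u..<tanh (u + h)} \<le>
     of_nat (card {j \<in> {..<m}. f (tanh (u + real j * (h / real m))) * f (tanh (u + real (Suc j) * (h / real m))) < 0})"
proof -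
  define F where "F = {z \<in> {-1<..<1}. f z = 0} \<inter> {tanh u..<tanh (u + h)}"
  have "finite {z \<in> {tanh u..tanh (u + h)}. f z = 0}"
  proof (rule finite_simple_zeros[where f'=f'])
    fix z assume "z \<in> {tanh u..tanh (u + h)}"
    then have "\<bar>z\<bar> < 1" using abs_tanh_less_1[of u] abs_tanh_less_1[of "u + h"] by auto
    then show "(f has_real_derivative f' z) (at z)" "f z = 0 \<Longrightarrow> f' z \<noteq> 0"
      using deriv simple by auto
  qed auto
  then have fin: "finite F"
    by (rule finite_subset[rotated]) (auto simp: F_def)
  have "\<exists>\<delta>. \<forall>z\<in>F. 0 < \<delta> z \<and> (\<forall>x y. z - \<delta> z < x \<and> x < z \<and> z < y \<and> y < z + \<delta> z \<longrightarrow> f x * f y < 0)"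
    by (intro bchoice ballI) (use sign_change_at_simple_zero[OF deriv simple] in \<open>auto simp: F_def abs_less_iff\<close>)
  then obtain \<delta> where \<delta>: "\<And>z. z \<in> F \<Longrightarrow> 0 < \<delta> z"
    "\<And>z x y. z \<in> F \<Longrightarrow> z - \<delta> z < x \<Longrightarrow> x < z \<Longrightarrow> z < y \<Longrightarrow> y < z + \<delta> z \<Longrightarrow> f x * f y < 0"
    by blast
  have "\<forall>\<^sub>F m in sequentially. \<forall>z\<in>F. h / real m < \<delta> z"
  proof (intro eventually_ball_finite fin ballI)
    fix z assume "z \<in> F"
    have "(\<lambda>m. h / real m) \<longlonglongrightarrow> 0" by real_asymp
    from order_tendstoD(2)[OF this \<delta>(1)[OF \<open>z \<in> F\<close>]] show "\<forall>\<^sub>F m in sequentially. h / real m < \<delta> z" .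
  qed
  with eventually_gt_at_top[of "0::nat"] show ?thesis
  proof eventually_elim
    case (elim m)
    define t where "t j = tanh (u + real j * (h / real m))" for j
    let ?C = "{j \<in> {..<m}. f (t j) * f (t (Suc j)) < 0}"
    have "\<exists>j. \<forall>z\<in>F. j z < m \<and> t (j z) < z \<and> z < t (Suc (j z))"
    proof (intro bchoice ballI)
      fix z assume z: "z \<in> F"
      then have z1: "-1 < z" "z < 1" "tanh u \<le> z" "z < tanh (u + h)" by (auto simp: F_def)
      have "u \<le> artanh z" "artanh z < u + h"
        using z1 tanh_artanh_real[OF z1(1,2)] by (metis tanh_real_le_iff, metis tanh_real_less_iff)
      from ex_cell[OF h this elim(1)] obtain j where j: "j < m" "u + real j * (h / real m) \<le> artanh z"
        "artanh z < u + real (Suc j) * (h / real m)" by blast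
      have "t j \<le> z" "z < t (Suc j)"
        using j tanh_artanh_real[OF z1(1,2)] unfolding t_def by (metis tanh_real_le_iff, metis tanh_real_less_iff)
      moreover have "t j \<noteq> z" using grid z unfolding t_def F_def by auto
      ultimately show "\<exists>j. j < m \<and> t j < z \<and> z < t (Suc j)" using j(1) by (auto intro!: exI[of _ j])
    qed
    then obtain j where j: "\<And>z. z \<in> F \<Longrightarrow> j z < m" "\<And>z. z \<in> F \<Longrightarrow> t (j z) < z" "\<And>z. z \<in> F \<Longrightarrow> z < t (Suc (j z))"
      by blast
    have mesh: "t (Suc i) - t i \<le> h / real m" for i
    proof -
      have "t (Suc i) - t i \<le> \<bar>(u + real (Suc i) * (h / real m)) - (u + real i * (h / real m))\<bar>"
        unfolding t_def by (rule order_trans[OF abs_ge_self abs_tanh_diff_le])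
      also have "\<dots> = \<bar>h / real m\<bar>" by (rule arg_cong[where f=abs]) (simp add: distrib_right add_divide_distrib)
      finally show ?thesis using h by simp
    qed
    have near: "z - \<delta> z < t (j z)" "t (Suc (j z)) < z + \<delta> z" if "z \<in> F" for z
      using mesh[of "j z"] j(2,3)[OF that] bspec[OF elim(2) that] by linarith+
    have "card F \<le> card ?C"
    proof (rule card_inj_on_le[where f=j])
      show "j ` F \<subseteq> ?C"
        using j(1) \<delta>(2)[OF _ near(1) j(2) j(3) near(2)] by blast
      \<comment> \<open>Two zeros in one cell are impossible: the larger one would lie in the
        controlled neighbourhood to the right of the smaller one, where \<open>f\<close> cannot
        vanish.\<close>
      have "\<not> z < z'" if z: "z \<in> F" "z' \<in> F" "j z = j z'" for z z'
      proof
        assume "z < z'"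
        moreover have "z' < z + \<delta> z" using near(2)[OF z(1)] j(3)[OF z(2)] z(3) by simp
        ultimately have "f (t (j z)) * f z' < 0"
          using \<delta>(2)[OF z(1) near(1)[OF z(1)] j(2)[OF z(1)]] by blast
        then show False using z(2) by (simp add: F_def)
      qed
      then show "inj_on j F" by (metis inj_onI linorder_neqE_linordered_idom)
    qed simp
    then have "emeasure (count_space UNIV) F \<le> of_nat (card ?C)"
      using fin by (simp add: emeasure_count_space)
    then show ?case unfolding num_points_def F_def t_def .
  qed
qed

lemma one_le_num_points_of_sign_change:
  fixes f f' :: "real \<Rightarrow> real"
  assumes deriv: "\<And>z. \<bar>z\<bar> < 1 \<Longrightarrow> (f has_real_derivative f' z) (at z)"
    and h: "0 < h" and sign: "f (tanh u) * f (tanh (u + h)) < 0"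
  shows "1 \<le> num_points {z \<in> {-1<..<1}. f z = 0} {tanh u..<tanh (u + h)}"
proof -
  have "continuous_on {tanh u..tanh (u + h)} f"
  proof (rule DERIV_continuous_on[where D=f'])
    fix z assume "z \<in> {tanh u..tanh (u + h)}"
    then have "\<bar>z\<bar> < 1" using abs_tanh_less_1[of u] abs_tanh_less_1[of "u + h"] by auto
    then show "(f has_real_derivative f' z) (at z within {tanh u..tanh (u + h)})"
      by (intro has_field_derivative_at_within[OF deriv])
  qed
  then obtain z where z: "z \<in> {tanh u..<tanh (u + h)}" "f z = 0"
    using ex_zero_of_sign_change[where f=f and x="tanh u" and y="tanh (u + h)", OF _ _ sign] h by auto
  then have "\<bar>z\<bar> < 1" using abs_tanh_less_1[of u] abs_tanh_less_1[of "u + h"] by auto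
  have "1 = emeasure (count_space UNIV) {z}" by simp
  also have "\<dots> \<le> emeasure (count_space UNIV) ({z \<in> {-1<..<1}. f z = 0} \<inter> {tanh u..<tanh (u + h)})"
    using z \<open>\<bar>z\<bar> < 1\<close> by (intro emeasure_mono) (auto simp: abs_less_iff)
  finally show ?thesis unfolding num_points_def .
qed

section \<open>Zero moments versus sign-change probabilities\<close>

context gaussian_coefficients
begin

definition sign_changes :: "nat \<Rightarrow> (nat \<Rightarrow> real) \<Rightarrow> real \<Rightarrow> 'a set" where
  "sign_changes n u h = {\<omega> \<in> space M. \<forall>i<n. random_series a \<omega> (tanh (u i)) * random_series a \<omega> (tanh (u i + h)) < 0}"

lemma sign_changes_sets[measurable]: "sign_changes n u h \<in> sets M"
  unfolding sign_changes_def by measurable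

text \<open>For pairwise disjoint intervals this is the left side of the identity in
  \<open>correlation_function\<close>. The common length \<open>h\<close> is measured in the
  coordinate u, not in x = tanh u.\<close>

definition zero_moment :: "nat \<Rightarrow> (nat \<Rightarrow> real) \<Rightarrow> real \<Rightarrow> ennreal" where
  "zero_moment n u h = (\<integral>\<^sup>+\<omega>. (\<Prod>i<n. num_points (real_zeros a \<omega>) {tanh (u i)..<tanh (u i + h)}) \<partial>M)"

lemma real_zeros_eq: "real_zeros a \<omega> = {z \<in> {-1<..<1}. random_series a \<omega> z = 0}"
  by (simp add: real_zeros_def)

lemma emeasure_sign_changes_le_moment:
  assumes h: "0 < h"
  shows "emeasure M (sign_changes n u h) \<le>
    zero_moment n u h"
proof -
  have "emeasure M (sign_changes n u h) = (\<integral>\<^sup>+\<omega>. indicator (sign_changes n u h) \<omega> \<partial>M)"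
    by simp
  also have "\<dots> \<le> (\<integral>\<^sup>+\<omega>. (\<Prod>i<n. num_points (real_zeros a \<omega>) {tanh (u i)..<tanh (u i + h)}) \<partial>M)"
  proof (rule nn_integral_mono_AE, use AE_simple_zeros in eventually_elim)
    case (elim \<omega>)
    show ?case
    proof (cases "\<omega> \<in> sign_changes n u h")
      case True
      have "1 \<le> num_points (real_zeros a \<omega>) {tanh (u i)..<tanh (u i + h)}" if "i < n" for i
        unfolding real_zeros_eq
        by (rule one_le_num_points_of_sign_change[OF _ h]) (use elim True that in \<open>auto simp: sign_changes_def\<close>)
      then have "1 \<le> (\<Prod>i<n. num_points (real_zeros a \<omega>) {tanh (u i)..<tanh (u i + h)})"
        by (intro prod_ge_1) auto
      then show ?thesis using True by simp
    qed simp
  qed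
  finally show ?thesis unfolding zero_moment_def .
qed

text \<open>Almost surely the counts are eventually bounded by numbers of cells with a sign change,
  but the required fineness is random, so the bound goes through the lower limit of
  \<open>G m\<close> and Fatou's lemma. Expanding the product of cell counts over tuples of cells
  turns the expectation of \<open>G m\<close> into the sum in the hypothesis.\<close>

lemma moment_le_sum_sign_changes:
  assumes h: "0 < h"
    and C: "\<And>m. 0 < m \<Longrightarrow> (\<Sum>p\<in>Pi\<^sub>E {..<n} (\<lambda>_. {..<m}).
        emeasure M (sign_changes n (\<lambda>i. u i + real (p i) * (h / real m)) (h / real m))) \<le> C"
  shows "zero_moment n u h \<le> C"
proof -
  define P where "P m i j \<omega> \<longleftrightarrow> random_series a \<omega> (tanh (u i + real j * (h / real m))) *
      random_series a \<omega> (tanh (u i + real (Suc j) * (h / real m))) < 0" for m i j \<omega>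
  define G where "G m \<omega> = (\<Prod>i<n. of_nat (card {j \<in> {..<m}. P m i j \<omega>}) :: ennreal)" for m \<omega>
  have G_eq: "G m \<omega> = (\<Sum>p\<in>Pi\<^sub>E {..<n} (\<lambda>_. {..<m}).
      indicator (sign_changes n (\<lambda>i. u i + real (p i) * (h / real m)) (h / real m)) \<omega>)"
    if "\<omega> \<in> space M" for m \<omega>
  proof -
    have "of_nat (card {j \<in> {..<m}. P m i j \<omega>}) = (\<Sum>j<m. indicator {j. P m i j \<omega>} j :: ennreal)" for i
      by (simp add: indicator_def sum.If_cases Int_def)
    then have "G m \<omega> = (\<Prod>i<n. \<Sum>j<m. indicator {j. P m i j \<omega>} j)"
      unfolding G_def by simp
    also have "\<dots> = (\<Sum>p\<in>Pi\<^sub>E {..<n} (\<lambda>_. {..<m}). \<Prod>i<n. indicator {j. P m i j \<omega>} (p i))"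
      by (rule prod_sum_PiE) auto
    also have "\<dots> = (\<Sum>p\<in>Pi\<^sub>E {..<n} (\<lambda>_. {..<m}).
      indicator (sign_changes n (\<lambda>i. u i + real (p i) * (h / real m)) (h / real m)) \<omega>)"
    proof (rule sum.cong[OF refl])
      fix p
      have e: "u i + real (p i) * (h / real m) + h / real m = u i + real (Suc (p i)) * (h / real m)" for i
        by (simp add: distrib_right add_divide_distrib)
      have "\<omega> \<in> sign_changes n (\<lambda>i. u i + real (p i) * (h / real m)) (h / real m) \<longleftrightarrow> (\<forall>i<n. P m i (p i) \<omega>)"
        using that by (simp only: sign_changes_def mem_Collect_eq e P_def simp_thms)
      moreover have "(\<Prod>i<n. indicator {j. P m i j \<omega>} (p i)) = (if \<forall>i<n. P m i (p i) \<omega> then 1 else 0 :: ennreal)"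
        by (auto simp: indicator_def prod_zero_iff intro!: prod.neutral)
      ultimately show "(\<Prod>i<n. indicator {j. P m i j \<omega>} (p i)) =
          (indicator (sign_changes n (\<lambda>i. u i + real (p i) * (h / real m)) (h / real m)) \<omega> :: ennreal)"
        by (simp add: indicator_def)
    qed
    finally show ?thesis .
  qed
  have G_measurable[measurable]: "G m \<in> borel_measurable M" for m
    by (subst measurable_cong[OF G_eq]) auto
  have G_int: "(\<integral>\<^sup>+\<omega>. G m \<omega> \<partial>M) \<le> C" if "0 < m" for m
    using C[OF that] by (simp add: G_eq nn_integral_sum cong: nn_integral_cong)
  have "(\<integral>\<^sup>+\<omega>. (\<Prod>i<n. num_points (real_zeros a \<omega>) {tanh (u i)..<tanh (u i + h)}) \<partial>M) \<le>
      (\<integral>\<^sup>+\<omega>. liminf (\<lambda>m. G m \<omega>) \<partial>M)"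
  proof (rule nn_integral_mono_AE)
    have "AE \<omega> in M. \<forall>i m j. random_series a \<omega> (tanh (u i + real j * (h / real m))) \<noteq> 0"
      unfolding AE_all_countable by (intro allI AE_random_series_nonzero abs_tanh_less_1)
    with AE_simple_zeros
    show "AE \<omega> in M. (\<Prod>i<n. num_points (real_zeros a \<omega>) {tanh (u i)..<tanh (u i + h)}) \<le> liminf (\<lambda>m. G m \<omega>)"
    proof eventually_elim
      case (elim \<omega>)
      have "\<forall>\<^sub>F m in sequentially. \<forall>i\<in>{..<n}. num_points (real_zeros a \<omega>) {tanh (u i)..<tanh (u i + h)} \<le>
          of_nat (card {j \<in> {..<m}. P m i j \<omega>})"
        unfolding P_def real_zeros_eq
        by (intro eventually_ball_finite ballI eventually_card_zeros_le_sign_changes[OF _ _ _ h]) (use elim in auto)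
      then have "\<forall>\<^sub>F m in sequentially. (\<Prod>i<n. num_points (real_zeros a \<omega>) {tanh (u i)..<tanh (u i + h)}) \<le> G m \<omega>"
        by eventually_elim (unfold G_def, intro prod_mono_ennreal, blast)
      then show ?case by (rule Liminf_bounded)
    qed
  qed
  also have "\<dots> \<le> liminf (\<lambda>m. \<integral>\<^sup>+\<omega>. G m \<omega> \<partial>M)"
    by (rule nn_integral_liminf) auto
  also have "\<dots> \<le> C"
  proof (rule Liminf_le)
    show "\<forall>\<^sub>F m in sequentially. (\<integral>\<^sup>+\<omega>. G m \<omega> \<partial>M) \<le> C"
      using eventually_gt_at_top[of "0::nat"] by eventually_elim (rule G_int)
  qed simp
  finally show ?thesis unfolding zero_moment_def .
qed

text \<open>Here \<open>L\<close> is the local intensity of sign changes.  The lower bound for the moment uses a single cell,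
  the upper bound arbitrarily fine subdivisions, so the hypothesis has to be uniform near \<open>u\<close>.\<close>

lemma moment_asymptotics:
  assumes L: "0 \<le> L"
    and lim: "\<And>w k. (\<And>i. i < n \<Longrightarrow> (\<lambda>m. w m i) \<longlonglongrightarrow> u i) \<Longrightarrow> k \<longlonglongrightarrow> 0 \<Longrightarrow> (\<And>m::nat. 0 < k m) \<Longrightarrow>
        (\<lambda>m. measure M (sign_changes n (w m) (k m)) / k m ^ n) \<longlonglongrightarrow> L"
    and \<epsilon>: "0 < \<epsilon>"
  shows "\<exists>\<delta>>0. \<forall>h. 0 < h \<longrightarrow> h < \<delta> \<longrightarrow>
     ennreal ((L - \<epsilon>) * h ^ n) \<le> zero_moment n u h \<and>
     zero_moment n u h \<le> ennreal ((L + \<epsilon>) * h ^ n)"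
proof -
  \<comment> \<open>Sequential convergence along all base points and steps upgrades to a uniform
    estimate: otherwise bad choices at scale 1/(m+1) would form sequences contradicting
    \<open>lim\<close>.\<close>
  have "\<exists>\<delta>>0. \<forall>w k. (\<forall>i<n. \<bar>w i - u i\<bar> < \<delta>) \<longrightarrow> 0 < k \<longrightarrow> k < \<delta> \<longrightarrow>
      \<bar>measure M (sign_changes n w k) / k ^ n - L\<bar> < \<epsilon>"
  proof (rule ccontr)
    assume neg: "\<not> ?thesis"
    have "\<exists>w k. (\<forall>i<n. \<bar>w i - u i\<bar> < 1 / real (Suc m)) \<and> 0 < k \<and> k < 1 / real (Suc m) \<and>
      \<not> \<bar>measure M (sign_changes n w k) / k ^ n - L\<bar> < \<epsilon>" for m
      using neg[unfolded not_ex, rule_format, of "1 / real (Suc m)"] by auto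
    then obtain w k where wk: "\<And>m i. i < n \<Longrightarrow> \<bar>w m i - u i\<bar> < 1 / real (Suc m)" "\<And>m. 0 < k m" "\<And>m. k m < 1 / real (Suc m)"
      "\<And>m. \<not> \<bar>measure M (sign_changes n (w m) (k m)) / k m ^ n - L\<bar> < \<epsilon>"
      by metis
    have null: "(\<lambda>m. 1 / real (Suc m)) \<longlonglongrightarrow> 0" by real_asymp
    have "(\<lambda>m. w m i) \<longlonglongrightarrow> u i" if "i < n" for i
    proof -
      have "(\<lambda>m. w m i - u i) \<longlonglongrightarrow> 0"
        by (rule Lim_null_comparison[OF _ null]) (use wk(1)[OF that] in \<open>auto intro!: always_eventually less_imp_le\<close>)
      then show ?thesis by (simp add: LIM_zero_iff)
    qed
    moreover have "k \<longlonglongrightarrow> 0"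
      by (rule Lim_null_comparison[OF _ null]) (use wk(2,3) in \<open>auto intro!: always_eventually less_imp_le simp: abs_of_pos\<close>)
    ultimately have "(\<lambda>m. measure M (sign_changes n (w m) (k m)) / k m ^ n) \<longlonglongrightarrow> L"
      using lim wk(2) by blast
    from tendstoD[OF this \<epsilon>] have "\<forall>\<^sub>F m in sequentially. \<bar>measure M (sign_changes n (w m) (k m)) / k m ^ n - L\<bar> < \<epsilon>"
      by (simp add: dist_real_def)
    then show False using wk(4) by (auto simp: eventually_sequentially)
  qed
  then obtain \<delta> where \<delta>: "0 < \<delta>" "\<And>w k. (\<forall>i<n. \<bar>w i - u i\<bar> < \<delta>) \<Longrightarrow> 0 < k \<Longrightarrow> k < \<delta> \<Longrightarrow>
      \<bar>measure M (sign_changes n w k) / k ^ n - L\<bar> < \<epsilon>" by blast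
  have bounds: "(L - \<epsilon>) * k ^ n \<le> measure M (sign_changes n w k)" "measure M (sign_changes n w k) \<le> (L + \<epsilon>) * k ^ n"
    if "\<forall>i<n. \<bar>w i - u i\<bar> < \<delta>" "0 < k" "k < \<delta>" for w k
  proof -
    have kn: "0 < k ^ n" using that by simp
    have "L - \<epsilon> \<le> measure M (sign_changes n w k) / k ^ n" "measure M (sign_changes n w k) / k ^ n \<le> L + \<epsilon>"
      using \<delta>(2)[OF that] by linarith+
    then show "(L - \<epsilon>) * k ^ n \<le> measure M (sign_changes n w k)" "measure M (sign_changes n w k) \<le> (L + \<epsilon>) * k ^ n"
      using kn by (simp_all add: le_divide_eq divide_le_eq)
  qed
  show ?thesis
  proof (intro exI[of _ \<delta>] conjI allI impI \<delta>(1))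
    fix h assume h: "0 < h" "h < \<delta>"
    have "ennreal ((L - \<epsilon>) * h ^ n) \<le> emeasure M (sign_changes n u h)"
      unfolding emeasure_eq_measure using bounds(1)[of u h] h \<delta>(1) by (intro ennreal_leI) auto
    also note emeasure_sign_changes_le_moment[OF h(1)]
    finally show "ennreal ((L - \<epsilon>) * h ^ n) \<le> zero_moment n u h" .
    show "zero_moment n u h \<le> ennreal ((L + \<epsilon>) * h ^ n)"
    proof (rule moment_le_sum_sign_changes[OF h(1)])
      fix m :: nat assume m: "0 < m"
      have hm: "0 < h / real m" "h / real m \<le> h" using h m by (auto simp: divide_le_eq)
      have "(\<Sum>p\<in>Pi\<^sub>E {..<n} (\<lambda>_. {..<m}). emeasure M (sign_changes n (\<lambda>i. u i + real (p i) * (h / real m)) (h / real m))) \<le>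
          (\<Sum>p\<in>Pi\<^sub>E {..<n} (\<lambda>_. {..<m}). ennreal ((L + \<epsilon>) * (h / real m) ^ n))"
      proof (rule sum_mono)
        fix p assume p: "p \<in> Pi\<^sub>E {..<n} (\<lambda>_. {..<m})"
        have "\<bar>u i + real (p i) * (h / real m) - u i\<bar> < \<delta>" if "i < n" for i
        proof -
          have "p i < m" using p that by auto
          then have "real (p i) * (h / real m) < real m * (h / real m)"
            using hm by (intro mult_strict_right_mono) auto
          then have "real (p i) * (h / real m) < h" using m by simp
          moreover have "0 \<le> real (p i) * (h / real m)" using hm by simp
          ultimately show ?thesis using h(2) by simp
        qed
        then show "emeasure M (sign_changes n (\<lambda>i. u i + real (p i) * (h / real m)) (h / real m)) \<le> ennreal ((L + \<epsilon>) * (h / real m) ^ n)"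
          unfolding emeasure_eq_measure using hm h by (intro ennreal_leI bounds(2)) auto
      qed
      \<comment> \<open>There are m^n tuples of cells, each contributing at most (L + \<epsilon>)
        (h/m)^n; the powers of m cancel and the bound is the same for every subdivision.\<close>
      also have "\<dots> = of_nat (m ^ n) * ennreal ((L + \<epsilon>) * (h / real m) ^ n)"
        by (simp add: card_PiE)
      also have "\<dots> = ennreal (real (m ^ n) * ((L + \<epsilon>) * (h / real m) ^ n))"
        by (simp only: ennreal_of_nat_eq_real_of_nat ennreal_mult' of_nat_0_le_iff)
      also have "real (m ^ n) * ((L + \<epsilon>) * (h / real m) ^ n) = (L + \<epsilon>) * h ^ n"
        using m by (simp add: power_divide)
      finally show "(\<Sum>p\<in>Pi\<^sub>E {..<n} (\<lambda>_. {..<m}). emeasure M (sign_changes n (\<lambda>i. u i + real (p i) * (h / real m)) (h / real m)))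
          \<le> ennreal ((L + \<epsilon>) * h ^ n)" .
    qed
  qed
qed

section \<open>From moments of small boxes to the density\<close>

lemma emeasure_PiM_restrict_box:
  fixes B :: "nat \<Rightarrow> real set"
  assumes D: "D \<in> sets borel" and B: "\<And>i. i < n \<Longrightarrow> B i \<in> sets borel" "\<And>i. i < n \<Longrightarrow> B i \<subseteq> D"
  shows "Pi\<^sub>E {..<n} B \<in> sets (\<Pi>\<^sub>M i\<in>{..<n}. restrict_space lborel D)"
    and "emeasure (\<Pi>\<^sub>M i\<in>{..<n}. restrict_space lborel D) (Pi\<^sub>E {..<n} B) = (\<Prod>i<n. emeasure lborel (B i))"
proof -
  interpret P: product_sigma_finite "\<lambda>_::nat. restrict_space lborel D"
    using D by (simp add: product_sigma_finite_def sigma_finite_measure_restrict_space sigma_finite_lborel)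
  have sets: "B i \<in> sets (restrict_space lborel D)" if "i < n" for i
    using that B D by (simp add: sets_restrict_space_iff)
  then show "Pi\<^sub>E {..<n} B \<in> sets (\<Pi>\<^sub>M i\<in>{..<n}. restrict_space lborel D)"
    by (intro sets_PiM_I_finite) auto
  have "emeasure (\<Pi>\<^sub>M i\<in>{..<n}. restrict_space lborel D) (Pi\<^sub>E {..<n} B) = (\<Prod>i<n. emeasure (restrict_space lborel D) (B i))"
    using sets by (intro P.emeasure_PiM) auto
  also have "\<dots> = (\<Prod>i<n. emeasure lborel (B i))"
    using B D by (intro prod.cong refl emeasure_restrict_space) auto
  finally show "emeasure (\<Pi>\<^sub>M i\<in>{..<n}. restrict_space lborel D) (Pi\<^sub>E {..<n} B) = (\<Prod>i<n. emeasure lborel (B i))" .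
qed

text \<open>On a small box the moment is about \<rho> times its volume, by continuity, and about L
  h^n, by the sign-change asymptotics. The volume divided by h^n tends to the Jacobian of tanh in
  each coordinate, which is the product on the left.\<close>

lemma correlation_function_eq_sign_change_intensity:
  assumes corr: "correlation_function M {-1<..<1} (real_zeros a) n \<rho>"
    and inj: "inj_on u {..<n}"
    and cont: "\<And>\<epsilon>. 0 < \<epsilon> \<Longrightarrow> \<exists>\<delta>>0. \<forall>x \<in> {..<n} \<rightarrow>\<^sub>E {-1<..<1}. (\<forall>i<n. \<bar>x i - tanh (u i)\<bar> < \<delta>) \<longrightarrow>
        \<bar>\<rho> x - \<rho> (\<lambda>i\<in>{..<n}. tanh (u i))\<bar> < \<epsilon>"
    and L: "0 \<le> L"
    and lim: "\<And>w k. (\<And>i. i < n \<Longrightarrow> (\<lambda>m. w m i) \<longlonglongrightarrow> u i) \<Longrightarrow> k \<longlonglongrightarrow> 0 \<Longrightarrow> (\<And>m::nat. 0 < k m) \<Longrightarrow>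
        (\<lambda>m. measure M (sign_changes n (w m) (k m)) / k m ^ n) \<longlonglongrightarrow> L"
  shows "\<rho> (\<lambda>i\<in>{..<n}. tanh (u i)) * (\<Prod>i<n. 1 - (tanh (u i))\<^sup>2) = L"
proof -
  let ?D = "{-1<..<1::real}"
  let ?P = "\<Pi>\<^sub>M i\<in>{..<n}. restrict_space lborel ?D"
  define y where "y = (\<lambda>i\<in>{..<n}. tanh (u i))"
  define h where "h m = 1 / real (Suc m)" for m
  have h: "0 < h m" for m by (simp add: h_def)
  have h0: "h \<longlonglongrightarrow> 0" unfolding h_def by real_asymp
  define B where "B m i = {tanh (u i)..<tanh (u i + h m)}" for m i
  define E where "E m = zero_moment n u (h m)" for m
  define V where "V m = (\<Prod>i<n. tanh (u i + h m) - tanh (u i))" for m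
  define S where "S = (\<Prod>i<n. 1 - (tanh (u i))\<^sup>2)"
  have yD: "y \<in> {..<n} \<rightarrow>\<^sub>E ?D" using abs_tanh_less_1 by (auto simp: y_def abs_less_iff)
  have \<rho>0: "0 \<le> \<rho> x" if "x \<in> {..<n} \<rightarrow>\<^sub>E ?D" for x
    using corr that unfolding correlation_function_def by blast
  have \<rho>m[measurable]: "\<rho> \<in> borel_measurable ?P"
    using corr unfolding correlation_function_def by blast
  have Bs: "B m i \<in> sets borel" "B m i \<subseteq> ?D" for m i
    using abs_tanh_less_1[of "u i"] abs_tanh_less_1[of "u i + h m"] by (auto simp: B_def)
  have V0: "0 \<le> V m" for m
    unfolding V_def using h[of m] by (intro prod_nonneg) auto
  have emV: "emeasure ?P (Pi\<^sub>E {..<n} (B m)) = ennreal (V m)" for m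
  proof -
    have "emeasure ?P (Pi\<^sub>E {..<n} (B m)) = (\<Prod>i<n. emeasure lborel (B m i))"
      by (rule emeasure_PiM_restrict_box) (use Bs in auto)
    also have "\<dots> = (\<Prod>i<n. ennreal (tanh (u i + h m) - tanh (u i)))"
      using h[of m] by (intro prod.cong refl) (simp add: B_def)
    finally show ?thesis unfolding V_def using h[of m] by (subst (asm) prod_ennreal) auto
  qed
  have boxs[measurable]: "Pi\<^sub>E {..<n} (B m) \<in> sets ?P" for m
    by (rule emeasure_PiM_restrict_box) (use Bs in auto)
  have Vlim: "(\<lambda>m. V m / h m ^ n) \<longlonglongrightarrow> S"
  proof -
    have "(\<lambda>m. (tanh (u i + h m) - tanh (u i)) / h m) \<longlonglongrightarrow> 1 - (tanh (u i))\<^sup>2" for i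
    proof -
      have "(tanh has_real_derivative 1 - (tanh (u i))\<^sup>2) (at (u i))"
        by (auto intro!: derivative_eq_intros)
      then have "(\<lambda>e. (tanh (u i + e) - tanh (u i)) / e) \<midarrow>0\<rightarrow> 1 - (tanh (u i))\<^sup>2"
        by (simp add: DERIV_def)
      moreover have "filterlim h (at 0) sequentially"
        using h0 h by (auto intro!: filterlim_atI always_eventually simp: less_imp_neq[THEN not_sym])
      ultimately show ?thesis by (rule filterlim_compose)
    qed
    then have "(\<lambda>m. \<Prod>i<n. (tanh (u i + h m) - tanh (u i)) / h m) \<longlonglongrightarrow> S"
      unfolding S_def by (intro tendsto_prod)
    then show ?thesis by (simp add: V_def prod_dividef)
  qed
  \<comment> \<open>The moment identity is available only for disjoint sets; distinct
    \<open>u i\<close> make the intervals disjoint once h is below their gaps.\<close>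
  have disj: "\<forall>\<^sub>F m in sequentially. disjoint_family_on (B m) {..<n}"
  proof -
    have "\<forall>\<^sub>F m in sequentially. \<forall>i\<in>{..<n}. \<forall>j\<in>{..<n}. i \<noteq> j \<longrightarrow> h m < \<bar>u i - u j\<bar>"
    proof (intro eventually_ball_finite ballI)
      fix i j assume ij: "i \<in> {..<n}" "j \<in> {..<n}"
      show "\<forall>\<^sub>F m in sequentially. i \<noteq> j \<longrightarrow> h m < \<bar>u i - u j\<bar>"
      proof (cases "i = j")
        case False
        then have "0 < \<bar>u i - u j\<bar>" using inj ij by (auto simp: inj_on_def)
        from order_tendstoD(2)[OF h0 this] show ?thesis by (rule eventually_mono) simp
      qed simp
    qed auto
    then show ?thesis
    proof eventually_elim
      case (elim m)
      have less: "B m i \<inter> B m j = {}" if "i < n" "j < n" "u i < u j" for i j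
      proof -
        have "i \<noteq> j" using that(3) by auto
        then have "h m < \<bar>u i - u j\<bar>" using elim that(1,2) by blast
        then have "u i + h m < u j" using that(3) by simp
        then have "tanh (u i + h m) < tanh (u j)" by simp
        then show ?thesis by (auto simp: B_def)
      qed
      show ?case
        unfolding disjoint_family_on_def
      proof (intro ballI impI)
        fix i j assume "i \<in> {..<n}" "j \<in> {..<n}" "i \<noteq> j"
        then have "u i \<noteq> u j" using inj by (auto simp: inj_on_def)
        then have "u i < u j \<or> u j < u i" by linarith
        then show "B m i \<inter> B m j = {}"
          using less[of i j] less[of j i] \<open>i \<in> {..<n}\<close> \<open>j \<in> {..<n}\<close> by auto
      qed
    qed
  qed
  \<comment> \<open>Both approximations carry an error \<epsilon>: one multiplies the volume and
    contributes \<epsilon> S, the other multiplies h^n and contributes \<epsilon>.\<close>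
  have close: "\<bar>\<rho> y * S - L\<bar> \<le> \<epsilon> * (1 + S)" if \<epsilon>: "0 < \<epsilon>" for \<epsilon>
  proof -
    obtain \<delta> where \<delta>: "0 < \<delta>" "\<And>x. x \<in> {..<n} \<rightarrow>\<^sub>E ?D \<Longrightarrow> (\<forall>i<n. \<bar>x i - tanh (u i)\<bar> < \<delta>) \<Longrightarrow> \<bar>\<rho> x - \<rho> y\<bar> < \<epsilon>"
      using cont[OF \<epsilon>] unfolding y_def by blast
    obtain \<delta>' where \<delta>': "0 < \<delta>'" "\<And>h. 0 < h \<Longrightarrow> h < \<delta>' \<Longrightarrow> ennreal ((L - \<epsilon>) * h ^ n) \<le> zero_moment n u h \<and>
       zero_moment n u h \<le> ennreal ((L + \<epsilon>) * h ^ n)"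
      using moment_asymptotics[where n=n and u=u and L=L, OF L lim \<epsilon>] by blast
    have ev: "\<forall>\<^sub>F m in sequentially. (\<rho> y - \<epsilon>) * V m \<le> (L + \<epsilon>) * h m ^ n \<and> (L - \<epsilon>) * h m ^ n \<le> (\<rho> y + \<epsilon>) * V m"
      using disj order_tendstoD(2)[OF h0 \<delta>(1)] order_tendstoD(2)[OF h0 \<delta>'(1)]
    proof eventually_elim
      case (elim m)
      have Eint: "E m = (\<integral>\<^sup>+x. ennreal (\<rho> x) * indicator (Pi\<^sub>E {..<n} (B m)) x \<partial>?P)"
        using corr elim(1) Bs unfolding correlation_function_def E_def zero_moment_def B_def[symmetric] by blast
      have near: "\<bar>\<rho> x - \<rho> y\<bar> < \<epsilon>" if "x \<in> Pi\<^sub>E {..<n} (B m)" for x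
      proof (rule \<delta>(2))
        show "x \<in> {..<n} \<rightarrow>\<^sub>E ?D" using that PiE_mono[of "{..<n}" "B m" "\<lambda>_. ?D"] Bs(2) by blast
        show "\<forall>i<n. \<bar>x i - tanh (u i)\<bar> < \<delta>"
        proof (intro allI impI)
          fix i assume "i < n"
          then have "tanh (u i) \<le> x i" "x i < tanh (u i + h m)" using that by (auto simp: PiE_iff B_def)
          moreover have "\<bar>tanh (u i + h m) - tanh (u i)\<bar> \<le> h m"
            using abs_tanh_diff_le[of "u i + h m" "u i"] h[of m] by simp
          ultimately show "\<bar>x i - tanh (u i)\<bar> < \<delta>" using elim(2) by linarith
        qed
      qed
      have "ennreal ((\<rho> y - \<epsilon>) * V m) = ennreal (\<rho> y - \<epsilon>) * emeasure ?P (Pi\<^sub>E {..<n} (B m))"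
        unfolding emV using V0[of m] by (simp add: ennreal_mult'')
      also have "\<dots> = (\<integral>\<^sup>+x. ennreal (\<rho> y - \<epsilon>) * indicator (Pi\<^sub>E {..<n} (B m)) x \<partial>?P)"
        by (rule nn_integral_cmult_indicator[symmetric]) measurable
      also have "\<dots> \<le> E m"
        unfolding Eint
      proof (rule nn_integral_mono)
        fix x
        show "ennreal (\<rho> y - \<epsilon>) * indicator (Pi\<^sub>E {..<n} (B m)) x \<le> ennreal (\<rho> x) * indicator (Pi\<^sub>E {..<n} (B m)) x"
          using near[of x] by (cases "x \<in> Pi\<^sub>E {..<n} (B m)") (simp_all add: ennreal_leI)
      qed
      also have "E m \<le> ennreal ((L + \<epsilon>) * h m ^ n)"
        using \<delta>'(2)[OF h elim(3)] unfolding E_def by blast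
      finally have 1: "(\<rho> y - \<epsilon>) * V m \<le> (L + \<epsilon>) * h m ^ n"
        using L \<epsilon> h[of m] by (subst (asm) ennreal_le_iff) auto
      have "ennreal ((L - \<epsilon>) * h m ^ n) \<le> E m"
        using \<delta>'(2)[OF h elim(3)] unfolding E_def by blast
      also have "E m \<le> (\<integral>\<^sup>+x. ennreal (\<rho> y + \<epsilon>) * indicator (Pi\<^sub>E {..<n} (B m)) x \<partial>?P)"
        unfolding Eint
      proof (rule nn_integral_mono)
        fix x
        show "ennreal (\<rho> x) * indicator (Pi\<^sub>E {..<n} (B m)) x \<le> ennreal (\<rho> y + \<epsilon>) * indicator (Pi\<^sub>E {..<n} (B m)) x"
          using near[of x] by (cases "x \<in> Pi\<^sub>E {..<n} (B m)") (simp_all add: ennreal_leI)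
      qed
      also have "\<dots> = ennreal (\<rho> y + \<epsilon>) * emeasure ?P (Pi\<^sub>E {..<n} (B m))"
        by (rule nn_integral_cmult_indicator) measurable
      also have "\<dots> = ennreal ((\<rho> y + \<epsilon>) * V m)"
        unfolding emV using V0[of m] by (simp add: ennreal_mult'')
      finally have 2: "(L - \<epsilon>) * h m ^ n \<le> (\<rho> y + \<epsilon>) * V m"
        using \<rho>0[OF yD] \<epsilon> V0[of m] by (subst (asm) ennreal_le_iff) auto
      from 1 2 show ?case ..
    qed
    have "(\<rho> y - \<epsilon>) * S \<le> L + \<epsilon>"
    proof (rule tendsto_upperbound)
      show "(\<lambda>m. (\<rho> y - \<epsilon>) * (V m / h m ^ n)) \<longlonglongrightarrow> (\<rho> y - \<epsilon>) * S"
        by (intro tendsto_intros Vlim)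
      show "\<forall>\<^sub>F m in sequentially. (\<rho> y - \<epsilon>) * (V m / h m ^ n) \<le> L + \<epsilon>"
        using ev by eventually_elim (use h in \<open>simp add: divide_le_eq\<close>)
    qed simp
    moreover have "L - \<epsilon> \<le> (\<rho> y + \<epsilon>) * S"
    proof (rule tendsto_lowerbound)
      show "(\<lambda>m. (\<rho> y + \<epsilon>) * (V m / h m ^ n)) \<longlonglongrightarrow> (\<rho> y + \<epsilon>) * S"
        by (intro tendsto_intros Vlim)
      show "\<forall>\<^sub>F m in sequentially. L - \<epsilon> \<le> (\<rho> y + \<epsilon>) * (V m / h m ^ n)"
        using ev by eventually_elim (use h in \<open>simp add: le_divide_eq\<close>)
    qed simp
    ultimately show ?thesis by (simp add: abs_le_iff algebra_simps)
  qed
  have "0 \<le> S"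
    unfolding S_def using abs_tanh_less_1 by (intro prod_nonneg) (simp add: abs_square_le_1 less_imp_le)
  have "\<bar>\<rho> y * S - L\<bar> \<le> 0 + e" if "0 < e" for e
    using close[of "e / (1 + S)"] that \<open>0 \<le> S\<close> by simp
  then have "\<bar>\<rho> y * S - L\<bar> \<le> 0" by (rule field_le_epsilon)
  then show ?thesis unfolding S_def y_def by simp
qed

end

section \<open>The normalized correlation\<close>

text \<open>The limiting two-point intensity in the coordinate u divided by the square 1/pi^2 of the
  one-point intensity, written in S = sinh d. At S = 0 the convention 1/0 = 0 does no harm: the
  factor S already gives 0.\<close>

definition profile :: "real \<Rightarrow> real" where
  "profile S = S * (S + arctan (1 / S)) / (1 + S\<^sup>2)"

lemma profile_0[simp]: "profile 0 = 0"
  by (simp add: profile_def)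

lemma profile_sinh:
  assumes "0 < d"
  shows "profile (sinh d) = tanh d * (tanh d + 1 / cosh d * arctan ((1 / cosh d) / tanh d))"
proof -
  have "1 + (sinh d)\<^sup>2 = (cosh d)\<^sup>2" using cosh_square_eq[of d] by simp
  moreover have "(1 / cosh d) / tanh d = 1 / sinh d" by (simp add: tanh_def)
  ultimately show ?thesis
    unfolding profile_def by (simp add: tanh_def power2_eq_square field_simps)
qed

lemma arctan_less_self:
  fixes x :: real
  assumes "0 < x"
  shows "arctan x < x"
proof -
  obtain z where z: "0 < z" "arctan x - arctan 0 = (x - 0) * inverse (1 + z\<^sup>2)"
    using MVT2[OF assms, of arctan "\<lambda>z. inverse (1 + z\<^sup>2)"] DERIV_arctan by blast
  have "0 < z\<^sup>2" using z(1) by simp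
  then have "inverse (1 + z\<^sup>2) < 1" by (intro inverse_less_1_iff[THEN iffD2]) simp
  then have "x * inverse (1 + z\<^sup>2) < x * 1" using assms by (rule mult_strict_left_mono)
  then show ?thesis using z(2) by simp
qed

lemma profile_strict_mono: "strict_mono_on {0..} profile"
proof (rule strict_mono_onI)
  fix r S :: real assume rS: "r \<in> {0..}" "S \<in> {0..}" "r < S"
  show "profile r < profile S"
  \<comment> \<open>The argument 1/S of the arctangent is singular at 0, so the derivative is used
    only for positive S; from 0 it suffices that \<open>profile\<close> is positive.\<close>
  proof (cases "r = 0")
    case True
    have "0 < 1 + S\<^sup>2" by (simp add: add_pos_nonneg)
    moreover have "0 < arctan (1 / S)" using rS by simp
    ultimately show ?thesis
      using True rS by (auto simp: profile_def intro!: divide_pos_pos mult_pos_pos add_pos_pos)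
  next
    case False
    with rS have r: "0 < r" by simp
    show ?thesis
    proof (rule DERIV_pos_imp_increasing[OF rS(3)])
      fix x assume "r \<le> x" "x \<le> S"
      with r have x: "0 < x" by simp
      define A where "A = arctan (1 / x)"
      have A: "0 < A" "A < 1 / x" using x arctan_less_self[of "1 / x"] by (auto simp: A_def)
      have p: "0 < 1 + x\<^sup>2" by (simp add: add_pos_nonneg)
      have dA: "((\<lambda>S. arctan (1 / S)) has_real_derivative - 1 / (1 + x\<^sup>2)) (at x)"
      proof -
        have "((\<lambda>S. 1 / S) has_real_derivative - 1 / (x * x)) (at x)"
          using x by (auto intro!: derivative_eq_intros)
        from DERIV_chain2[where f=arctan and g="\<lambda>S. 1 / S", OF DERIV_arctan this]
        have "((\<lambda>S. arctan (1 / S)) has_real_derivative inverse (1 + (1 / x)\<^sup>2) * (- 1 / (x * x))) (at x)" .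
        moreover have "inverse (1 + (1 / x)\<^sup>2) * (- 1 / (x * x)) = - 1 / (1 + x\<^sup>2)"
          using x p by (simp add: divide_simps power2_eq_square)
        ultimately show ?thesis by simp
      qed
      have "((\<lambda>S. S + arctan (1 / S)) has_real_derivative 1 + - 1 / (1 + x\<^sup>2)) (at x)"
        by (rule DERIV_add[OF DERIV_ident dA])
      from DERIV_mult[OF DERIV_ident this]
      have num: "((\<lambda>S. S * (S + arctan (1 / S))) has_real_derivative 1 * (x + A) + x * (1 + - 1 / (1 + x\<^sup>2))) (at x)"
        by (simp add: A_def mult.commute)
      have den: "((\<lambda>S. 1 + S\<^sup>2) has_real_derivative 2 * x) (at x)"
        by (auto intro!: derivative_eq_intros)
      have "profile = (\<lambda>S. S * (S + arctan (1 / S)) / (1 + S\<^sup>2))"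
        by (simp add: profile_def fun_eq_iff)
      then have "(profile has_real_derivative
         ((1 * (x + A) + x * (1 + - 1 / (1 + x\<^sup>2))) * (1 + x\<^sup>2) - (x * (x + A)) * (2 * x)) / ((1 + x\<^sup>2) * (1 + x\<^sup>2))) (at x)"
        using DERIV_divide[OF num den] p by (simp add: A_def)
      moreover have "(1 * (x + A) + x * (1 + - 1 / (1 + x\<^sup>2))) * (1 + x\<^sup>2) - (x * (x + A)) * (2 * x) = x + A * (1 - x\<^sup>2)"
        using p by (simp add: field_simps power2_eq_square)
      moreover have "0 < x + A * (1 - x\<^sup>2)"
      \<comment> \<open>For x \<le> 1 both summands are nonnegative and the first is positive. For x
        > 1 the second is negative, and A < 1/x leaves more than x - (x - 1/x) = 1/x.\<close>
      proof (cases "x \<le> 1")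
        case True
        then have "0 \<le> 1 - x\<^sup>2" using x by (simp add: power_le_one)
        then show ?thesis using A x by (simp add: add_pos_nonneg)
      next
        case False
        then have "0 < x\<^sup>2 - 1" by (simp add: one_less_power)
        then have "A * (x\<^sup>2 - 1) < 1 / x * (x\<^sup>2 - 1)" using A by (intro mult_strict_right_mono) auto
        also have "\<dots> = x - 1 / x" using x by (simp add: field_simps power2_eq_square)
        also have "\<dots> < x" using x by simp
        finally show ?thesis by (simp add: algebra_simps)
      qed
      ultimately show "\<exists>y. DERIV profile x :> y \<and> 0 < y"
        using p by (intro exI[of _ "(x + A * (1 - x\<^sup>2)) / ((1 + x\<^sup>2) * (1 + x\<^sup>2))"]) simp
    qed
  qed
qed

lemma profile_at_top: "(profile \<longlongrightarrow> 1) at_top"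
  unfolding profile_def by real_asymp

text \<open>The limit at infinity only bounds \<open>profile\<close> by 1; one further step to S + 1
  makes the inequality strict.\<close>

lemma profile_less_1:
  assumes "0 \<le> S"
  shows "profile S < 1"
proof -
  have "profile S < profile (S + 1)"
    using strict_mono_onD[OF profile_strict_mono, of S "S + 1"] assms by simp
  also have "profile (S + 1) \<le> 1"
  proof (rule tendsto_lowerbound[OF profile_at_top])
    show "\<forall>\<^sub>F x in at_top. profile (S + 1) \<le> profile x"
      using eventually_gt_at_top[of "S + 1"]
      by eventually_elim (use assms strict_mono_onD[OF profile_strict_mono] in \<open>auto intro!: less_imp_le\<close>)
  qed simp
  finally show ?thesis .
qed

lemma profile_nonneg: "0 \<le> S \<Longrightarrow> 0 \<le> profile S"
  by (auto simp: profile_def intro!: divide_nonneg_pos mult_nonneg_nonneg add_nonneg_nonneg add_pos_nonneg)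

text \<open>The arctangent stays below pi/2 < 2, so \<open>profile\<close> is squeezed under f (f +
  2), whatever 1/f does near 0.\<close>

lemma tendsto_profile_0:
  assumes "(f \<longlongrightarrow> 0) F" "\<And>x. 0 \<le> f x"
  shows "((\<lambda>x. profile (f x)) \<longlongrightarrow> 0) F"
proof (rule tendsto_sandwich)
  show "\<forall>\<^sub>F x in F. profile (f x) \<le> f x * (f x + 2)"
  proof (intro always_eventually allI)
    fix x
    have "arctan (1 / f x) \<le> 2" using arctan_ubound[of "1 / f x"] pi_half_less_two by linarith
    then have "f x * (f x + arctan (1 / f x)) \<le> f x * (f x + 2)"
      using assms(2) by (intro mult_left_mono) auto
    moreover have "profile (f x) \<le> f x * (f x + arctan (1 / f x))"
    proof -
      have le: "y / (1 + r\<^sup>2) \<le> y" if "0 \<le> y" for y r :: real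
        using that by (simp add: divide_le_eq add_pos_nonneg distrib_left)
      have "0 \<le> f x * (f x + arctan (1 / f x))"
        using assms(2)[of x] by (intro mult_nonneg_nonneg add_nonneg_nonneg) auto
      then show ?thesis unfolding profile_def by (rule le)
    qed
    ultimately show "profile (f x) \<le> f x * (f x + 2)" by simp
  qed
  show "\<forall>\<^sub>F x in F. 0 \<le> profile (f x)"
    using assms(2) by (intro always_eventually allI profile_nonneg)
  show "((\<lambda>x. f x * (f x + 2)) \<longlongrightarrow> 0) F"
    using tendsto_mult[OF assms(1) tendsto_add[OF assms(1) tendsto_const[of 2]]] by simp
qed simp_all

text \<open>In the original coordinates this is |t - s| / sqrt ((1 - s^2) (1 - t^2)) on
  (-1,1).\<close>

definition separation :: "real \<Rightarrow> real \<Rightarrow> real" where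
  "separation s t = sinh \<bar>artanh t - artanh s\<bar>"

lemma separation_nonneg: "0 \<le> separation s t"
  by (simp add: separation_def)

lemma artanh_less:
  assumes "- 1 < s" "s < t" "t < (1::real)"
  shows "artanh s < artanh t"
proof -
  have "tanh (artanh s) < tanh (artanh t)" using assms by (simp add: tanh_artanh_real)
  then show ?thesis by simp
qed

section \<open>Closed forms of the two correlation functions\<close>

context gaussian_coefficients
begin

text \<open>In the coordinate u the zeros have constant intensity 1/pi; the Jacobian 1 - s^2 of tanh
  turns this into Kac's density.\<close>

lemma correlation_1:
  assumes corr: "correlation_function M {-1<..<1} (real_zeros a) 1 (\<lambda>x. \<rho>1 (x 0))"
    and cont: "continuous_on {-1<..<1} \<rho>1" and s: "s \<in> {-1<..<1}"
  shows "\<rho>1 s = 1 / (pi * (1 - s\<^sup>2))"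
proof -
  have th: "tanh (artanh s) = s" using s by (intro tanh_artanh_real) auto
  have "\<rho>1 ((\<lambda>i\<in>{..<1::nat}. tanh (artanh s)) 0) * (\<Prod>i<1::nat. 1 - (tanh (artanh s))\<^sup>2) = 1 / pi"
  proof (rule correlation_function_eq_sign_change_intensity[OF corr])
    fix \<epsilon> :: real assume "0 < \<epsilon>"
    then obtain \<delta> where \<delta>: "0 < \<delta>" "\<And>x. x \<in> {-1<..<1} \<Longrightarrow> dist x s < \<delta> \<Longrightarrow> dist (\<rho>1 x) (\<rho>1 s) < \<epsilon>"
      using cont s unfolding continuous_on_iff by blast
    show "\<exists>\<delta>>0. \<forall>x\<in>{..<1::nat} \<rightarrow>\<^sub>E {-1<..<1}. (\<forall>i<1. \<bar>x i - tanh (artanh s)\<bar> < \<delta>) \<longrightarrow>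
        \<bar>\<rho>1 (x 0) - \<rho>1 ((\<lambda>i\<in>{..<1::nat}. tanh (artanh s)) 0)\<bar> < \<epsilon>"
    proof (intro exI[of _ \<delta>] conjI ballI impI \<delta>(1))
      fix x :: "nat \<Rightarrow> real" assume x: "x \<in> {..<1} \<rightarrow>\<^sub>E {-1<..<1}" "\<forall>i<1. \<bar>x i - tanh (artanh s)\<bar> < \<delta>"
      have "x 0 \<in> {-1<..<1}" using x(1) by (rule PiE_mem) simp
      moreover have "dist (x 0) s < \<delta>" using x(2) by (simp add: th dist_real_def)
      ultimately have "dist (\<rho>1 (x 0)) (\<rho>1 s) < \<epsilon>" by (rule \<delta>(2))
      then show "\<bar>\<rho>1 (x 0) - \<rho>1 ((\<lambda>i\<in>{..<1::nat}. tanh (artanh s)) 0)\<bar> < \<epsilon>"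
        by (simp add: th dist_real_def)
    qed
  next
    fix w :: "nat \<Rightarrow> nat \<Rightarrow> real" and k :: "nat \<Rightarrow> real"
    assume "k \<longlonglongrightarrow> 0" "\<And>m. 0 < k m"
    from sign_change_density[OF this, of "\<lambda>m. w m 0"]
    show "(\<lambda>m. measure M (sign_changes 1 (w m) (k m)) / k m ^ 1) \<longlonglongrightarrow> 1 / pi"
      by (simp add: sign_changes_def)
  qed (auto simp: inj_on_def)
  then have "\<rho>1 s * (1 - s\<^sup>2) = 1 / pi" by (simp add: th)
  moreover have "0 < 1 - s\<^sup>2" using s abs_square_less_1[of s] by auto
  ultimately show ?thesis by (simp add: field_simps)
qed

text \<open>The asymptotics were derived for a positive distance, so the two points are relabelled
  in increasing order; the event is symmetric under the exchange.\<close>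

lemma two_sign_changes_intensity:
  assumes w: "\<And>i. i < 2 \<Longrightarrow> (\<lambda>m. w m i) \<longlonglongrightarrow> u i" and k: "k \<longlonglongrightarrow> 0" "\<And>m::nat. 0 < k m" and ne: "u 0 \<noteq> u 1"
  shows "(\<lambda>m. measure M (sign_changes 2 (w m) (k m)) / k m ^ 2) \<longlonglongrightarrow> profile (sinh \<bar>u 1 - u 0\<bar>) / pi\<^sup>2"
proof -
  have lim: "(\<lambda>m. measure M (sign_changes 2 (w m) (k m)) / k m ^ 2) \<longlonglongrightarrow> profile (sinh (u j - u i)) / pi\<^sup>2"
    if ij: "{i, j} = {0, 1}" "u i < u j" for i j
  proof -
    have i2: "i < 2" "j < 2" using ij by (auto simp: doubleton_eq_iff)
    have "(\<lambda>m. w m j - w m i) \<longlonglongrightarrow> u j - u i"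
      by (intro tendsto_diff w i2)
    from two_sign_changes_density[OF k this, of "\<lambda>m. w m i"] ij(2)
    have "(\<lambda>m. measure M {\<omega> \<in> space M. random_series a \<omega> (tanh (w m i)) * random_series a \<omega> (tanh (w m i + k m)) < 0 \<and>
      random_series a \<omega> (tanh (w m j)) * random_series a \<omega> (tanh (w m j + k m)) < 0} / (k m)\<^sup>2)
      \<longlonglongrightarrow> tanh (u j - u i) / pi\<^sup>2 * (tanh (u j - u i) + 1 / cosh (u j - u i) * arctan ((1 / cosh (u j - u i)) / tanh (u j - u i)))"
      by simp
    moreover have "sign_changes 2 (w m) (k m) = {\<omega> \<in> space M. random_series a \<omega> (tanh (w m i)) * random_series a \<omega> (tanh (w m i + k m)) < 0 \<and>
      random_series a \<omega> (tanh (w m j)) * random_series a \<omega> (tanh (w m j + k m)) < 0}" for m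
      using ij(1) unfolding sign_changes_def by (auto simp: doubleton_eq_iff less_2_cases_iff)
    ultimately show ?thesis
      using ij(2) by (subst profile_sinh) simp_all
  qed
  consider "u 0 < u 1" | "u 1 < u 0" using ne by linarith
  then show ?thesis
    using lim[of 0 1] lim[of 1 0] by cases (auto simp: insert_commute)
qed

text \<open>The Jacobian factors here are those of the two one-point functions, so they cancel in
  the normalised correlation and \<open>profile\<close> alone remains.\<close>

lemma correlation_2_off_diagonal:
  assumes corr: "correlation_function M {-1<..<1} (real_zeros a) 2 (\<lambda>x. \<rho>2 (x 0) (x 1))"
    and cont: "continuous_on ({-1<..<1} \<times> {-1<..<1}) (\<lambda>(s, t). \<rho>2 s t)"
    and st: "s \<in> {-1<..<1}" "t \<in> {-1<..<1}" "s \<noteq> t"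
  shows "\<rho>2 s t = profile (separation s t) / (pi\<^sup>2 * (1 - s\<^sup>2) * (1 - t\<^sup>2))"
proof -
  define u where "u i = (if i = 0 then artanh s else artanh t)" for i :: nat
  have th: "tanh (u 0) = s" "tanh (u 1) = t" using st by (auto simp: u_def intro!: tanh_artanh_real)
  have ne: "u 0 \<noteq> u 1" using th st(3) by metis
  have "\<rho>2 ((\<lambda>i\<in>{..<2::nat}. tanh (u i)) 0) ((\<lambda>i\<in>{..<2::nat}. tanh (u i)) 1) * (\<Prod>i<2::nat. 1 - (tanh (u i))\<^sup>2) = profile (sinh \<bar>u 1 - u 0\<bar>) / pi\<^sup>2"
  proof (rule correlation_function_eq_sign_change_intensity[OF corr])
    show "inj_on u {..<2}" using ne by (auto simp: inj_on_def less_2_cases_iff)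
    show "0 \<le> profile (sinh \<bar>u 1 - u 0\<bar>) / pi\<^sup>2" by (simp add: profile_nonneg)
    fix \<epsilon> :: real assume "0 < \<epsilon>"
    moreover have "(s, t) \<in> {-1<..<1} \<times> {-1<..<1}" using st by simp
    ultimately obtain \<delta> where \<delta>: "0 < \<delta>" "\<And>z. z \<in> {-1<..<1} \<times> {-1<..<1} \<Longrightarrow> dist z (s, t) < \<delta> \<Longrightarrow>
        dist ((\<lambda>(s, t). \<rho>2 s t) z) ((\<lambda>(s, t). \<rho>2 s t) (s, t)) < \<epsilon>"
      using cont unfolding continuous_on_iff by metis
    show "\<exists>\<delta>>0. \<forall>x\<in>{..<2::nat} \<rightarrow>\<^sub>E {-1<..<1}. (\<forall>i<2. \<bar>x i - tanh (u i)\<bar> < \<delta>) \<longrightarrow>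
        \<bar>\<rho>2 (x 0) (x 1) - \<rho>2 ((\<lambda>i\<in>{..<2::nat}. tanh (u i)) 0) ((\<lambda>i\<in>{..<2::nat}. tanh (u i)) 1)\<bar> < \<epsilon>"
    proof (intro exI[of _ "\<delta> / 2"] conjI ballI impI)
      show "0 < \<delta> / 2" using \<delta> by simp
      fix x :: "nat \<Rightarrow> real" assume x: "x \<in> {..<2} \<rightarrow>\<^sub>E {-1<..<1}" "\<forall>i<2. \<bar>x i - tanh (u i)\<bar> < \<delta> / 2"
      then have near: "\<bar>x 0 - s\<bar> < \<delta> / 2" "\<bar>x 1 - t\<bar> < \<delta> / 2"
        using th by (metis pos2, metis one_less_numeral_iff semiring_norm(76))
      have "dist (x 0, x 1) (s, t) \<le> \<bar>x 0 - s\<bar> + \<bar>x 1 - t\<bar>"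
        using sqrt_sum_squares_le_sum_abs[of "\<bar>x 0 - s\<bar>" "\<bar>x 1 - t\<bar>"] by (simp add: dist_Pair_Pair dist_real_def)
      also have "\<dots> < \<delta>" using near by simp
      finally have "dist (\<rho>2 (x 0) (x 1)) (\<rho>2 s t) < \<epsilon>"
        using \<delta>(2)[of "(x 0, x 1)"] x(1) by (auto simp: PiE_iff)
      then show "\<bar>\<rho>2 (x 0) (x 1) - \<rho>2 ((\<lambda>i\<in>{..<2::nat}. tanh (u i)) 0) ((\<lambda>i\<in>{..<2::nat}. tanh (u i)) 1)\<bar> < \<epsilon>"
        using th by (simp add: dist_real_def)
    qed
  next
    fix w :: "nat \<Rightarrow> nat \<Rightarrow> real" and k :: "nat \<Rightarrow> real"
    assume "\<And>i. i < 2 \<Longrightarrow> (\<lambda>m. w m i) \<longlonglongrightarrow> u i" "k \<longlonglongrightarrow> 0" "\<And>m. 0 < k m"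
    then show "(\<lambda>m. measure M (sign_changes 2 (w m) (k m)) / k m ^ 2) \<longlonglongrightarrow> profile (sinh \<bar>u 1 - u 0\<bar>) / pi\<^sup>2"
      by (rule two_sign_changes_intensity[OF _ _ _ ne])
  qed
  then have "\<rho>2 s t * ((1 - s\<^sup>2) * (1 - t\<^sup>2)) = profile (separation s t) / pi\<^sup>2"
    using th by (simp add: numeral_2_eq_2 separation_def u_def)
  moreover have "0 < 1 - s\<^sup>2" "0 < 1 - t\<^sup>2" using st abs_square_less_1[of s] abs_square_less_1[of t] by auto
  moreover have "x = p / (c * A * B)" if "x * (A * B) = p / c" "0 < A" "0 < B" "0 < c" for x p c A B :: real
    using that by (simp add: field_simps)
  ultimately show ?thesis by simp
qed

end

section \<open>Behaviour of the separation at the diagonal and the ends, and the conclusion\<close>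

lemma tendsto_separation_self:
  assumes "s \<in> {-1<..<1}"
  shows "((\<lambda>t. separation s t) \<longlongrightarrow> 0) (at s)"
proof -
  have "((\<lambda>t. sinh \<bar>artanh t - artanh s\<bar>) \<longlongrightarrow> sinh \<bar>artanh s - artanh s\<bar>) (at s)"
    using assms by (intro tendsto_intros) auto
  then show ?thesis by (simp add: separation_def)
qed

lemma filterlim_separation:
  "filterlim (separation s) at_top (at_left 1)" "filterlim (separation s) at_top (at_right (-1))"
proof -
  have "filterlim (\<lambda>t::real. \<bar>artanh t - c\<bar>) at_top (at_left 1)"
    "filterlim (\<lambda>t::real. \<bar>artanh t - c\<bar>) at_top (at_right (-1))" for c
    unfolding artanh_def by real_asymp+
  note this[of "artanh s"]
  from this[THEN filterlim_compose[OF sinh_real_at_top]]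
  show "filterlim (separation s) at_top (at_left 1)" "filterlim (separation s) at_top (at_right (-1))"
    unfolding separation_def[abs_def] .
qed

theorem corollary2p2:
  fixes M :: "'a measure"
    and a :: "nat \<Rightarrow> 'a \<Rightarrow> real"
    and \<rho>1 :: "real \<Rightarrow> real"
    and \<rho>2 :: "real \<Rightarrow> real \<Rightarrow> real"
  defines "R \<equiv> norm_corr_ext \<rho>1 \<rho>2"
  assumes "prob_space M"
    and "prob_space.indep_vars M (\<lambda>_. borel) a UNIV"
    and "\<And>k. distributed M lborel (a k) (\<lambda>x. ennreal (std_normal_density x))"
    and "correlation_function M {-1<..<1} (real_zeros a) 1 (\<lambda>x. \<rho>1 (x 0))"
    and "correlation_function M {-1<..<1} (real_zeros a) 2 (\<lambda>x. \<rho>2 (x 0) (x 1))"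
    and "continuous_on {-1<..<1} \<rho>1"
    and "continuous_on ({-1<..<1} \<times> {-1<..<1}) (\<lambda>(s, t). \<rho>2 s t)"
  shows "(\<forall>s\<in>{-1<..<1}.
            R s s = 0 \<and>
            (norm_corr \<rho>1 \<rho>2 s \<longlongrightarrow> R s 1) (at_left 1) \<and> R s 1 = 1 \<and>
            (norm_corr \<rho>1 \<rho>2 s \<longlongrightarrow> R s (-1)) (at_right (-1)) \<and> R s (-1) = 1 \<and>
            strict_mono_on {s..1} (R s) \<and>
            strict_antimono_on {-1..s} (R s)) \<and>
         (\<forall>s\<in>{-1<..<1}. \<forall>t\<in>{-1<..<1}. \<rho>2 s t \<le> \<rho>1 s * \<rho>1 t)"
proof -
  interpret gaussian_coefficients M a
    using assms(2-4) by (simp add: gaussian_coefficients_def gaussian_coefficients_axioms_def)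
  let ?D = "{-1<..<1::real}"
  have pos: "0 < 1 - s\<^sup>2" if "s \<in> ?D" for s :: real
    using that abs_square_less_1[of s] by auto
  have \<rho>1: "\<rho>1 s = 1 / (pi * (1 - s\<^sup>2))" if "s \<in> ?D" for s
    by (rule correlation_1) (use assms that in auto)
  have off: "\<rho>2 s t = profile (separation s t) / (pi\<^sup>2 * (1 - s\<^sup>2) * (1 - t\<^sup>2))" if "s \<in> ?D" "t \<in> ?D" "s \<noteq> t" for s t
    by (rule correlation_2_off_diagonal) (use assms that in auto)
  \<comment> \<open>Disjoint boxes never meet the diagonal, so the value there is forced by
    continuity from the off-diagonal formula, whose numerator tends to 0.\<close>
  have diag: "\<rho>2 s s = 0" if s: "s \<in> ?D" for s
  proof (rule tendsto_unique)
    have "continuous_on ?D (\<lambda>t. (s, t))" "(\<lambda>t. (s, t)) ` ?D \<subseteq> ?D \<times> ?D"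
      using s by (auto intro!: continuous_intros)
    from continuous_on_compose2[OF assms(8) this] have "continuous_on ?D (\<lambda>t. \<rho>2 s t)" by simp
    then show "((\<lambda>t. \<rho>2 s t) \<longlongrightarrow> \<rho>2 s s) (at s)"
      using s by (simp add: continuous_on_eq_continuous_at isCont_def)
    have "((\<lambda>t. profile (separation s t) / (pi\<^sup>2 * (1 - s\<^sup>2) * (1 - t\<^sup>2))) \<longlongrightarrow> 0 / (pi\<^sup>2 * (1 - s\<^sup>2) * (1 - s\<^sup>2))) (at s)"
      using pos[OF s] by (intro tendsto_intros tendsto_profile_0 tendsto_separation_self[OF s] separation_nonneg) auto
    moreover have "\<forall>\<^sub>F t in at s. profile (separation s t) / (pi\<^sup>2 * (1 - s\<^sup>2) * (1 - t\<^sup>2)) = \<rho>2 s t"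
    proof -
      have "\<forall>\<^sub>F t in at s. t \<in> ?D" using s by (intro eventually_at_in_open') auto
      then show ?thesis using eventually_neq_at_within[of s s UNIV]
        by eventually_elim (use off[OF s] in auto)
    qed
    ultimately show "((\<lambda>t. \<rho>2 s t) \<longlongrightarrow> 0) (at s)"
      by (auto intro: Lim_transform_eventually)
  qed simp
  have NC: "norm_corr \<rho>1 \<rho>2 s t = profile (separation s t)" if st: "s \<in> ?D" "t \<in> ?D" for s t
  proof (cases "s = t")
    case True
    then show ?thesis using diag st by (simp add: norm_corr_def separation_def)
  next
    case False
    have "p / (c\<^sup>2 * A * B) / (1 / (c * A) * (1 / (c * B))) = p" if "0 < A" "0 < B" "0 < c" for p c A B :: real
      using that by (simp add: field_simps power2_eq_square)
    from this[OF pos[OF st(1)] pos[OF st(2)] pi_gt_zero] show ?thesis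
      unfolding norm_corr_def \<rho>1[OF st(1)] \<rho>1[OF st(2)] off[OF st False] .
  qed
  have lim1: "(norm_corr \<rho>1 \<rho>2 s \<longlongrightarrow> 1) (at_left 1)" if s: "s \<in> ?D" for s
  proof (rule Lim_transform_eventually)
    show "((\<lambda>t. profile (separation s t)) \<longlongrightarrow> 1) (at_left 1)"
      by (rule filterlim_compose[OF profile_at_top filterlim_separation(1)])
    have "\<forall>\<^sub>F t in at_left 1. t \<in> ?D" by (rule eventually_at_leftI[of "-1"]) auto
    then show "\<forall>\<^sub>F t in at_left 1. profile (separation s t) = norm_corr \<rho>1 \<rho>2 s t"
      by eventually_elim (rule NC[OF s, symmetric])
  qed
  have lim2: "(norm_corr \<rho>1 \<rho>2 s \<longlongrightarrow> 1) (at_right (-1))" if s: "s \<in> ?D" for s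
  proof (rule Lim_transform_eventually)
    show "((\<lambda>t. profile (separation s t)) \<longlongrightarrow> 1) (at_right (-1))"
      by (rule filterlim_compose[OF profile_at_top filterlim_separation(2)])
    have "\<forall>\<^sub>F t in at_right (-1). t \<in> ?D" by (rule eventually_at_rightI[of _ 1]) auto
    then show "\<forall>\<^sub>F t in at_right (-1). profile (separation s t) = norm_corr \<rho>1 \<rho>2 s t"
      by eventually_elim (rule NC[OF s, symmetric])
  qed
  have R1: "R s 1 = 1" "R s (-1) = 1" if s: "s \<in> ?D" for s
    unfolding R_def norm_corr_ext_def using tendsto_Lim[OF _ lim1[OF s]] tendsto_Lim[OF _ lim2[OF s]] by simp_all
  have R: "R s t = profile (separation s t)" if "s \<in> ?D" "t \<in> ?D" for s t
    using NC[OF that] that unfolding R_def norm_corr_ext_def by simp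
  \<comment> \<open>One comparison serves both monotonicity claims. At interior points it is strict
    monotonicity of \<open>profile\<close>; if t' is an end point, the value there is the limit 1,
    which \<open>profile\<close> never attains.\<close>
  have R_less: "R s t < R s t'"
    if s: "s \<in> ?D" and t: "t \<in> ?D" and t': "t' \<in> ?D \<Longrightarrow> separation s t < separation s t'" "t' \<in> ?D \<or> t' = 1 \<or> t' = -1" for s t t'
  proof (cases "t' \<in> ?D")
    case True
    then show ?thesis
      using strict_mono_onD[OF profile_strict_mono _ _ t'(1)[OF True]] separation_nonneg
      unfolding R[OF s t] R[OF s True] by simp
  next
    case False
    then have "R s t' = 1" using R1[OF s] t'(2) by auto
    then show ?thesis using profile_less_1[OF separation_nonneg] unfolding R[OF s t] by simp
  qed
  have "strict_mono_on {s..1} (R s)" if s: "s \<in> ?D" for s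
  proof (rule strict_mono_onI)
    fix t t' assume tt': "t \<in> {s..1}" "t' \<in> {s..1}" "t < t'"
    show "R s t < R s t'"
    proof (rule R_less[OF s])
      assume "t' \<in> ?D"
      then have "artanh s \<le> artanh t" "artanh t < artanh t'"
        using s tt' artanh_less[of s t] artanh_less[of t t'] by (cases "s = t"; auto)+
      then show "separation s t < separation s t'" by (simp add: separation_def)
    qed (use s tt' in auto)
  qed
  moreover have "strict_antimono_on {-1..s} (R s)" if s: "s \<in> ?D" for s
  proof (rule monotone_onI)
    fix t t' assume tt': "t \<in> {-1..s}" "t' \<in> {-1..s}" "t < t'"
    show "R s t' < R s t"
    proof (rule R_less[OF s])
      assume "t \<in> ?D"
      then have "artanh t' \<le> artanh s" "artanh t < artanh t'"
        using s tt' artanh_less[of t' s] artanh_less[of t t'] by (cases "s = t'"; auto)+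
      then show "separation s t' < separation s t" by (simp add: separation_def)
    qed (use s tt' in auto)
  qed
  moreover have "R s s = 0" if "s \<in> ?D" for s
    unfolding R[OF that that] by (simp add: separation_def)
  moreover have "\<rho>2 s t \<le> \<rho>1 s * \<rho>1 t" if st: "s \<in> ?D" "t \<in> ?D" for s t
  proof -
    have p: "0 < \<rho>1 s * \<rho>1 t" unfolding \<rho>1[OF st(1)] \<rho>1[OF st(2)] using pos[OF st(1)] pos[OF st(2)] by simp
    have "\<rho>2 s t / (\<rho>1 s * \<rho>1 t) \<le> 1"
      using profile_less_1[OF separation_nonneg[of s t]] unfolding NC[OF st, unfolded norm_corr_def] by simp
    then show ?thesis using p by (simp add: divide_le_eq)
  qed
  ultimately show ?thesis
    using lim1 lim2 R1 by auto
qed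

end
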